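(* Let $E$ be a finite directed graph, $\mathsf k$ a field, $L_{\mathsf k}(E)$ the Leavitt path algebra of $E$ with coefficients in $\mathsf k$, and $T_E$ the talented monoid of $E$, regarded as a $\mathbb Z$-monoid. Then the following are equivalent. (1) $E$ is a graph with disjoint cycles. (2) $T_E$ has a composition series of cyclic and non-comparable types, i.e. there is a chain of $\mathbb Z$-order-ideals $0=I_0\subset I_1\subset\dots\subset I_n=T_E$ such that each quotient $I_{i+1}/I_i$, $0\le i\le n-1$, is a simple $\mathbb Z$-monoid which is either cyclic or non-comparable. (3) $L_{\mathsf k}(E)$ has finite Gelfand-Kirillov dimension.
   Context: A directed graph $E=(E^0,E^1,r,s)$ has vertex set $E^0$, edge set $E^1$ and range and source maps $r,s:E^1\to E^0$; it is finite if $E^0$ and $E^1$ are finite. A vertex $v$ is a sink if $s^{-1}(v)=\emptyset$. A path is a sequence of edges $e_1\cdots e_n$ with $r(e_i)=s(e_{i+1})$ (vertices are paths of length $0$). A cycle is a path $e_1\cdots e_n$, $n\ge 1$, with $r(e_n)=s(e_1)$ and $s(e_1),\dots,s(e_n)$ pairwise distinct; it is based at $s(e_1)$. $E$ is a graph with disjoint cycles if every vertex is the base of at most one cycle (acyclic graphs are allowed). The Leavitt path algebra $L_{\mathsf k}(E)$ of a finite graph is the $\mathsf k$-algebra generated by $v\in E^0$ and $e,e^*$ ($e\in E^1$) subject to: $vw=\delta_{v,w}v$; $s(e)e=e=er(e)$, $r(e)e^*=e^*=e^*s(e)$; $e^*f=\delta_{e,f}r(e)$; and $v=\sum_{e\in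 s^{-1}(v)}ee^*$ for every $v$ that is not a sink. The talented monoid $T_E$ is the commutative monoid generated by $\{v(i)\mid v\in E^0,\ i\in\mathbb Z\}$ subject to $v(i)=\sum_{e\in s^{-1}(v)}r(e)(i+1)$ for all $i\in\mathbb Z$ and all $v\in E^0$ that are not sinks. The group $\mathbb Z$ acts on it by ${}^nv(i)=v(i+n)$. Let $T$ be a commutative monoid on which an abelian group $\Gamma$ acts by monoid automorphisms (a $\Gamma$-monoid; here $\Gamma=\mathbb Z$). Write $a\le b$ if $b=a+c$ for some $c\in T$, and $a\parallel b$ if neither $a\le b$ nor $b\le a$. A $\Gamma$-order-ideal is a submonoid $I$ closed under the $\Gamma$-action such that $a+b\in I$ implies $a,b\in I$. $T/I$ is the quotient of $T$ by the congruence $a\sim_I b$ iff $a+i=b+j$ for some $i,j\in I$. $T$ is simple if its only $\Gamma$-order-ideals are $0$ and $T$. A $\Gamma$-monoid (or $\Gamma$-order-ideal) $I$ is cyclic if for every $x\in I$ there is $0\ne\alpha\in\Gamma$ with ${}^\alpha x=x$; it is non-comparable if ${}^\alpha x\parallel x$ for every $0\ne x\in I$ and every $0\neq\alpha\in\Gamma$. The symbol $\subset$ denotes strict inclusion. *)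

theory Defs
  imports
    "Graph_Theory.Graph_Theory"
    "Jordan_Normal_Form.Missing_VectorSpace"
    "HOL-Library.Extended_Real"
    "HOL-Library.Multiset"
    "HOL-Algebra.QuotRing"
begin

section \<open>Graphs with disjoint cycles\<close>

text \<open>
  A graph \<open>E\<close> is a \<^const>\<open>fin_digraph\<close>: multiple arcs and loops are allowed, \<^const>\<open>tail\<close> is the
  source map, \<^const>\<open>head\<close> is the range map, and \<open>out_arcs E v\<close> is \<open>s\<^sup>-\<^sup>1(v)\<close>. For
  \<^const>\<open>pre_digraph.cycle\<close> the library asks that the heads of \<open>e\<^sub>1, \<dots>, e\<^sub>n\<close> be distinct; for a
  closed walk these are the tails, rotated by one place.
\<close>

definition disjoint_cycles :: "('v, 'e) pre_digraph \<Rightarrow> bool" where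
  "disjoint_cycles E \<longleftrightarrow>
     (\<forall>v\<in>verts E. \<forall>p q. pre_digraph.cycle E p \<and> tail E (hd p) = v \<and>
                       pre_digraph.cycle E q \<and> tail E (hd q) = v \<longrightarrow> p = q)"


section \<open>Monoids with a group action\<close>

text \<open>
  The commutative monoid operation is written \<open>\<otimes>\<close>, \<open>\<one>\<close>, as in \<^locale>\<open>comm_monoid\<close>; it is the
  \<open>+\<close>, \<open>0\<close> of the usual notation for \<open>\<Gamma>\<close>-monoids. The acting abelian group \<open>\<Gamma>\<close> is the type \<open>'g\<close>.
\<close>

record ('a, 'g) gamma_monoid = "'a monoid" +
  act :: "'g \<Rightarrow> 'a \<Rightarrow> 'a"

locale gamma_monoid = comm_monoid T
  for T :: "('a, 'g :: ab_group_add, 'm) gamma_monoid_scheme" (structure) +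
  assumes act_closed: "x \<in> carrier T \<Longrightarrow> act T g x \<in> carrier T"
    and act_mult: "x \<in> carrier T \<Longrightarrow> y \<in> carrier T \<Longrightarrow> act T g (x \<otimes> y) = act T g x \<otimes> act T g y"
    and act_one: "act T g \<one> = \<one>"
    and act_zero: "x \<in> carrier T \<Longrightarrow> act T 0 x = x"
    and act_add: "x \<in> carrier T \<Longrightarrow> act T (g + h) x = act T g (act T h x)"

definition mle :: "('a, 'm) monoid_scheme \<Rightarrow> 'a \<Rightarrow> 'a \<Rightarrow> bool" where
  "mle T a b \<longleftrightarrow> (\<exists>c\<in>carrier T. b = a \<otimes>\<^bsub>T\<^esub> c)"

definition incomparable :: "('a, 'm) monoid_scheme \<Rightarrow> 'a \<Rightarrow> 'a \<Rightarrow> bool" where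
  "incomparable T a b \<longleftrightarrow> \<not> mle T a b \<and> \<not> mle T b a"

definition order_ideal :: "('a, 'g, 'm) gamma_monoid_scheme \<Rightarrow> 'a set \<Rightarrow> bool" where
  "order_ideal T I \<longleftrightarrow> submonoid I T \<and>
     (\<forall>g. \<forall>x\<in>I. act T g x \<in> I) \<and>
     (\<forall>a\<in>carrier T. \<forall>b\<in>carrier T. a \<otimes>\<^bsub>T\<^esub> b \<in> I \<longrightarrow> a \<in> I \<and> b \<in> I)"

definition simple_gamma_monoid :: "('a, 'g, 'm) gamma_monoid_scheme \<Rightarrow> bool" where
  "simple_gamma_monoid T \<longleftrightarrow> (\<forall>I. order_ideal T I \<longrightarrow> I = {\<one>\<^bsub>T\<^esub>} \<or> I = carrier T)"

definition cyclic_gamma_monoid :: "('a, 'g :: ab_group_add, 'm) gamma_monoid_scheme \<Rightarrow> bool" where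
  "cyclic_gamma_monoid T \<longleftrightarrow> (\<forall>x\<in>carrier T. \<exists>g. g \<noteq> 0 \<and> act T g x = x)"

definition noncomparable_gamma_monoid ::
    "('a, 'g :: ab_group_add, 'm) gamma_monoid_scheme \<Rightarrow> bool" where
  "noncomparable_gamma_monoid T \<longleftrightarrow>
     (\<forall>x\<in>carrier T. \<forall>g. x \<noteq> \<one>\<^bsub>T\<^esub> \<and> g \<noteq> 0 \<longrightarrow> incomparable T (act T g x) x)"

text \<open>The quotient by a congruence \<open>r \<subseteq> carrier T \<times> carrier T\<close> compatible with the action.\<close>

definition quot_gamma_monoid ::
    "('a, 'g) gamma_monoid \<Rightarrow> 'a rel \<Rightarrow> ('a set, 'g) gamma_monoid" where
  "quot_gamma_monoid T r =
     \<lparr>carrier = carrier T // r,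
      mult = (\<lambda>A B. \<Union>a\<in>A. \<Union>b\<in>B. r `` {a \<otimes>\<^bsub>T\<^esub> b}),
      one = r `` {\<one>\<^bsub>T\<^esub>},
      act = (\<lambda>g A. \<Union>a\<in>A. r `` {act T g a})\<rparr>"

definition ideal_cong :: "('a, 'm) monoid_scheme \<Rightarrow> 'a set \<Rightarrow> 'a rel" where
  "ideal_cong T I = {(a, b). a \<in> carrier T \<and> b \<in> carrier T \<and>
                             (\<exists>i\<in>I. \<exists>j\<in>I. a \<otimes>\<^bsub>T\<^esub> i = b \<otimes>\<^bsub>T\<^esub> j)}"

text \<open>\<open>ideal_quot T J I\<close> is \<open>J/I\<close>, the order-ideal \<open>J\<close> being a \<open>\<Gamma>\<close>-monoid in its own right.\<close>

definition ideal_quot ::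
    "('a, 'g) gamma_monoid \<Rightarrow> 'a set \<Rightarrow> 'a set \<Rightarrow> ('a set, 'g) gamma_monoid" where
  "ideal_quot T J I = quot_gamma_monoid (T\<lparr>carrier := J\<rparr>) (ideal_cong (T\<lparr>carrier := J\<rparr>) I)"

definition composition_series ::
    "('a, 'g) gamma_monoid \<Rightarrow> nat \<Rightarrow> (nat \<Rightarrow> 'a set) \<Rightarrow> bool" where
  "composition_series T n I \<longleftrightarrow>
     I 0 = {\<one>\<^bsub>T\<^esub>} \<and> I n = carrier T \<and>
     (\<forall>i\<le>n. order_ideal T (I i)) \<and>
     (\<forall>i<n. I i \<subset> I (Suc i) \<and> simple_gamma_monoid (ideal_quot T (I (Suc i)) (I i)))"


section \<open>The talented monoid\<close>

inductive_set gen_cong :: "('a, 'm) monoid_scheme \<Rightarrow> 'a rel \<Rightarrow> 'a rel"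
  for M :: "('a, 'm) monoid_scheme" and R :: "'a rel" where
  base: "p \<in> R \<Longrightarrow> p \<in> gen_cong M R"
| refl: "a \<in> carrier M \<Longrightarrow> (a, a) \<in> gen_cong M R"
| sym: "(a, b) \<in> gen_cong M R \<Longrightarrow> (b, a) \<in> gen_cong M R"
| trans: "(a, b) \<in> gen_cong M R \<Longrightarrow> (b, c) \<in> gen_cong M R \<Longrightarrow> (a, c) \<in> gen_cong M R"
| mult: "(a, b) \<in> gen_cong M R \<Longrightarrow> (c, d) \<in> gen_cong M R \<Longrightarrow>
         (a \<otimes>\<^bsub>M\<^esub> c, b \<otimes>\<^bsub>M\<^esub> d) \<in> gen_cong M R"

text \<open>The free commutative monoid on the symbols \<open>v(i)\<close>, which are encoded as pairs \<open>(v, i)\<close>.\<close>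

definition free_talented :: "('v, 'e) pre_digraph \<Rightarrow> (('v \<times> int) multiset, int) gamma_monoid" where
  "free_talented E =
     \<lparr>carrier = {m. set_mset m \<subseteq> verts E \<times> UNIV}, mult = (+), one = {#},
      act = (\<lambda>n. image_mset (\<lambda>(v, i). (v, i + n)))\<rparr>"

definition talented_rel :: "('v, 'e) pre_digraph \<Rightarrow> ('v \<times> int) multiset rel" where
  "talented_rel E =
     {({#(v, i)#}, {#(head E e, i + 1). e \<in># mset_set (out_arcs E v)#}) | v i.
       v \<in> verts E \<and> out_arcs E v \<noteq> {}}"

definition talented_monoid ::
    "('v, 'e) pre_digraph \<Rightarrow> (('v \<times> int) multiset set, int) gamma_monoid" where
  "talented_monoid E =
     quot_gamma_monoid (free_talented E) (gen_cong (free_talented E) (talented_rel E))"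


section \<open>Algebras over a field given by generators and relations\<close>

text \<open>
  Algebras need not have an identity, so nothing is assumed about the \<open>one\<close> field of the record. The
  free algebra has the nonempty words in the generators as a basis; it has no identity.
\<close>

locale kalgebra = vectorspace K A for K (structure) and A (structure) +
  assumes kalg_m_closed: "x \<in> carrier A \<Longrightarrow> y \<in> carrier A \<Longrightarrow> x \<otimes>\<^bsub>A\<^esub> y \<in> carrier A"
    and kalg_m_assoc: "x \<in> carrier A \<Longrightarrow> y \<in> carrier A \<Longrightarrow> z \<in> carrier A \<Longrightarrow>
      (x \<otimes>\<^bsub>A\<^esub> y) \<otimes>\<^bsub>A\<^esub> z = x \<otimes>\<^bsub>A\<^esub> (y \<otimes>\<^bsub>A\<^esub> z)"
    and kalg_l_distr: "x \<in> carrier A \<Longrightarrow> y \<in> carrier A \<Longrightarrow> z \<in> carrier A \<Longrightarrow>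
      (x \<oplus>\<^bsub>A\<^esub> y) \<otimes>\<^bsub>A\<^esub> z = x \<otimes>\<^bsub>A\<^esub> z \<oplus>\<^bsub>A\<^esub> y \<otimes>\<^bsub>A\<^esub> z"
    and kalg_r_distr: "x \<in> carrier A \<Longrightarrow> y \<in> carrier A \<Longrightarrow> z \<in> carrier A \<Longrightarrow>
      z \<otimes>\<^bsub>A\<^esub> (x \<oplus>\<^bsub>A\<^esub> y) = z \<otimes>\<^bsub>A\<^esub> x \<oplus>\<^bsub>A\<^esub> z \<otimes>\<^bsub>A\<^esub> y"
    and kalg_smult_l: "c \<in> carrier K \<Longrightarrow> x \<in> carrier A \<Longrightarrow> y \<in> carrier A \<Longrightarrow>
      (c \<odot>\<^bsub>A\<^esub> x) \<otimes>\<^bsub>A\<^esub> y = c \<odot>\<^bsub>A\<^esub> (x \<otimes>\<^bsub>A\<^esub> y)"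
    and kalg_smult_r: "c \<in> carrier K \<Longrightarrow> x \<in> carrier A \<Longrightarrow> y \<in> carrier A \<Longrightarrow>
      x \<otimes>\<^bsub>A\<^esub> (c \<odot>\<^bsub>A\<^esub> y) = c \<odot>\<^bsub>A\<^esub> (x \<otimes>\<^bsub>A\<^esub> y)"

definition free_alg :: "('k, 'm) ring_scheme \<Rightarrow> 'x set \<Rightarrow> ('k, 'x list \<Rightarrow> 'k) module" where
  "free_alg K X =
     \<lparr>carrier = {f. (\<forall>w. f w \<in> carrier K) \<and> finite {w. f w \<noteq> \<zero>\<^bsub>K\<^esub>} \<and>
                    (\<forall>w. f w \<noteq> \<zero>\<^bsub>K\<^esub> \<longrightarrow> w \<noteq> [] \<and> set w \<subseteq> X)},
      mult = (\<lambda>f g w. \<Oplus>\<^bsub>K\<^esub>i\<in>{..length w}. f (take i w) \<otimes>\<^bsub>K\<^esub> g (drop i w)),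
      one = undefined,
      zero = (\<lambda>w. \<zero>\<^bsub>K\<^esub>),
      add = (\<lambda>f g w. f w \<oplus>\<^bsub>K\<^esub> g w),
      smult = (\<lambda>c f w. c \<otimes>\<^bsub>K\<^esub> f w)\<rparr>"

definition gen :: "('k, 'm) ring_scheme \<Rightarrow> 'x \<Rightarrow> 'x list \<Rightarrow> 'k" where
  "gen K x = (\<lambda>w. if w = [x] then \<one>\<^bsub>K\<^esub> else \<zero>\<^bsub>K\<^esub>)"

inductive_set gen_alg_ideal :: "('k, 'm) ring_scheme \<Rightarrow> ('k, 'a, 'n) module_scheme \<Rightarrow> 'a set \<Rightarrow> 'a set"
  for K :: "('k, 'm) ring_scheme" and A :: "('k, 'a, 'n) module_scheme" and S :: "'a set" where
  base: "a \<in> S \<Longrightarrow> a \<in> gen_alg_ideal K A S"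
| zero: "\<zero>\<^bsub>A\<^esub> \<in> gen_alg_ideal K A S"
| add: "a \<in> gen_alg_ideal K A S \<Longrightarrow> b \<in> gen_alg_ideal K A S \<Longrightarrow> a \<oplus>\<^bsub>A\<^esub> b \<in> gen_alg_ideal K A S"
| smult: "c \<in> carrier K \<Longrightarrow> a \<in> gen_alg_ideal K A S \<Longrightarrow> c \<odot>\<^bsub>A\<^esub> a \<in> gen_alg_ideal K A S"
| l_mult: "x \<in> carrier A \<Longrightarrow> a \<in> gen_alg_ideal K A S \<Longrightarrow> x \<otimes>\<^bsub>A\<^esub> a \<in> gen_alg_ideal K A S"
| r_mult: "x \<in> carrier A \<Longrightarrow> a \<in> gen_alg_ideal K A S \<Longrightarrow> a \<otimes>\<^bsub>A\<^esub> x \<in> gen_alg_ideal K A S"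

text \<open>The library's quotient \<^const>\<open>FactRing\<close>, together with the induced scalar multiplication.\<close>

definition quot_alg :: "('k, 'a, 'n) module_scheme \<Rightarrow> 'a set \<Rightarrow> ('k, 'a set) module" where
  "quot_alg A I =
     \<lparr>carrier = carrier (A Quot I), mult = mult (A Quot I), one = one (A Quot I),
      zero = zero (A Quot I), add = add (A Quot I),
      smult = (\<lambda>c X. \<Union>x\<in>X. I +>\<^bsub>A\<^esub> (c \<odot>\<^bsub>A\<^esub> x))\<rparr>"


section \<open>Leavitt path algebras\<close>

datatype ('v, 'e) lpa_gen = Vertex 'v | Edge 'e | Ghost 'e

definition lpa_gens :: "('v, 'e) pre_digraph \<Rightarrow> ('v, 'e) lpa_gen set" where
  "lpa_gens E = Vertex ` verts E \<union> Edge ` arcs E \<union> Ghost ` arcs E"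

text \<open>Each relation \<open>a = b\<close> is recorded as the element \<open>a - b\<close> of the free algebra.\<close>

definition lpa_rels ::
    "('k, 'm) ring_scheme \<Rightarrow> ('v, 'e) pre_digraph \<Rightarrow> (('v, 'e) lpa_gen list \<Rightarrow> 'k) set" where
  "lpa_rels K E =
    (let F = free_alg K (lpa_gens E);
         V = (\<lambda>v. gen K (Vertex v)); D = (\<lambda>e. gen K (Edge e)); G = (\<lambda>e. gen K (Ghost e))
     in {V v \<otimes>\<^bsub>F\<^esub> V w \<ominus>\<^bsub>F\<^esub> (if v = w then V v else \<zero>\<^bsub>F\<^esub>) | v w. v \<in> verts E \<and> w \<in> verts E}
      \<union> {V (tail E e) \<otimes>\<^bsub>F\<^esub> D e \<ominus>\<^bsub>F\<^esub> D e | e. e \<in> arcs E}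
      \<union> {D e \<otimes>\<^bsub>F\<^esub> V (head E e) \<ominus>\<^bsub>F\<^esub> D e | e. e \<in> arcs E}
      \<union> {V (head E e) \<otimes>\<^bsub>F\<^esub> G e \<ominus>\<^bsub>F\<^esub> G e | e. e \<in> arcs E}
      \<union> {G e \<otimes>\<^bsub>F\<^esub> V (tail E e) \<ominus>\<^bsub>F\<^esub> G e | e. e \<in> arcs E}
      \<union> {G e \<otimes>\<^bsub>F\<^esub> D f \<ominus>\<^bsub>F\<^esub> (if e = f then V (head E e) else \<zero>\<^bsub>F\<^esub>) | e f. e \<in> arcs E \<and> f \<in> arcs E}
      \<union> {V v \<ominus>\<^bsub>F\<^esub> (\<Oplus>\<^bsub>F\<^esub>e\<in>out_arcs E v. D e \<otimes>\<^bsub>F\<^esub> G e) | v. v \<in> verts E \<and> out_arcs E v \<noteq> {}})"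

text \<open>
  For a finite graph the sum of the vertices is the identity of the Leavitt path algebra, and it is
  entered as the \<open>one\<close> of the record.
\<close>

definition leavitt_path_algebra ::
    "('k, 'm) ring_scheme \<Rightarrow> ('v, 'e) pre_digraph \<Rightarrow>
     ('k, (('v, 'e) lpa_gen list \<Rightarrow> 'k) set) module" where
  "leavitt_path_algebra K E =
    (let F = free_alg K (lpa_gens E); I = gen_alg_ideal K F (lpa_rels K E)
     in (quot_alg F I)\<lparr>one := I +>\<^bsub>F\<^esub> (\<Oplus>\<^bsub>F\<^esub>v\<in>verts E. gen K (Vertex v))\<rparr>)"


section \<open>Gelfand--Kirillov dimension\<close>

text \<open>\<open>prods A V j\<close> consists of the products of \<open>j + 1\<close> elements of \<open>V\<close>.\<close>

primrec prods :: "('a, 'm) monoid_scheme \<Rightarrow> 'a set \<Rightarrow> nat \<Rightarrow> 'a set" where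
  "prods A V 0 = V"
| "prods A V (Suc j) = {x \<otimes>\<^bsub>A\<^esub> y | x y. x \<in> prods A V j \<and> y \<in> V}"

text \<open>\<open>alg_growth K A V n\<close> is \<open>dim (V + V\<^sup>2 + \<dots> + V\<^sup>n)\<close>.\<close>

definition alg_growth ::
    "('k, 'm) ring_scheme \<Rightarrow> ('k, 'a, 'n) module_scheme \<Rightarrow> 'a set \<Rightarrow> nat \<Rightarrow> nat" where
  "alg_growth K A V n =
     vectorspace.dim K (A\<lparr>carrier := LinearCombinations.module.span K A (\<Union>j<n. prods A V j)\<rparr>)"

text \<open>
  The supremum ranges over the finite-dimensional subspaces \<open>V\<close>. The subspace \<open>V = 0\<close> contributes
  \<open>log n 0 = 0\<close>, so the zero algebra has dimension \<open>0\<close>. The values at \<open>n \<le> 1\<close>, where \<open>log n\<close> is not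
  a logarithm, do not affect the limit superior.
\<close>

definition gk_dim :: "('k, 'm) ring_scheme \<Rightarrow> ('k, 'a, 'n) module_scheme \<Rightarrow> ereal" where
  "gk_dim K A =
     (SUP V\<in>{V. VectorSpace.subspace K V A \<and> vectorspace.fin_dim K (A\<lparr>carrier := V\<rparr>)}.
        limsup (\<lambda>n. ereal (log (real n) (real (alg_growth K A V n)))))"

section \<open>Well-definedness\<close>

text \<open>
  The quotients above are taken by congruences, so the talented monoid and the quotients in a
  composition series are \<open>\<Gamma>\<close>-monoids, and the Leavitt path algebra is a \<open>K\<close>-algebra.
\<close>

lemma gen_cong_sub:
  assumes "comm_monoid M" "R \<subseteq> carrier M \<times> carrier M"
  shows "gen_cong M R \<subseteq> carrier M \<times> carrier M"
proof -
  interpret comm_monoid M by fact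
  have "p \<in> gen_cong M R \<Longrightarrow> p \<in> carrier M \<times> carrier M" for p
    by (induction p rule: gen_cong.induct) (use assms in auto)
  then show ?thesis by auto
qed

lemma gamma_monoid_quot:
  assumes T: "gamma_monoid T" and r: "equiv (carrier T) r"
    and rm: "\<And>a b c d. (a, b) \<in> r \<Longrightarrow> (c, d) \<in> r \<Longrightarrow> (a \<otimes>\<^bsub>T\<^esub> c, b \<otimes>\<^bsub>T\<^esub> d) \<in> r"
    and ra: "\<And>a b g. (a, b) \<in> r \<Longrightarrow> (act T g a, act T g b) \<in> r"
  shows "gamma_monoid (quot_gamma_monoid T r)"
proof -
  interpret gamma_monoid T by fact
  let ?Q = "quot_gamma_monoid T r"
  have car: "carrier ?Q = (\<lambda>a. r `` {a}) ` carrier T"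
    by (auto simp: quot_gamma_monoid_def quotient_def)
  have one: "one ?Q = r `` {\<one>\<^bsub>T\<^esub>}" by (simp add: quot_gamma_monoid_def)
  have sub: "(a, b) \<in> r \<Longrightarrow> a \<in> carrier T \<and> b \<in> carrier T" for a b
    using equiv_type[OF r] by auto
  have refl: "a \<in> carrier T \<Longrightarrow> (a, a) \<in> r" for a
    using r by (auto simp: equiv_def dest: refl_onD)
  have eq: "(a, b) \<in> r \<Longrightarrow> r `` {a} = r `` {b}" for a b using r by (rule equiv_class_eq)
  have mult: "(r `` {a}) \<otimes>\<^bsub>?Q\<^esub> (r `` {b}) = r `` {a \<otimes>\<^bsub>T\<^esub> b}" if "a \<in> carrier T" "b \<in> carrier T" for a b
  proof -
    have "r `` {a' \<otimes>\<^bsub>T\<^esub> b'} = r `` {a \<otimes>\<^bsub>T\<^esub> b}" if "a' \<in> r `` {a}" "b' \<in> r `` {b}" for a' b'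
      using that eq[OF rm, of a a' b b'] by auto
    then have "(\<Union>a'\<in>r `` {a}. \<Union>b'\<in>r `` {b}. r `` {a' \<otimes>\<^bsub>T\<^esub> b'}) =
        (\<Union>a'\<in>r `` {a}. \<Union>b'\<in>r `` {b}. r `` {a \<otimes>\<^bsub>T\<^esub> b})"
      by (intro SUP_cong HOL.refl)
    also have "\<dots> = r `` {a \<otimes>\<^bsub>T\<^esub> b}" using refl[OF that(1)] refl[OF that(2)] by auto
    finally show ?thesis by (simp add: quot_gamma_monoid_def)
  qed
  have act: "act ?Q g (r `` {a}) = r `` {act T g a}" if "a \<in> carrier T" for a g
  proof -
    have "r `` {act T g a'} = r `` {act T g a}" if "a' \<in> r `` {a}" for a'
      using that eq[OF ra, of a a' g] by auto
    then have "(\<Union>a'\<in>r `` {a}. r `` {act T g a'}) = (\<Union>a'\<in>r `` {a}. r `` {act T g a})"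
      by (intro SUP_cong HOL.refl)
    also have "\<dots> = r `` {act T g a}" using refl[OF that] by auto
    finally show ?thesis by (simp add: quot_gamma_monoid_def)
  qed
  have cm: "comm_monoid ?Q"
    by (rule comm_monoidI) (auto simp: car one mult m_ac)
  show ?thesis
    by (intro gamma_monoid.intro cm gamma_monoid_axioms.intro)
       (auto simp: car one mult act act_closed act_mult act_one act_zero act_add)
qed

lemma gamma_monoid_ideal_quot:
  assumes "gamma_monoid T" and J: "order_ideal T J" and I: "order_ideal T I" and "I \<subseteq> J"
  shows "gamma_monoid (ideal_quot T J I)"
proof -
  interpret gamma_monoid T by fact
  interpret J: submonoid J T using J by (simp add: order_ideal_def)
  interpret I: submonoid I T using I by (simp add: order_ideal_def)
  have Jc: "x \<in> J \<Longrightarrow> x \<in> carrier T" for x using J.subset by auto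
  have Ic: "x \<in> I \<Longrightarrow> x \<in> carrier T" for x using I.subset by auto
  let ?J = "T\<lparr>carrier := J\<rparr>"
  let ?r = "ideal_cong ?J I"
  have ai: "act T g x \<in> L" if "order_ideal T L" "x \<in> L" for L x g
  proof -
    have "\<forall>g. \<forall>x\<in>L. act T g x \<in> L" using that(1) unfolding order_ideal_def by (elim conjE)
    then show ?thesis using that(2) by blast
  qed
  note actJ = ai[OF J] and actI = ai[OF I]
  have "comm_monoid ?J" by (rule comm_monoidI) (auto simp: m_ac Jc)
  then have gJ: "gamma_monoid ?J"
    by (intro gamma_monoid.intro gamma_monoid_axioms.intro)
       (auto simp: actJ act_mult act_one act_zero act_add Jc)
  have rI: "(a, b) \<in> ?r" if "a \<in> J" "b \<in> J" "i \<in> I" "j \<in> I" "a \<otimes>\<^bsub>T\<^esub> i = b \<otimes>\<^bsub>T\<^esub> j" for a b i j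
    using that by (auto simp: ideal_cong_def)
  have rE: "\<exists>i j. a \<in> J \<and> b \<in> J \<and> i \<in> I \<and> j \<in> I \<and> a \<otimes>\<^bsub>T\<^esub> i = b \<otimes>\<^bsub>T\<^esub> j" if "(a, b) \<in> ?r" for a b
    using that by (auto simp: ideal_cong_def)
  have "equiv J ?r"
  proof (intro equivI refl_onI symI transI)
    show "(a, a) \<in> ?r" if "a \<in> J" for a
      using that by (intro rI[of _ _ "\<one>\<^bsub>T\<^esub>" "\<one>\<^bsub>T\<^esub>"]) auto
    show "(b, a) \<in> ?r" if "(a, b) \<in> ?r" for a b
      using rE[OF that] by (metis rI)
    show "(a, c) \<in> ?r" if ab: "(a, b) \<in> ?r" and bc: "(b, c) \<in> ?r" for a b c
    proof -
      obtain i j where 1: "a \<in> J" "b \<in> J" "i \<in> I" "j \<in> I" "a \<otimes>\<^bsub>T\<^esub> i = b \<otimes>\<^bsub>T\<^esub> j" using rE[OF ab] by blast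
      obtain k l where 2: "c \<in> J" "k \<in> I" "l \<in> I" "b \<otimes>\<^bsub>T\<^esub> k = c \<otimes>\<^bsub>T\<^esub> l" using rE[OF bc] by blast
      have "a \<otimes>\<^bsub>T\<^esub> (i \<otimes>\<^bsub>T\<^esub> k) = (b \<otimes>\<^bsub>T\<^esub> j) \<otimes>\<^bsub>T\<^esub> k" using 1 2 by (metis m_assoc Jc Ic)
      also have "\<dots> = (b \<otimes>\<^bsub>T\<^esub> k) \<otimes>\<^bsub>T\<^esub> j" using 1(1-4) 2(1-3) by (simp add: m_ac Jc Ic)
      also have "\<dots> = c \<otimes>\<^bsub>T\<^esub> (l \<otimes>\<^bsub>T\<^esub> j)" unfolding 2(4) using 1(1-4) 2(1-3) by (simp add: m_assoc Jc Ic)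
      finally show ?thesis using 1 2 by (intro rI[of a c "i \<otimes>\<^bsub>T\<^esub> k" "l \<otimes>\<^bsub>T\<^esub> j"]) auto
    qed
  qed (auto simp: ideal_cong_def)
  moreover have "(a \<otimes>\<^bsub>T\<^esub> c, b \<otimes>\<^bsub>T\<^esub> d) \<in> ?r" if ab: "(a, b) \<in> ?r" and cd: "(c, d) \<in> ?r" for a b c d
  proof -
    obtain i j where 1: "a \<in> J" "b \<in> J" "i \<in> I" "j \<in> I" "a \<otimes>\<^bsub>T\<^esub> i = b \<otimes>\<^bsub>T\<^esub> j" using rE[OF ab] by blast
    obtain k l where 2: "c \<in> J" "d \<in> J" "k \<in> I" "l \<in> I" "c \<otimes>\<^bsub>T\<^esub> k = d \<otimes>\<^bsub>T\<^esub> l" using rE[OF cd] by blast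
    have "(a \<otimes>\<^bsub>T\<^esub> c) \<otimes>\<^bsub>T\<^esub> (i \<otimes>\<^bsub>T\<^esub> k) = (a \<otimes>\<^bsub>T\<^esub> i) \<otimes>\<^bsub>T\<^esub> (c \<otimes>\<^bsub>T\<^esub> k)" using 1(1-4) 2(1-4) by (simp add: m_ac Jc Ic)
    also have "\<dots> = (b \<otimes>\<^bsub>T\<^esub> d) \<otimes>\<^bsub>T\<^esub> (j \<otimes>\<^bsub>T\<^esub> l)" unfolding 1(5) 2(5) using 1(1-4) 2(1-4) by (simp add: m_ac Jc Ic)
    finally show ?thesis using 1 2
      by (intro rI[of "a \<otimes>\<^bsub>T\<^esub> c" "b \<otimes>\<^bsub>T\<^esub> d" "i \<otimes>\<^bsub>T\<^esub> k" "j \<otimes>\<^bsub>T\<^esub> l"]) auto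
  qed
  moreover have "(act T g a, act T g b) \<in> ?r" if ab: "(a, b) \<in> ?r" for a b g
  proof -
    obtain i j where 1: "a \<in> J" "b \<in> J" "i \<in> I" "j \<in> I" "a \<otimes>\<^bsub>T\<^esub> i = b \<otimes>\<^bsub>T\<^esub> j" using rE[OF ab] by blast
    have "act T g a \<otimes>\<^bsub>T\<^esub> act T g i = act T g b \<otimes>\<^bsub>T\<^esub> act T g j"
      using 1 by (metis act_mult Jc Ic)
    then show ?thesis using 1 by (intro rI[of _ _ "act T g i" "act T g j"]) (auto simp: actJ actI)
  qed
  ultimately show ?thesis unfolding ideal_quot_def
    by (intro gamma_monoid_quot[OF gJ]) auto
qed

lemma gamma_monoid_free_talented: "gamma_monoid (free_talented E)"
proof (intro gamma_monoid.intro gamma_monoid_axioms.intro comm_monoidI)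
  fix x g assume "x \<in> carrier (free_talented E)"
  then show "act (free_talented E) g x \<in> carrier (free_talented E)"
    by (auto simp: free_talented_def)
next
  fix x g h assume "x \<in> carrier (free_talented E)"
  show "act (free_talented E) (g + h) x = act (free_talented E) g (act (free_talented E) h x)"
    by (simp add: free_talented_def image_mset.compositionality comp_def split_def algebra_simps)
next
  fix x assume "x \<in> carrier (free_talented E)"
  show "act (free_talented E) 0 x = x"
    by (simp add: free_talented_def split_def)
qed (auto simp: free_talented_def)

lemma gamma_monoid_talented_monoid:
  assumes "fin_digraph E"
  shows "gamma_monoid (talented_monoid E)"
proof -
  interpret fin_digraph E by fact
  interpret F: gamma_monoid "free_talented E" by (rule gamma_monoid_free_talented)
  let ?F = "free_talented E" and ?R = "talented_rel E"
  have R: "?R \<subseteq> carrier ?F \<times> carrier ?F"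
    by (auto simp: talented_rel_def free_talented_def elem_mset_set[OF finite_out_arcs])
  note sub = gen_cong_sub[OF F.comm_monoid_axioms R]
  have ra: "(act ?F g a, act ?F g b) \<in> gen_cong ?F ?R" if "(a, b) \<in> gen_cong ?F ?R" for a b g
    using that
  proof (induction "(a, b)" arbitrary: a b rule: gen_cong.induct)
    case base
    then obtain v i where "a = {#(v, i)#}" "b = {#(head E e, i + 1). e \<in># mset_set (out_arcs E v)#}"
      "v \<in> verts E" "out_arcs E v \<noteq> {}" by (auto simp: talented_rel_def)
    then have "(act ?F g a, act ?F g b) \<in> ?R"
      by (auto simp: talented_rel_def free_talented_def image_mset.compositionality comp_def algebra_simps
          intro!: exI[of _ v] exI[of _ "i + g"])
    then show ?case by (rule gen_cong.base)
  next
    case (mult a b c d)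
    then have "a \<in> carrier ?F" "b \<in> carrier ?F" "c \<in> carrier ?F" "d \<in> carrier ?F"
      using sub by auto
    with mult show ?case by (simp add: F.act_mult gen_cong.mult)
  next
    case (refl a)
    then show ?case by (simp add: gen_cong.refl F.act_closed)
  next
    case (sym a b)
    show ?case by (rule gen_cong.sym[OF sym(2)])
  next
    case (trans a b c)
    show ?case by (rule gen_cong.trans[OF trans(2) trans(4)])
  qed
  have "equiv (carrier ?F) (gen_cong ?F ?R)"
    using sub by (intro equivI refl_onI symI transI)
      (assumption | erule gen_cong.refl gen_cong.sym | erule (1) gen_cong.trans)+
  then show ?thesis unfolding talented_monoid_def
    by (intro gamma_monoid_quot gamma_monoid_free_talented) (auto intro: gen_cong.mult ra)
qed
lemma free_alg_simps:
  "carrier (free_alg K X) = {f. (\<forall>w. f w \<in> carrier K) \<and> finite {w. f w \<noteq> \<zero>\<^bsub>K\<^esub>} \<and>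
                    (\<forall>w. f w \<noteq> \<zero>\<^bsub>K\<^esub> \<longrightarrow> w \<noteq> [] \<and> set w \<subseteq> X)}"
  "mult (free_alg K X) = (\<lambda>f g w. \<Oplus>\<^bsub>K\<^esub>i\<in>{..length w}. f (take i w) \<otimes>\<^bsub>K\<^esub> g (drop i w))"
  "zero (free_alg K X) = (\<lambda>w. \<zero>\<^bsub>K\<^esub>)"
  "add (free_alg K X) = (\<lambda>f g w. f w \<oplus>\<^bsub>K\<^esub> g w)"
  "smult (free_alg K X) = (\<lambda>c f w. c \<otimes>\<^bsub>K\<^esub> f w)"
  by (simp_all add: free_alg_def)

lemma free_alg_mult_closed:
  assumes "field K" "f \<in> carrier (free_alg K X)" "g \<in> carrier (free_alg K X)"
  shows "f \<otimes>\<^bsub>free_alg K X\<^esub> g \<in> carrier (free_alg K X)"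
proof -
  interpret field K by fact
  let ?h = "\<lambda>w. \<Oplus>\<^bsub>K\<^esub>i\<in>{..length w}. f (take i w) \<otimes>\<^bsub>K\<^esub> g (drop i w)"
  have f: "\<And>w. f w \<in> carrier K" "finite {w. f w \<noteq> \<zero>\<^bsub>K\<^esub>}" "\<And>w. f w \<noteq> \<zero>\<^bsub>K\<^esub> \<Longrightarrow> w \<noteq> [] \<and> set w \<subseteq> X"
    and g: "\<And>w. g w \<in> carrier K" "finite {w. g w \<noteq> \<zero>\<^bsub>K\<^esub>}" "\<And>w. g w \<noteq> \<zero>\<^bsub>K\<^esub> \<Longrightarrow> w \<noteq> [] \<and> set w \<subseteq> X"
    using assms by (auto simp: free_alg_simps)
  have ex: "\<exists>i\<le>length w. f (take i w) \<noteq> \<zero>\<^bsub>K\<^esub> \<and> g (drop i w) \<noteq> \<zero>\<^bsub>K\<^esub>" if "?h w \<noteq> \<zero>\<^bsub>K\<^esub>" for w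
  proof (rule ccontr)
    assume "\<not> ?thesis"
    then have "?h w = (\<Oplus>\<^bsub>K\<^esub>i\<in>{..length w}. \<zero>\<^bsub>K\<^esub>)"
      using f g by (intro finsum_cong') auto
    then show False using that by simp
  qed
  have "{w. ?h w \<noteq> \<zero>\<^bsub>K\<^esub>} \<subseteq> (\<lambda>(u, v). u @ v) ` ({w. f w \<noteq> \<zero>\<^bsub>K\<^esub>} \<times> {w. g w \<noteq> \<zero>\<^bsub>K\<^esub>})"
  proof
    fix w assume "w \<in> {w. ?h w \<noteq> \<zero>\<^bsub>K\<^esub>}"
    then obtain i where "f (take i w) \<noteq> \<zero>\<^bsub>K\<^esub>" "g (drop i w) \<noteq> \<zero>\<^bsub>K\<^esub>" using ex by blast
    then show "w \<in> (\<lambda>(u, v). u @ v) ` ({w. f w \<noteq> \<zero>\<^bsub>K\<^esub>} \<times> {w. g w \<noteq> \<zero>\<^bsub>K\<^esub>})"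
      by (intro image_eqI[of _ _ "(take i w, drop i w)"]) auto
  qed
  then have fin: "finite {w. ?h w \<noteq> \<zero>\<^bsub>K\<^esub>}"
    by (rule finite_subset) (use f(2) g(2) in blast)
  have "w \<noteq> [] \<and> set w \<subseteq> X" if h: "?h w \<noteq> \<zero>\<^bsub>K\<^esub>" for w
  proof -
    obtain i where "f (take i w) \<noteq> \<zero>\<^bsub>K\<^esub>" "g (drop i w) \<noteq> \<zero>\<^bsub>K\<^esub>" using ex h by blast
    then have "take i w \<noteq> []" "set (take i w) \<subseteq> X" "set (drop i w) \<subseteq> X" using f(3) g(3) by blast+
    then show ?thesis by (metis append_take_drop_id set_append Un_least take_Nil)
  qed
  moreover have "?h w \<in> carrier K" for w using f g by (intro finsum_closed) auto
  ultimately show ?thesis using fin by (simp add: free_alg_simps)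
qed

lemma free_alg_vectorspace:
  assumes "field K"
  shows "vectorspace K (free_alg K X)"
proof -
  interpret field K by fact
  have ag: "abelian_group (free_alg K X)"
  proof (rule abelian_groupI)
    fix f g assume "f \<in> carrier (free_alg K X)" "g \<in> carrier (free_alg K X)"
    then have f: "\<And>w. f w \<in> carrier K" "finite {w. f w \<noteq> \<zero>\<^bsub>K\<^esub>}" "\<And>w. f w \<noteq> \<zero>\<^bsub>K\<^esub> \<Longrightarrow> w \<noteq> [] \<and> set w \<subseteq> X"
      and g: "\<And>w. g w \<in> carrier K" "finite {w. g w \<noteq> \<zero>\<^bsub>K\<^esub>}" "\<And>w. g w \<noteq> \<zero>\<^bsub>K\<^esub> \<Longrightarrow> w \<noteq> [] \<and> set w \<subseteq> X"
      by (auto simp: free_alg_simps)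
    have "{w. f w \<oplus>\<^bsub>K\<^esub> g w \<noteq> \<zero>\<^bsub>K\<^esub>} \<subseteq> {w. f w \<noteq> \<zero>\<^bsub>K\<^esub>} \<union> {w. g w \<noteq> \<zero>\<^bsub>K\<^esub>}" by auto
    then have "finite {w. f w \<oplus>\<^bsub>K\<^esub> g w \<noteq> \<zero>\<^bsub>K\<^esub>}" using f g by (meson finite_UnI finite_subset)
    moreover have "\<And>w. f w \<oplus>\<^bsub>K\<^esub> g w \<noteq> \<zero>\<^bsub>K\<^esub> \<Longrightarrow> w \<noteq> [] \<and> set w \<subseteq> X" using f(3) g(3) by (metis l_zero zero_closed)
    ultimately show "f \<oplus>\<^bsub>free_alg K X\<^esub> g \<in> carrier (free_alg K X)"
      using f g by (simp add: free_alg_simps)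
  next
    fix f assume f: "f \<in> carrier (free_alg K X)"
    have "{w. \<ominus>\<^bsub>K\<^esub> f w \<noteq> \<zero>\<^bsub>K\<^esub>} = {w. f w \<noteq> \<zero>\<^bsub>K\<^esub>}" using f by (auto simp: free_alg_simps)
    then have "(\<lambda>w. \<ominus>\<^bsub>K\<^esub> f w) \<in> carrier (free_alg K X)"
      using f by (auto simp: free_alg_simps)
    then show "\<exists>g\<in>carrier (free_alg K X). g \<oplus>\<^bsub>free_alg K X\<^esub> f = \<zero>\<^bsub>free_alg K X\<^esub>"
      using f by (intro bexI[of _ "\<lambda>w. \<ominus>\<^bsub>K\<^esub> f w"]) (auto simp: free_alg_simps fun_eq_iff l_neg)
  qed (auto simp: free_alg_simps fun_eq_iff a_ac)
  have sm: "c \<odot>\<^bsub>free_alg K X\<^esub> f \<in> carrier (free_alg K X)"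
    if "c \<in> carrier K" and "f \<in> carrier (free_alg K X)" for c f
  proof -
    have "{w. c \<otimes>\<^bsub>K\<^esub> f w \<noteq> \<zero>\<^bsub>K\<^esub>} \<subseteq> {w. f w \<noteq> \<zero>\<^bsub>K\<^esub>}" using that by auto
    moreover have "finite {w. f w \<noteq> \<zero>\<^bsub>K\<^esub>}" using that by (auto simp: free_alg_simps)
    ultimately have "finite {w. c \<otimes>\<^bsub>K\<^esub> f w \<noteq> \<zero>\<^bsub>K\<^esub>}" by (rule finite_subset)
    moreover have "c \<otimes>\<^bsub>K\<^esub> f w \<noteq> \<zero>\<^bsub>K\<^esub> \<Longrightarrow> f w \<noteq> \<zero>\<^bsub>K\<^esub>" for w using that by auto
    ultimately show ?thesis using that by (simp add: free_alg_simps)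
  qed
  have "module K (free_alg K X)"
    by (rule moduleI[OF is_cring ag])
       (auto simp: sm, auto simp: free_alg_simps fun_eq_iff l_distr r_distr m_assoc)
  then show ?thesis by (simp add: vectorspace_def assms)
qed


lemma conv_Cons:
  assumes "ring K" "\<And>w. f w \<in> carrier K" "\<And>w. g w \<in> carrier K"
  shows "(\<Oplus>\<^bsub>K\<^esub>i\<in>{..length (x # w)}. f (take i (x # w)) \<otimes>\<^bsub>K\<^esub> g (drop i (x # w))) =
     f [] \<otimes>\<^bsub>K\<^esub> g (x # w) \<oplus>\<^bsub>K\<^esub> (\<Oplus>\<^bsub>K\<^esub>i\<in>{..length w}. f (x # take i w) \<otimes>\<^bsub>K\<^esub> g (drop i w))"
proof -
  interpret ring K by fact
  show ?thesis
    using assms finsum_Suc2[of "\<lambda>i. f (take i (x # w)) \<otimes>\<^bsub>K\<^esub> g (drop i (x # w))" "length w"]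
    by (simp add: a_comm)
qed

lemma conv_assoc:
  fixes f g h :: "'x list \<Rightarrow> 'k"
  assumes "ring K" "\<And>w. f w \<in> carrier K" "\<And>w. g w \<in> carrier K" "\<And>w. h w \<in> carrier K"
  defines "conv \<equiv> \<lambda>f g w. \<Oplus>\<^bsub>K\<^esub>i\<in>{..length (w :: 'x list)}. f (take i w) \<otimes>\<^bsub>K\<^esub> g (drop i w)"
  shows "conv (conv f g) h w = conv f (conv g h) w"
  using assms(2-4)
proof (induction w arbitrary: f g)
  interpret ring K by fact
  {
    case Nil
    then show ?case by (simp add: conv_def m_assoc)
  next
    case (Cons x w)
    have cl: "conv p q u \<in> carrier K" if "\<And>w. p w \<in> carrier K" "\<And>w. q w \<in> carrier K" for p q u
      using that by (auto simp: conv_def)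
    have C: "conv p q (x # w) = p [] \<otimes>\<^bsub>K\<^esub> q (x # w) \<oplus>\<^bsub>K\<^esub> conv (\<lambda>u. p (x # u)) q w"
      if "\<And>w. p w \<in> carrier K" "\<And>w. q w \<in> carrier K" for p q w
      unfolding conv_def using that by (rule conv_Cons[OF ring_axioms])
    have L: "conv (\<lambda>u. a \<otimes>\<^bsub>K\<^esub> p u \<oplus>\<^bsub>K\<^esub> q u) r w = a \<otimes>\<^bsub>K\<^esub> conv p r w \<oplus>\<^bsub>K\<^esub> conv q r w"
      if "a \<in> carrier K" "\<And>w. p w \<in> carrier K" "\<And>w. q w \<in> carrier K" "\<And>w. r w \<in> carrier K" for a p q r w
    proof -
      have "conv (\<lambda>u. a \<otimes>\<^bsub>K\<^esub> p u \<oplus>\<^bsub>K\<^esub> q u) r w =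
        (\<Oplus>\<^bsub>K\<^esub>i\<in>{..length w}. a \<otimes>\<^bsub>K\<^esub> (p (take i w) \<otimes>\<^bsub>K\<^esub> r (drop i w)) \<oplus>\<^bsub>K\<^esub> q (take i w) \<otimes>\<^bsub>K\<^esub> r (drop i w))"
        unfolding conv_def using that by (intro finsum_cong') (auto simp: l_distr m_assoc)
      also have "\<dots> = (\<Oplus>\<^bsub>K\<^esub>i\<in>{..length w}. a \<otimes>\<^bsub>K\<^esub> (p (take i w) \<otimes>\<^bsub>K\<^esub> r (drop i w))) \<oplus>\<^bsub>K\<^esub> conv q r w"
        unfolding conv_def using that by (intro finsum_addf) auto
      also have "(\<Oplus>\<^bsub>K\<^esub>i\<in>{..length w}. a \<otimes>\<^bsub>K\<^esub> (p (take i w) \<otimes>\<^bsub>K\<^esub> r (drop i w))) = a \<otimes>\<^bsub>K\<^esub> conv p r w"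
        unfolding conv_def using that by (intro finsum_rdistr[symmetric]) auto
      finally show ?thesis .
    qed
    let ?f = "\<lambda>u. f (x # u)" and ?g = "\<lambda>u. g (x # u)"
    have "conv (conv f g) h (x # w) =
      conv f g [] \<otimes>\<^bsub>K\<^esub> h (x # w) \<oplus>\<^bsub>K\<^esub> conv (\<lambda>u. conv f g (x # u)) h w"
      using Cons.prems by (intro C) (auto simp: cl)
    also have "(\<lambda>u. conv f g (x # u)) = (\<lambda>u. f [] \<otimes>\<^bsub>K\<^esub> ?g u \<oplus>\<^bsub>K\<^esub> conv ?f g u)"
      using Cons.prems by (intro ext C) auto
    also have "conv \<dots> h w = f [] \<otimes>\<^bsub>K\<^esub> conv ?g h w \<oplus>\<^bsub>K\<^esub> conv (conv ?f g) h w"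
      using Cons.prems by (intro L) (auto simp: cl)
    also have "conv (conv ?f g) h w = conv ?f (conv g h) w"
      using Cons.prems by (intro Cons.IH) auto
    also have "conv f g [] = f [] \<otimes>\<^bsub>K\<^esub> g []" using Cons.prems by (simp add: conv_def)
    also have "f [] \<otimes>\<^bsub>K\<^esub> g [] \<otimes>\<^bsub>K\<^esub> h (x # w) \<oplus>\<^bsub>K\<^esub> (f [] \<otimes>\<^bsub>K\<^esub> conv ?g h w \<oplus>\<^bsub>K\<^esub> conv ?f (conv g h) w) =
      f [] \<otimes>\<^bsub>K\<^esub> (g [] \<otimes>\<^bsub>K\<^esub> h (x # w) \<oplus>\<^bsub>K\<^esub> conv ?g h w) \<oplus>\<^bsub>K\<^esub> conv ?f (conv g h) w"
      using Cons.prems by (simp add: cl m_assoc r_distr a_assoc)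
    also have "g [] \<otimes>\<^bsub>K\<^esub> h (x # w) \<oplus>\<^bsub>K\<^esub> conv ?g h w = conv g h (x # w)"
      using Cons.prems by (intro C[symmetric]) auto
    also have "f [] \<otimes>\<^bsub>K\<^esub> conv g h (x # w) \<oplus>\<^bsub>K\<^esub> conv ?f (conv g h) w = conv f (conv g h) (x # w)"
      using Cons.prems by (intro C[symmetric]) (auto simp: cl)
    finally show ?case .
  }
qed

lemma free_alg_kalgebra:
  assumes "field K"
  shows "kalgebra K (free_alg K X)"
proof -
  interpret K: field K by fact
  interpret vectorspace K "free_alg K X" by (rule free_alg_vectorspace) fact
  have val: "f w \<in> carrier K" if "f \<in> carrier (free_alg K X)" for f w
    using that by (simp add: free_alg_simps)
  show ?thesis
  proof
    fix x y z assume xyz: "x \<in> carrier (free_alg K X)" "y \<in> carrier (free_alg K X)" "z \<in> carrier (free_alg K X)"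
    note v = xyz[THEN val]
    show "(x \<otimes>\<^bsub>free_alg K X\<^esub> y) \<otimes>\<^bsub>free_alg K X\<^esub> z = x \<otimes>\<^bsub>free_alg K X\<^esub> (y \<otimes>\<^bsub>free_alg K X\<^esub> z)"
      unfolding free_alg_simps by (rule ext, rule conv_assoc[OF K.ring_axioms]) (rule v)+
    have "(\<Oplus>\<^bsub>K\<^esub>i\<in>{..length w}. (x (take i w) \<oplus>\<^bsub>K\<^esub> y (take i w)) \<otimes>\<^bsub>K\<^esub> z (drop i w)) =
      (\<Oplus>\<^bsub>K\<^esub>i\<in>{..length w}. x (take i w) \<otimes>\<^bsub>K\<^esub> z (drop i w)  \<oplus>\<^bsub>K\<^esub> y (take i w) \<otimes>\<^bsub>K\<^esub> z (drop i w))" for w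
      using v by (intro K.finsum_cong') (auto simp: K.l_distr)
    also have "\<dots> w = (\<Oplus>\<^bsub>K\<^esub>i\<in>{..length w}. x (take i w) \<otimes>\<^bsub>K\<^esub> z (drop i w)) \<oplus>\<^bsub>K\<^esub>
      (\<Oplus>\<^bsub>K\<^esub>i\<in>{..length w}. y (take i w) \<otimes>\<^bsub>K\<^esub> z (drop i w))" for w
      using v by (intro K.finsum_addf) auto
    finally show "(x \<oplus>\<^bsub>free_alg K X\<^esub> y) \<otimes>\<^bsub>free_alg K X\<^esub> z = x \<otimes>\<^bsub>free_alg K X\<^esub> z \<oplus>\<^bsub>free_alg K X\<^esub> y \<otimes>\<^bsub>free_alg K X\<^esub> z"
      by (simp add: free_alg_simps fun_eq_iff)
    have "(\<Oplus>\<^bsub>K\<^esub>i\<in>{..length w}. z (take i w) \<otimes>\<^bsub>K\<^esub> (x (drop i w) \<oplus>\<^bsub>K\<^esub> y (drop i w))) =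
      (\<Oplus>\<^bsub>K\<^esub>i\<in>{..length w}. z (take i w) \<otimes>\<^bsub>K\<^esub> x (drop i w)  \<oplus>\<^bsub>K\<^esub> z (take i w) \<otimes>\<^bsub>K\<^esub> y (drop i w))" for w
      using v by (intro K.finsum_cong') (auto simp: K.r_distr)
    also have "\<dots> w = (\<Oplus>\<^bsub>K\<^esub>i\<in>{..length w}. z (take i w) \<otimes>\<^bsub>K\<^esub> x (drop i w)) \<oplus>\<^bsub>K\<^esub>
      (\<Oplus>\<^bsub>K\<^esub>i\<in>{..length w}. z (take i w) \<otimes>\<^bsub>K\<^esub> y (drop i w))" for w
      using v by (intro K.finsum_addf) auto
    finally show "z \<otimes>\<^bsub>free_alg K X\<^esub> (x \<oplus>\<^bsub>free_alg K X\<^esub> y) = z \<otimes>\<^bsub>free_alg K X\<^esub> x \<oplus>\<^bsub>free_alg K X\<^esub> z \<otimes>\<^bsub>free_alg K X\<^esub> y"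
      by (simp add: free_alg_simps fun_eq_iff)
  next
    fix c x y assume c: "c \<in> carrier K" and xy: "x \<in> carrier (free_alg K X)" "y \<in> carrier (free_alg K X)"
    note v = xy[THEN val]
    have "(\<Oplus>\<^bsub>K\<^esub>i\<in>{..length w}. (c \<otimes>\<^bsub>K\<^esub> x (take i w)) \<otimes>\<^bsub>K\<^esub> y (drop i w)) =
      c \<otimes>\<^bsub>K\<^esub> (\<Oplus>\<^bsub>K\<^esub>i\<in>{..length w}. x (take i w) \<otimes>\<^bsub>K\<^esub> y (drop i w))" for w
      using v c by (subst K.finsum_rdistr) (auto intro!: K.finsum_cong' simp: K.m_assoc)
    then show "(c \<odot>\<^bsub>free_alg K X\<^esub> x) \<otimes>\<^bsub>free_alg K X\<^esub> y = c \<odot>\<^bsub>free_alg K X\<^esub> (x \<otimes>\<^bsub>free_alg K X\<^esub> y)"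
      by (simp add: free_alg_simps fun_eq_iff)
    have "(\<Oplus>\<^bsub>K\<^esub>i\<in>{..length w}. x (take i w) \<otimes>\<^bsub>K\<^esub> (c \<otimes>\<^bsub>K\<^esub> y (drop i w))) =
      c \<otimes>\<^bsub>K\<^esub> (\<Oplus>\<^bsub>K\<^esub>i\<in>{..length w}. x (take i w) \<otimes>\<^bsub>K\<^esub> y (drop i w))" for w
      using v c by (subst K.finsum_rdistr) (auto intro!: K.finsum_cong' simp: K.m_lcomm)
    then show "x \<otimes>\<^bsub>free_alg K X\<^esub> (c \<odot>\<^bsub>free_alg K X\<^esub> y) = c \<odot>\<^bsub>free_alg K X\<^esub> (x \<otimes>\<^bsub>free_alg K X\<^esub> y)"
      by (simp add: free_alg_simps fun_eq_iff)
  qed (simp add: free_alg_mult_closed assms)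
qed

context kalgebra begin

lemma gen_alg_ideal_carrier:
  assumes "S \<subseteq> carrier A" "x \<in> gen_alg_ideal K A S"
  shows "x \<in> carrier A"
  using assms(2,1) by induction (auto intro: kalg_m_closed)

lemma gen_alg_ideal_subgroup:
  assumes "S \<subseteq> carrier A"
  shows "abelian_subgroup (gen_alg_ideal K A S) A"
proof (rule abelian_subgroupI3)
  show "additive_subgroup (gen_alg_ideal K A S) A"
  proof (rule additive_subgroup.intro, rule group.subgroupI)
    show "gen_alg_ideal K A S \<subseteq> carrier (add_monoid A)"
      using gen_alg_ideal_carrier[OF assms] by auto
    show "gen_alg_ideal K A S \<noteq> {}" using gen_alg_ideal.zero by blast
    fix a assume a: "a \<in> gen_alg_ideal K A S"
    then have "a \<in> carrier A" using gen_alg_ideal_carrier[OF assms] by auto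
    moreover have "(\<ominus>\<^bsub>K\<^esub> \<one>\<^bsub>K\<^esub>) \<odot>\<^bsub>A\<^esub> a \<in> gen_alg_ideal K A S"
      using a by (intro gen_alg_ideal.smult) auto
    ultimately have "\<ominus>\<^bsub>A\<^esub> a \<in> gen_alg_ideal K A S"
      by (metis smult_l_minus R.one_closed smult_one)
    then show "inv\<^bsub>add_monoid A\<^esub> a \<in> gen_alg_ideal K A S" by (simp add: a_inv_def)
  qed (use M.a_group in \<open>auto intro: gen_alg_ideal.add\<close>)
  show "abelian_group A" by (rule M.abelian_group_axioms)
qed


lemma quot_alg_rules:
  assumes S: "S \<subseteq> carrier A"
  defines "I \<equiv> gen_alg_ideal K A S"
  defines "Q \<equiv> quot_alg A I"
  shows "carrier Q = (\<lambda>x. I +>\<^bsub>A\<^esub> x) ` carrier A"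
    and "zero Q = I +>\<^bsub>A\<^esub> \<zero>\<^bsub>A\<^esub>"
    and "\<And>x y. x \<in> carrier A \<Longrightarrow> y \<in> carrier A \<Longrightarrow> (I +>\<^bsub>A\<^esub> x) \<oplus>\<^bsub>Q\<^esub> (I +>\<^bsub>A\<^esub> y) = I +>\<^bsub>A\<^esub> (x \<oplus>\<^bsub>A\<^esub> y)"
    and "\<And>x y. x \<in> carrier A \<Longrightarrow> y \<in> carrier A \<Longrightarrow> (I +>\<^bsub>A\<^esub> x) \<otimes>\<^bsub>Q\<^esub> (I +>\<^bsub>A\<^esub> y) = I +>\<^bsub>A\<^esub> (x \<otimes>\<^bsub>A\<^esub> y)"
    and "\<And>c x. c \<in> carrier K \<Longrightarrow> x \<in> carrier A \<Longrightarrow> c \<odot>\<^bsub>Q\<^esub> (I +>\<^bsub>A\<^esub> x) = I +>\<^bsub>A\<^esub> (c \<odot>\<^bsub>A\<^esub> x)"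
    and "\<And>x. x \<in> I \<Longrightarrow> I +>\<^bsub>A\<^esub> x = zero Q"
proof -
  interpret I: abelian_subgroup I A unfolding I_def using S by (rule gen_alg_ideal_subgroup)
  have Ic: "\<And>x. x \<in> I \<Longrightarrow> x \<in> carrier A" by (rule I.a_Hcarr)
  show "carrier Q = (\<lambda>x. I +>\<^bsub>A\<^esub> x) ` carrier A"
    by (auto simp: Q_def quot_alg_def FactRing_def A_RCOSETS_def RCOSETS_def a_r_coset_def)
  show "zero Q = I +>\<^bsub>A\<^esub> \<zero>\<^bsub>A\<^esub>"
    by (simp add: Q_def quot_alg_def FactRing_def I.a_rcos_const)
  show "I +>\<^bsub>A\<^esub> x = zero Q" if "x \<in> I" for x
    using that by (simp add: Q_def quot_alg_def FactRing_def I.a_rcos_const)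
  show "(I +>\<^bsub>A\<^esub> x) \<oplus>\<^bsub>Q\<^esub> (I +>\<^bsub>A\<^esub> y) = I +>\<^bsub>A\<^esub> (x \<oplus>\<^bsub>A\<^esub> y)" if "x \<in> carrier A" "y \<in> carrier A" for x y
    using that by (simp add: Q_def quot_alg_def FactRing_def I.a_rcos_sum)
  have mem: "x' \<in> I +>\<^bsub>A\<^esub> x \<longleftrightarrow> (\<exists>h\<in>I. x' = h \<oplus>\<^bsub>A\<^esub> x)" for x x'
    by (auto simp: a_r_coset_def r_coset_def)
  have self: "x \<in> I +>\<^bsub>A\<^esub> x" if "x \<in> carrier A" for x using I.a_rcos_self that by auto
  have eqI: "I +>\<^bsub>A\<^esub> (h \<oplus>\<^bsub>A\<^esub> x) = I +>\<^bsub>A\<^esub> x" if "h \<in> I" "x \<in> carrier A" for h x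
    using that by (metis I.a_repr_independence' mem)
  show "(I +>\<^bsub>A\<^esub> x) \<otimes>\<^bsub>Q\<^esub> (I +>\<^bsub>A\<^esub> y) = I +>\<^bsub>A\<^esub> (x \<otimes>\<^bsub>A\<^esub> y)" if xy: "x \<in> carrier A" "y \<in> carrier A" for x y
  proof -
    have "I +>\<^bsub>A\<^esub> (a \<otimes>\<^bsub>A\<^esub> b) = I +>\<^bsub>A\<^esub> (x \<otimes>\<^bsub>A\<^esub> y)" if "a \<in> I +>\<^bsub>A\<^esub> x" "b \<in> I +>\<^bsub>A\<^esub> y" for a b
    proof -
      obtain h k where hk: "h \<in> I" "k \<in> I" "a = h \<oplus>\<^bsub>A\<^esub> x" "b = k \<oplus>\<^bsub>A\<^esub> y" using \<open>a \<in> _\<close> \<open>b \<in> _\<close> by (auto simp: mem)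
      note c = hk(1,2)[THEN Ic]
      have "a \<otimes>\<^bsub>A\<^esub> b = (h \<otimes>\<^bsub>A\<^esub> (k \<oplus>\<^bsub>A\<^esub> y) \<oplus>\<^bsub>A\<^esub> x \<otimes>\<^bsub>A\<^esub> k) \<oplus>\<^bsub>A\<^esub> x \<otimes>\<^bsub>A\<^esub> y"
        using hk c xy by (simp add: kalg_l_distr kalg_r_distr kalg_m_closed M.a_ac)
      moreover have "h \<otimes>\<^bsub>A\<^esub> (k \<oplus>\<^bsub>A\<^esub> y) \<oplus>\<^bsub>A\<^esub> x \<otimes>\<^bsub>A\<^esub> k \<in> I"
        unfolding I_def using hk c xy
        by (intro gen_alg_ideal.add gen_alg_ideal.l_mult gen_alg_ideal.r_mult) (auto simp: I_def)
      ultimately show ?thesis using eqI xy by (simp add: kalg_m_closed)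
    qed
    then have "(\<Union>a\<in>I +>\<^bsub>A\<^esub> x. \<Union>b\<in>I +>\<^bsub>A\<^esub> y. I +>\<^bsub>A\<^esub> (a \<otimes>\<^bsub>A\<^esub> b)) =
        (\<Union>a\<in>I +>\<^bsub>A\<^esub> x. \<Union>b\<in>I +>\<^bsub>A\<^esub> y. I +>\<^bsub>A\<^esub> (x \<otimes>\<^bsub>A\<^esub> y))"
      by (intro SUP_cong HOL.refl)
    also have "\<dots> = I +>\<^bsub>A\<^esub> (x \<otimes>\<^bsub>A\<^esub> y)" using self[OF xy(1)] self[OF xy(2)] by blast
    finally show ?thesis by (simp add: Q_def quot_alg_def FactRing_def rcoset_mult_def)
  qed
  show "c \<odot>\<^bsub>Q\<^esub> (I +>\<^bsub>A\<^esub> x) = I +>\<^bsub>A\<^esub> (c \<odot>\<^bsub>A\<^esub> x)" if cx: "c \<in> carrier K" "x \<in> carrier A" for c x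
  proof -
    have "I +>\<^bsub>A\<^esub> (c \<odot>\<^bsub>A\<^esub> a) = I +>\<^bsub>A\<^esub> (c \<odot>\<^bsub>A\<^esub> x)" if a: "a \<in> I +>\<^bsub>A\<^esub> x" for a
    proof -
      obtain h where h: "h \<in> I" "a = h \<oplus>\<^bsub>A\<^esub> x" using a by (auto simp: mem)
      have "c \<odot>\<^bsub>A\<^esub> h \<in> I" using h cx unfolding I_def by (intro gen_alg_ideal.smult)
      moreover have "c \<odot>\<^bsub>A\<^esub> a = c \<odot>\<^bsub>A\<^esub> h \<oplus>\<^bsub>A\<^esub> c \<odot>\<^bsub>A\<^esub> x" using h cx Ic by (simp add: smult_r_distr)
      ultimately show ?thesis using eqI cx by simp
    qed
    then have "(\<Union>a\<in>I +>\<^bsub>A\<^esub> x. I +>\<^bsub>A\<^esub> (c \<odot>\<^bsub>A\<^esub> a)) = (\<Union>a\<in>I +>\<^bsub>A\<^esub> x. I +>\<^bsub>A\<^esub> (c \<odot>\<^bsub>A\<^esub> x))"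
      by (intro SUP_cong HOL.refl)
    also have "\<dots> = I +>\<^bsub>A\<^esub> (c \<odot>\<^bsub>A\<^esub> x)" using self[OF cx(2)] by blast
    finally show ?thesis by (simp add: Q_def quot_alg_def)
  qed
qed

lemma quot_alg_kalgebra:
  assumes S: "S \<subseteq> carrier A"
  shows "kalgebra K (quot_alg A (gen_alg_ideal K A S))" (is "kalgebra K ?Q")
proof -
  note [simp] = quot_alg_rules(2-5)[OF S] kalg_m_closed
  note car = quot_alg_rules(1)[OF S]
  have ag: "abelian_group ?Q"
  proof (rule abelian_groupI)
    fix X assume "X \<in> carrier ?Q"
    then obtain x where "x \<in> carrier A" "X = gen_alg_ideal K A S +>\<^bsub>A\<^esub> x" by (auto simp: car)
    then show "\<exists>Y\<in>carrier ?Q. Y \<oplus>\<^bsub>?Q\<^esub> X = \<zero>\<^bsub>?Q\<^esub>"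
      by (intro bexI[of _ "gen_alg_ideal K A S +>\<^bsub>A\<^esub> (\<ominus>\<^bsub>A\<^esub> x)"]) (auto simp: car M.l_neg)
  qed (auto simp: car M.a_ac)
  have "module K ?Q"
    by (rule moduleI[OF R.is_cring ag])
       (auto simp: car smult_l_distr smult_r_distr smult_assoc1)
  then have "vectorspace K ?Q" by (simp add: vectorspace_def field_axioms)
  then show ?thesis
    by (intro kalgebra.intro kalgebra_axioms.intro)
       (auto simp: car kalg_m_assoc kalg_l_distr kalg_r_distr kalg_smult_l kalg_smult_r)
qed

end

lemma gen_closed:
  assumes "field K" "x \<in> X"
  shows "gen K x \<in> carrier (free_alg K X)"
proof -
  interpret field K by fact
  show ?thesis using assms(2) by (auto simp: free_alg_simps gen_def)
qed

lemma lpa_rels_carrier: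
  assumes "field K" "fin_digraph E"
  shows "lpa_rels K E \<subseteq> carrier (free_alg K (lpa_gens E))"
proof -
  interpret fin_digraph E by fact
  interpret F: kalgebra K "free_alg K (lpa_gens E)" by (rule free_alg_kalgebra) fact
  have g: "v \<in> verts E \<Longrightarrow> gen K (Vertex v) \<in> carrier (free_alg K (lpa_gens E))"
    "e \<in> arcs E \<Longrightarrow> gen K (Edge e) \<in> carrier (free_alg K (lpa_gens E))"
    "e \<in> arcs E \<Longrightarrow> gen K (Ghost e) \<in> carrier (free_alg K (lpa_gens E))" for v e
    by (auto intro!: gen_closed assms simp: lpa_gens_def)
  have "(\<Oplus>\<^bsub>free_alg K (lpa_gens E)\<^esub>e\<in>out_arcs E v. gen K (Edge e) \<otimes>\<^bsub>free_alg K (lpa_gens E)\<^esub> gen K (Ghost e))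
     \<in> carrier (free_alg K (lpa_gens E))" for v
    by (intro F.M.finsum_closed) (auto intro!: F.kalg_m_closed g)
  then show ?thesis
    by (auto simp: lpa_rels_def Let_def intro!: F.M.minus_closed F.kalg_m_closed g)
qed

lemma kalgebra_one_update:
  assumes "kalgebra K Q"
  shows "kalgebra K (Q\<lparr>one := u\<rparr>)"
proof -
  interpret kalgebra K Q by fact
  have ag: "abelian_group (Q\<lparr>one := u\<rparr>)"
  proof (rule abelian_groupI)
    fix x assume "x \<in> carrier (Q\<lparr>one := u\<rparr>)"
    then show "\<exists>y\<in>carrier (Q\<lparr>one := u\<rparr>). y \<oplus>\<^bsub>Q\<lparr>one := u\<rparr>\<^esub> x = \<zero>\<^bsub>Q\<lparr>one := u\<rparr>\<^esub>"
      by (intro bexI[of _ "\<ominus>\<^bsub>Q\<^esub> x"]) (auto simp: M.l_neg)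
  qed (auto simp: M.a_ac)
  have "module K (Q\<lparr>one := u\<rparr>)"
    by (rule moduleI[OF R.is_cring ag]) (auto simp: smult_l_distr smult_r_distr smult_assoc1)
  then have "vectorspace K (Q\<lparr>one := u\<rparr>)" by (simp add: vectorspace_def field_axioms)
  then show ?thesis
    by (intro kalgebra.intro kalgebra_axioms.intro)
       (auto simp: kalg_m_closed kalg_m_assoc kalg_l_distr kalg_r_distr kalg_smult_l kalg_smult_r)
qed

lemma leavitt_path_algebra_kalgebra:
  assumes "field K" "fin_digraph E"
  shows "kalgebra K (leavitt_path_algebra K E)"
  unfolding leavitt_path_algebra_def Let_def
  by (rule kalgebra_one_update, rule kalgebra.quot_alg_kalgebra,
      rule free_alg_kalgebra[OF assms(1)], rule lpa_rels_carrier[OF assms])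

end

theory Submission
  imports Defs "HOL-Library.Sublist" "HOL-Real_Asymp.Real_Asymp"
begin

text \<open>
  Disjointness of cycles means that a vertex has at most one arc that starts a closed walk.

  Order ideals of the talented monoid correspond to hereditary saturated vertex sets, and simple
  quotients to covers \<open>S' \<subset> S\<close> of such sets. If the cover contains a new sink \<open>v\<close>, then counting
  walks into \<open>v\<close> by their time of arrival gives invariants with finite support, which no nontrivial
  shift can leave comparable. Otherwise a minimal strongly connected part of \<open>S - S'\<close> is
  a cycle whose exits all lie in \<open>S'\<close>, and the quotient is periodic. Conversely, a vertex \<open>u\<close> with two
  returning arcs satisfies \<open>u = u(a) + u(b) + c\<close> in every quotient in which it survives, with
  \<open>a, b > 0\<close>; this is a comparison, and periodicity would turn it into \<open>u = u + u(b) + c'\<close>, which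
  contradicts the eventually invariant number of walks that avoid \<open>S'\<close>.

  Products of generators of the Leavitt path algebra are \<open>0\<close> or monomials \<open>p q\<^sup>*\<close>. With disjoint cycles a
  walk is determined by its origin, its length and the times at which it uses arcs that lie on no
  cycle, so there are only polynomially many monomials of bounded length. Two closed walks
  at \<open>u\<close> with different first arcs, on the other hand, generate a free algebra as soon as \<open>u \<noteq> 0\<close>.
\<close>

section \<open>Graphs with disjoint cycles\<close>

text \<open>The monoid and the algebra are both given by generators and relations, so equalities are
  easy to produce and the difficulty lies in showing that elements differ. In the talented monoid
  this is done with additive invariants: a function of vertex and time whose value at
  \<open>v(i)\<close> is its sum over the arcs leaving \<open>v\<close> descends to the congruence,
  and if it vanishes on \<open>S'\<close> it also descends to the quotient by \<open>S'\<close>.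
  Arrivals at a sink satisfy the relations exactly. The count of surviving walks may fail them at
  times that are not before the horizon \<open>n\<close>, so it is an invariant only for all large
  \<open>n\<close>; for this reason invariance is formulated along a filter. In the algebra,
  independence is tested by multiplying with dual words, which reduces freeness to the single fact
  that a vertex is not zero. That fact needs a representation available for every finite graph and
  every field: partial maps on a set of points turn the relations into arithmetic with residues. The
  upper bound on growth aims at finiteness alone, so its exponents are generous.\<close>

context fin_digraph begin

text \<open>An \<open>apath\<close> back to the tail suffices: only heads are compared, and the
  heads of \<open>e # p\<close> are exactly the vertices of that \<open>apath\<close>.\<close>

lemma cycle_of_return_path:
  assumes "e \<in> arcs G" "head G e \<rightarrow>\<^sup>* tail G e"
  obtains p where "cycle (e # p)"
proof -
  obtain p where p: "apath (head G e) p (tail G e)"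
    using assms(2) reachable_apath by blast
  then have "awalk (tail G e) (e # p) (tail G e)" "distinct (tl (awalk_verts (tail G e) (e # p)))"
    using assms(1) by (auto simp: apath_def awalk_Cons_iff)
  then have "cycle (e # p)" unfolding cycle_def by blast
  then show thesis ..
qed

text \<open>The rest of a proper extension of \<open>p\<close> would be closed at the same base, so
  the base would occur twice among the heads of \<open>q\<close>.\<close>

lemma cycle_prefix_eq:
  assumes "cycle p" "cycle q" "tail G (hd p) = tail G (hd q)" "prefix p q"
  shows "p = q"
proof (rule ccontr) 
  assume "p \<noteq> q"
  with assms(4) obtain r where q: "q = p @ r" "r \<noteq> []" by (auto simp: prefix_def)
  obtain u where u: "awalk u p u" "p \<noteq> []" using assms(1) by (auto simp: cycle_def)
  obtain w where w: "awalk w q w" "distinct (tl (awalk_verts w q))" using assms(2) by (auto simp: cycle_def)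
  have tlv: "tail G (hd c) = x" if "awalk x c y" "c \<noteq> []" for x c y
    using that by (cases c) (auto simp: awalk_Cons_iff)
  have "u = w" using tlv[OF u] tlv[OF w(1)] q assms(3) by simp
  then have r: "awalk u r u" using w(1) u q by auto
  have "awalk_verts u q = awalk_verts u p @ tl (awalk_verts u r)"
    using w(1) \<open>u = w\<close> q(1) awalk_verts_append[of u p r u] awlast_of_awalk[OF u(1)] by simp
  moreover have "u \<in> set (tl (awalk_verts u c))" if "awalk u c u" "c \<noteq> []" for c
    using that awlast_of_awalk[OF that(1)] by (cases c) (auto split: if_splits)
  then have "u \<in> set (tl (awalk_verts u p))" "u \<in> set (tl (awalk_verts u r))" using u r q by auto
  ultimately show False using w(2) \<open>u = w\<close> by (cases "awalk_verts u p") auto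
qed

text \<open>Two different cycles at \<open>v\<close> are not prefixes of each other, so they part at
  some vertex by two different arcs, and the remainders of both lead back there through
  \<open>v\<close>.\<close>

lemma disjoint_cycles_iff:
  "disjoint_cycles G \<longleftrightarrow>
     (\<forall>e\<in>arcs G. \<forall>f\<in>arcs G. tail G e = tail G f \<and> head G e \<rightarrow>\<^sup>* tail G e \<and>
        head G f \<rightarrow>\<^sup>* tail G f \<longrightarrow> e = f)" (is "?L \<longleftrightarrow> ?R")
proof
  assume L: ?L
  show ?R
  proof (intro ballI impI, elim conjE)
    fix e f assume a: "e \<in> arcs G" "f \<in> arcs G" "tail G e = tail G f"
      "head G e \<rightarrow>\<^sup>* tail G e" "head G f \<rightarrow>\<^sup>* tail G f"
    obtain p q where "cycle (e # p)" "cycle (f # q)"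
      using a cycle_of_return_path by metis
    then have "e # p = f # q" using L a unfolding disjoint_cycles_def
      by (metis list.sel(1) tail_in_verts)
    then show "e = f" by simp
  qed
next
  assume R: ?R
  show ?L unfolding disjoint_cycles_def
  proof (intro ballI allI impI, elim conjE, rule ccontr)
    fix v c d assume c: "cycle c" "tail G (hd c) = v" and d: "cycle d" "tail G (hd d) = v" and ne: "c \<noteq> d"
    have "c \<parallel> d" using cycle_prefix_eq[OF c(1) d(1)] cycle_prefix_eq[OF d(1) c(1)] c d ne by auto
    then obtain as e p f q where ef: "e \<noteq> f" "c = as @ e # p" "d = as @ f # q"
      using parallel_decomp by blast
    obtain u where u: "awalk u c u" using c(1) by (auto simp: cycle_def)
    obtain w where w: "awalk w d w" using d(1) by (auto simp: cycle_def)
    have "tail G (hd c) = u" "tail G (hd d) = w"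
      using u w ef by (cases as; auto simp: awalk_Cons_iff)+
    then have "u = w" using c d by simp
    have "e \<in> arcs G" "f \<in> arcs G" "tail G e = tail G f"
      using u w \<open>u = w\<close> ef by (auto simp: awalk_Cons_iff) 
    moreover have "head G e \<rightarrow>\<^sup>* u" "head G f \<rightarrow>\<^sup>* u" "u \<rightarrow>\<^sup>* tail G e" "u \<rightarrow>\<^sup>* tail G f"
      using u w \<open>u = w\<close> ef by (auto simp: awalk_Cons_iff intro: reachable_awalkI)
    then have "head G e \<rightarrow>\<^sup>* tail G e" "head G f \<rightarrow>\<^sup>* tail G f"
      by (blast intro: reachable_trans)+
    ultimately show False using R ef(1) by blast
  qed
qed

end

section \<open>Quotients by order ideals\<close>

text \<open>One locale for both kinds of quotient: the talented monoid as a quotient of the free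
  monoid, and \<open>J/I\<close> for nested order ideals.\<close>

locale gamma_congruence = gamma_monoid T
  for T :: "('a, 'g :: ab_group_add) gamma_monoid" (structure) and r :: "'a rel" +
  assumes equiv: "equiv (carrier T) r"
    and compat_mult: "(a, b) \<in> r \<Longrightarrow> (c, d) \<in> r \<Longrightarrow> (a \<otimes> c, b \<otimes> d) \<in> r"
    and compat_act: "(a, b) \<in> r \<Longrightarrow> (act T g a, act T g b) \<in> r"
begin

abbreviation "Q \<equiv> quot_gamma_monoid T r"

lemma Q_carrier: "carrier Q = (\<lambda>a. r `` {a}) ` carrier T"
  by (auto simp: quot_gamma_monoid_def quotient_def)

lemma Q_one: "\<one>\<^bsub>Q\<^esub> = r `` {\<one>}"
  by (simp add: quot_gamma_monoid_def)

lemma Q_eq_iff: "a \<in> carrier T \<Longrightarrow> b \<in> carrier T \<Longrightarrow> r `` {a} = r `` {b} \<longleftrightarrow> (a, b) \<in> r"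
  using equiv by (simp add: eq_equiv_class_iff)

lemma Q_mult:
  assumes "a \<in> carrier T" "b \<in> carrier T"
  shows "(r `` {a}) \<otimes>\<^bsub>Q\<^esub> (r `` {b}) = r `` {a \<otimes> b}"
proof -
  have "r `` {a' \<otimes> b'} = r `` {a \<otimes> b}" if "a' \<in> r `` {a}" "b' \<in> r `` {b}" for a' b'
    using that equiv_class_eq[OF equiv compat_mult, of a a' b b'] by auto
  moreover have "a \<in> r `` {a}" "b \<in> r `` {b}" using assms equiv_class_self[OF equiv] by auto
  ultimately have "(\<Union>a'\<in>r `` {a}. \<Union>b'\<in>r `` {b}. r `` {a' \<otimes> b'}) = r `` {a \<otimes> b}"
    by blast
  then show ?thesis by (simp add: quot_gamma_monoid_def)
qed

lemma Q_act:
  assumes "a \<in> carrier T"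
  shows "act Q g (r `` {a}) = r `` {act T g a}"
proof -
  have "r `` {act T g a'} = r `` {act T g a}" if "a' \<in> r `` {a}" for a'
    using that equiv_class_eq[OF equiv compat_act, of a a' g] by auto
  moreover have "a \<in> r `` {a}" using assms equiv_class_self[OF equiv] by auto
  ultimately have "(\<Union>a'\<in>r `` {a}. r `` {act T g a'}) = r `` {act T g a}"
    by blast
  then show ?thesis by (simp add: quot_gamma_monoid_def)
qed

end

lemma order_idealI:
  assumes "submonoid I T" "\<And>g x. x \<in> I \<Longrightarrow> act T g x \<in> I"
    "\<And>a b. a \<in> carrier T \<Longrightarrow> b \<in> carrier T \<Longrightarrow> a \<otimes>\<^bsub>T\<^esub> b \<in> I \<Longrightarrow> a \<in> I \<and> b \<in> I"
  shows "order_ideal T I"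
  unfolding order_ideal_def by (intro conjI allI ballI impI assms(1)) (simp_all only: assms)

lemma order_idealD:
  assumes "order_ideal T I"
  shows "submonoid I T" "\<And>g x. x \<in> I \<Longrightarrow> act T g x \<in> I"
    "\<And>a b. a \<in> carrier T \<Longrightarrow> b \<in> carrier T \<Longrightarrow> a \<otimes>\<^bsub>T\<^esub> b \<in> I \<Longrightarrow> a \<in> I"
    "\<And>a b. a \<in> carrier T \<Longrightarrow> b \<in> carrier T \<Longrightarrow> a \<otimes>\<^bsub>T\<^esub> b \<in> I \<Longrightarrow> b \<in> I"
proof -
  note o = assms[unfolded order_ideal_def]
  show "submonoid I T" using o by (elim conjE)
  have "\<forall>g. \<forall>x\<in>I. act T g x \<in> I" using o by (elim conjE)
  then show "x \<in> I \<Longrightarrow> act T g x \<in> I" for g x by blast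
  have *: "\<forall>a\<in>carrier T. \<forall>b\<in>carrier T. a \<otimes>\<^bsub>T\<^esub> b \<in> I \<longrightarrow> a \<in> I \<and> b \<in> I" using o by (elim conjE)
  show "a \<in> carrier T \<Longrightarrow> b \<in> carrier T \<Longrightarrow> a \<otimes>\<^bsub>T\<^esub> b \<in> I \<Longrightarrow> a \<in> I"
    "a \<in> carrier T \<Longrightarrow> b \<in> carrier T \<Longrightarrow> a \<otimes>\<^bsub>T\<^esub> b \<in> I \<Longrightarrow> b \<in> I" for a b
    using * by blast+
qed

locale ideal_pair = gamma_monoid T
  for T :: "('a, 'g :: ab_group_add) gamma_monoid" (structure) and J I :: "'a set" +
  assumes J: "order_ideal T J" and I: "order_ideal T I" and IJ: "I \<subseteq> J"
begin

abbreviation "IC \<equiv> ideal_cong (T\<lparr>carrier := J\<rparr>) I"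

lemma J_sub: "x \<in> J \<Longrightarrow> x \<in> carrier T"
  using submonoid.subset[OF order_idealD(1)[OF J]] by blast

lemma J_closed: "x \<in> J \<Longrightarrow> y \<in> J \<Longrightarrow> x \<otimes> y \<in> J" "\<one> \<in> J"
  using order_idealD(1)[OF J] by (simp_all add: submonoid.m_closed submonoid.one_closed)

lemma I_closed: "x \<in> I \<Longrightarrow> y \<in> I \<Longrightarrow> x \<otimes> y \<in> I" "\<one> \<in> I"
  using order_idealD(1)[OF I] by (simp_all add: submonoid.m_closed submonoid.one_closed)

lemma IC_iff: "(a, b) \<in> IC \<longleftrightarrow> a \<in> J \<and> b \<in> J \<and> (\<exists>i\<in>I. \<exists>j\<in>I. a \<otimes> i = b \<otimes> j)"
  by (simp add: ideal_cong_def)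

lemma gamma_J: "gamma_monoid (T\<lparr>carrier := J\<rparr>)"
proof -
  have "comm_monoid (T\<lparr>carrier := J\<rparr>)"
    by (rule comm_monoidI) (auto simp: m_ac J_sub J_closed)
  then show ?thesis
    by (intro gamma_monoid.intro gamma_monoid_axioms.intro)
       (auto simp: order_idealD(2)[OF J] act_mult act_one act_zero act_add J_sub)
qed

sublocale IQ: gamma_congruence "T\<lparr>carrier := J\<rparr>" IC
proof (intro gamma_congruence.intro gamma_J gamma_congruence_axioms.intro)
  note [simp] = J_sub IJ[THEN subsetD] order_idealD(2)[OF J] order_idealD(2)[OF I] J_closed I_closed
  have rE: thesis if "(a, b) \<in> IC"
    "\<And>i j. a \<in> J \<Longrightarrow> b \<in> J \<Longrightarrow> i \<in> I \<Longrightarrow> j \<in> I \<Longrightarrow> a \<otimes> i = b \<otimes> j \<Longrightarrow> thesis" for a b thesis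
    using that unfolding IC_iff by blast
  have rI: "(a, b) \<in> IC" if "a \<in> J" "b \<in> J" "i \<in> I" "j \<in> I" "a \<otimes> i = b \<otimes> j" for a b i j
    using that unfolding IC_iff by blast
  show "equiv (carrier (T\<lparr>carrier := J\<rparr>)) IC"
  proof (intro equivI refl_onI symI transI)
    show "(a, a) \<in> IC" if "a \<in> carrier (T\<lparr>carrier := J\<rparr>)" for a
      using that by (intro rI[of _ _ \<one> \<one>]) auto
    show "(b, a) \<in> IC" if ab: "(a, b) \<in> IC" for a b
    proof -
      obtain i j where "a \<in> J" "b \<in> J" "i \<in> I" "j \<in> I" "a \<otimes> i = b \<otimes> j" using ab by (rule rE)
      then show ?thesis by (intro rI[of b a j i]) simp_all
    qed
    show "(a, c) \<in> IC" if ab: "(a, b) \<in> IC" and bc: "(b, c) \<in> IC" for a b c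
    proof -
      obtain i j where 1: "a \<in> J" "b \<in> J" "i \<in> I" "j \<in> I" "a \<otimes> i = b \<otimes> j" using ab by (rule rE)
      obtain k l where 2: "c \<in> J" "k \<in> I" "l \<in> I" "b \<otimes> k = c \<otimes> l" using bc by (rule rE)
      have "a \<otimes> (i \<otimes> k) = (b \<otimes> j) \<otimes> k" using 1 2 by (simp flip: m_assoc)
      also have "\<dots> = (b \<otimes> k) \<otimes> j" using 1(1-4) 2(1-3) by (simp add: m_ac)
      also have "\<dots> = c \<otimes> (l \<otimes> j)" unfolding 2(4) using 1(1-4) 2(1-3) by (simp add: m_assoc)
      finally show ?thesis using 1 2 by (intro rI[of a c "i \<otimes> k" "l \<otimes> j"]) auto
    qed
  qed (auto simp: IC_iff)
  show "(a \<otimes>\<^bsub>T\<lparr>carrier := J\<rparr>\<^esub> c, b \<otimes>\<^bsub>T\<lparr>carrier := J\<rparr>\<^esub> d) \<in> IC"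
    if ab: "(a, b) \<in> IC" and cd: "(c, d) \<in> IC" for a b c d
  proof -
    obtain i j where 1: "a \<in> J" "b \<in> J" "i \<in> I" "j \<in> I" "a \<otimes> i = b \<otimes> j" using ab by (rule rE)
    obtain k l where 2: "c \<in> J" "d \<in> J" "k \<in> I" "l \<in> I" "c \<otimes> k = d \<otimes> l" using cd by (rule rE)
    have "(a \<otimes> c) \<otimes> (i \<otimes> k) = (a \<otimes> i) \<otimes> (c \<otimes> k)" using 1(1-4) 2(1-4) by (simp add: m_ac)
    also have "\<dots> = (b \<otimes> d) \<otimes> (j \<otimes> l)" unfolding 1(5) 2(5) using 1(1-4) 2(1-4) by (simp add: m_ac)
    finally show ?thesis using 1 2 by (intro rI[of _ _ "i \<otimes> k" "j \<otimes> l"]) auto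
  qed
  show "(act (T\<lparr>carrier := J\<rparr>) g a, act (T\<lparr>carrier := J\<rparr>) g b) \<in> IC" if ab: "(a, b) \<in> IC" for a b g
  proof -
    obtain i j where 1: "a \<in> J" "b \<in> J" "i \<in> I" "j \<in> I" "a \<otimes> i = b \<otimes> j" using ab by (rule rE)
    have "act T g a \<otimes> act T g i = act T g b \<otimes> act T g j"
      using 1 by (simp flip: act_mult)
    then show ?thesis using 1 by (intro rI[of _ _ "act T g i" "act T g j"]) auto
  qed
qed

definition qc :: "'a \<Rightarrow> 'a set" where "qc x = IC `` {x}"

lemma iq_carrier: "carrier (ideal_quot T J I) = qc ` J"
  and iq_one: "\<one>\<^bsub>ideal_quot T J I\<^esub> = qc \<one>"
  and iq_mult: "x \<in> J \<Longrightarrow> y \<in> J \<Longrightarrow> qc x \<otimes>\<^bsub>ideal_quot T J I\<^esub> qc y = qc (x \<otimes> y)"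
  and iq_act: "x \<in> J \<Longrightarrow> act (ideal_quot T J I) g (qc x) = qc (act T g x)"
  using IQ.Q_carrier IQ.Q_one IQ.Q_mult[of x y] IQ.Q_act[of x g] by (simp_all add: ideal_quot_def qc_def[abs_def])

lemma qc_eq_iff: "x \<in> J \<Longrightarrow> y \<in> J \<Longrightarrow> qc x = qc y \<longleftrightarrow> (\<exists>i\<in>I. \<exists>j\<in>I. x \<otimes> i = y \<otimes> j)"
  using IQ.Q_eq_iff[of x y] by (simp add: IC_iff qc_def)

text \<open>If \<open>x + i = j\<close> with \<open>i\<close> and \<open>j\<close> in
  \<open>I\<close>, then \<open>x\<close> is a summand of an element of \<open>I\<close>.\<close>

lemma qc_one_iff: 
  assumes "x \<in> J"
  shows "qc x = qc \<one> \<longleftrightarrow> x \<in> I"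
proof -
  have "x \<in> I" if "i \<in> I" "j \<in> I" "x \<otimes> i = \<one> \<otimes> j" for i j
  proof -
    have "x \<otimes> i \<in> I" using that IJ J_sub by auto
    then show ?thesis using order_idealD(3)[OF I, of x i] that assms J_sub IJ by auto
  qed
  moreover have "\<exists>i\<in>I. \<exists>j\<in>I. x \<otimes> i = \<one> \<otimes> j" if "x \<in> I"
    using that assms J_sub I_closed by (intro bexI[of _ \<one>] bexI[of _ x]) simp_all
  ultimately show ?thesis using qc_eq_iff[OF assms J_closed(2)] by blast
qed

text \<open>Taking preimages turns ideals of \<open>J/I\<close> into ideals between \<open>I\<close>
  and \<open>J\<close>, which reduces simplicity to a covering relation in \<open>T\<close>.\<close>

lemma order_ideal_pullback:
  assumes L: "order_ideal (ideal_quot T J I) L"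
  defines "L' \<equiv> {x \<in> J. qc x \<in> L}"
  shows "order_ideal T L'" "I \<subseteq> L'" "L' \<subseteq> J" "L = qc ` L'"
proof -
  note LD = order_idealD[OF L]
  have one: "qc \<one> \<in> L" using submonoid.one_closed[OF LD(1)] by (simp add: iq_one)
  have sub: "L \<subseteq> qc ` J" using submonoid.subset[OF LD(1)] by (simp add: iq_carrier)
  have L': "x \<in> L' \<longleftrightarrow> x \<in> J \<and> qc x \<in> L" for x unfolding L'_def by (rule mem_Collect_eq)
  have mult: "qc a \<otimes>\<^bsub>ideal_quot T J I\<^esub> qc b \<in> L \<longleftrightarrow> a \<otimes> b \<in> L'" if "a \<in> J" "b \<in> J" for a b
    using J_closed(1)[OF that] by (simp only: L' iq_mult[OF that] simp_thms)
  have car: "qc a \<in> carrier (ideal_quot T J I)" if "a \<in> J" for a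
    unfolding iq_carrier using that by (rule imageI)
  have "a \<in> L' \<and> b \<in> L'" if ab: "a \<in> carrier T" "b \<in> carrier T" "a \<otimes> b \<in> L'" for a b
  proof -
    have "a \<otimes> b \<in> J" using ab(3) by (rule L'[THEN iffD1, THEN conjunct1])
    then have J2: "a \<in> J" "b \<in> J" by (rule order_idealD(3,4)[OF J ab(1,2)])+
    then have "qc a \<otimes>\<^bsub>ideal_quot T J I\<^esub> qc b \<in> L" using ab(3) by (simp only: mult)
    then have "qc a \<in> L" "qc b \<in> L" by (rule LD(3,4)[OF car[OF J2(1)] car[OF J2(2)]])+
    then show ?thesis using J2 by (simp only: L' simp_thms)
  qed
  moreover have "act T g x \<in> L'" if "x \<in> L'" for x g
  proof -
    have x: "x \<in> J" "qc x \<in> L" using that by (simp_all only: L')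
    then show ?thesis using LD(2)[of "qc x" g] order_idealD(2)[OF J x(1), of g] L' by (simp only: iq_act simp_thms)
  qed
  moreover have "submonoid L' T"
  proof
    show "L' \<subseteq> carrier T" using J_sub L' by blast
    show "x \<otimes> y \<in> L'" if "x \<in> L'" "y \<in> L'" for x y
      using that submonoid.m_closed[OF LD(1), of "qc x" "qc y"] mult[of x y] by (simp only: L' simp_thms)
    show "\<one> \<in> L'" using one J_closed(2) by (simp only: L' simp_thms)
  qed
  ultimately show "order_ideal T L'" by (intro order_idealI)
  show "I \<subseteq> L'" 
  proof
    fix x assume "x \<in> I"
    then have "x \<in> J" using IJ by (rule subsetD[rotated])
    moreover from this have "qc x = qc \<one>" using \<open>x \<in> I\<close> by (simp only: qc_one_iff)
    ultimately show "x \<in> L'" using one by (simp add: L'_def)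
  qed
  show "L' \<subseteq> J" by (simp add: L'_def)
  show "L = qc ` L'"
  proof (intro equalityI subsetI)
    fix X assume "X \<in> L"
    moreover from this obtain x where "x \<in> J" "X = qc x" using sub by (elim subsetD[elim_format] imageE)
    ultimately show "X \<in> qc ` L'" by (simp add: L'_def)
  next
    fix X assume "X \<in> qc ` L'"
    then show "X \<in> L" unfolding L'_def by (elim imageE) simp
  qed
qed

lemma simple_ideal_quotI:
  assumes cover: "\<And>L. order_ideal T L \<Longrightarrow> I \<subseteq> L \<Longrightarrow> L \<subseteq> J \<Longrightarrow> L = I \<or> L = J"
  shows "simple_gamma_monoid (ideal_quot T J I)"
proof -
  have img: "qc ` I = {qc \<one>}"
  proof -
    have "qc x = qc \<one>" if "x \<in> I" for x
      using that IJ by (subst qc_one_iff) auto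
    then have "qc ` I = (\<lambda>_. qc \<one>) ` I" by (rule image_cong[OF HOL.refl])
    also have "\<dots> = {qc \<one>}" using I_closed(2) by (rule image_constant)
    finally show ?thesis .
  qed
  have "L = {\<one>\<^bsub>ideal_quot T J I\<^esub>} \<or> L = carrier (ideal_quot T J I)"
    if L: "order_ideal (ideal_quot T J I) L" for L
  proof -
    obtain L' where L': "order_ideal T L'" "I \<subseteq> L'" "L' \<subseteq> J" "L = qc ` L'"
      by (rule that[OF order_ideal_pullback[OF L]])
    have "L' = I \<or> L' = J" using L'(1-3) by (rule cover)
    then have "L = qc ` I \<or> L = qc ` J" unfolding L'(4) by (elim disjE) (rule disjI1, erule arg_cong, rule disjI2, erule arg_cong)
    then show ?thesis unfolding iq_one iq_carrier img .
  qed
  then show ?thesis unfolding simple_gamma_monoid_def by blast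
qed

end

section \<open>Order ideals of the talented monoid\<close>

lemma free_talented_simps [simp]:
  "carrier (free_talented E) = {m. set_mset m \<subseteq> verts E \<times> UNIV}"
  "a \<otimes>\<^bsub>free_talented E\<^esub> b = a + b" "\<one>\<^bsub>free_talented E\<^esub> = {#}"
  "act (free_talented E) n a = image_mset (\<lambda>(v, i). (v, i + n)) a"
  by (simp_all add: free_talented_def)

context fin_digraph begin

definition tcong :: "('a \<times> int) multiset rel" where
  "tcong = gen_cong (free_talented G) (talented_rel G)"

definition nexts :: "'a \<Rightarrow> int \<Rightarrow> ('a \<times> int) multiset" where
  "nexts v i = {#(head G e, i + 1). e \<in># mset_set (out_arcs G v)#}"

lemma set_nexts: "set_mset (nexts v i) = (\<lambda>e. (head G e, i + 1)) ` out_arcs G v"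
  by (simp add: nexts_def finite_out_arcs)

lemma talented_rel_sub: "talented_rel G \<subseteq> carrier (free_talented G) \<times> carrier (free_talented G)"
  by (auto simp: talented_rel_def elem_mset_set[OF finite_out_arcs])

lemma tcong_sub: "(a, b) \<in> tcong \<Longrightarrow> a \<in> carrier (free_talented G) \<and> b \<in> carrier (free_talented G)"
  using gen_cong_sub[OF gamma_monoid.axioms(1)[OF gamma_monoid_free_talented] talented_rel_sub]
  unfolding tcong_def by blast

lemma tcong_induct [consumes 1, case_names base refl sym trans add]:
  assumes "(a, b) \<in> tcong"
    and "\<And>v i. v \<in> verts G \<Longrightarrow> out_arcs G v \<noteq> {} \<Longrightarrow> P {#(v, i)#} (nexts v i)"
    and "\<And>a. set_mset a \<subseteq> verts G \<times> UNIV \<Longrightarrow> P a a"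
    and "\<And>a b. P a b \<Longrightarrow> P b a"
    and "\<And>a b c. P a b \<Longrightarrow> P b c \<Longrightarrow> P a c"
    and "\<And>a b c d. (a, b) \<in> tcong \<Longrightarrow> (c, d) \<in> tcong \<Longrightarrow> P a b \<Longrightarrow> P c d \<Longrightarrow> P (a + c) (b + d)"
  shows "P a b"
proof -
  have "p \<in> gen_cong (free_talented G) (talented_rel G) \<Longrightarrow> P (fst p) (snd p)" for p
  proof (induction p rule: gen_cong.induct)
    case (base p)
    then obtain v i where "p = ({#(v, i)#}, nexts v i)" "v \<in> verts G" "out_arcs G v \<noteq> {}"
      unfolding talented_rel_def nexts_def by blast
    then show ?case using assms(2) by simp
  next
    case (refl a)
    then show ?case using assms(3) by simp
  next
    case (sym a b)
    then show ?case using assms(4) by simp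
  next
    case (trans a b c)
    then show ?case using assms(5) by fastforce
  next
    case (mult a b c d)
    then show ?case using assms(6)[of a b c d] by (simp add: tcong_def)
  qed
  from this[of "(a, b)"] show ?thesis using assms(1) by (simp add: tcong_def)
qed

lemma tcong_add: "(a, b) \<in> tcong \<Longrightarrow> (c, d) \<in> tcong \<Longrightarrow> (a + c, b + d) \<in> tcong"
  using gen_cong.mult[of a b "free_talented G" "talented_rel G" c d] by (simp add: tcong_def)

lemma tcong_base: "v \<in> verts G \<Longrightarrow> out_arcs G v \<noteq> {} \<Longrightarrow> ({#(v, i)#}, nexts v i) \<in> tcong"
  unfolding tcong_def nexts_def by (rule gen_cong.base) (auto simp: talented_rel_def)

lemma shift_nexts: "image_mset (\<lambda>(v, i). (v, i + g)) (nexts v i) = nexts v (i + g)"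
  by (simp add: nexts_def image_mset.compositionality comp_def algebra_simps)

sublocale tal: gamma_congruence "free_talented G" tcong
proof (intro gamma_congruence.intro gamma_monoid_free_talented gamma_congruence_axioms.intro)
  show "equiv (carrier (free_talented G)) tcong"
  proof (intro equivI refl_onI symI transI)
    show "tcong \<subseteq> carrier (free_talented G) \<times> carrier (free_talented G)" using tcong_sub by auto
    show "(a, a) \<in> tcong" if "a \<in> carrier (free_talented G)" for a
      using that unfolding tcong_def by (rule gen_cong.refl)
    show "(b, a) \<in> tcong" if "(a, b) \<in> tcong" for a b
      using that unfolding tcong_def by (rule gen_cong.sym)
    show "(a, c) \<in> tcong" if "(a, b) \<in> tcong" "(b, c) \<in> tcong" for a b c
      using that unfolding tcong_def by (rule gen_cong.trans)
  qed
  show "(a \<otimes>\<^bsub>free_talented G\<^esub> c, b \<otimes>\<^bsub>free_talented G\<^esub> d) \<in> tcong"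
    if "(a, b) \<in> tcong" "(c, d) \<in> tcong" for a b c d
    using tcong_add that by simp
  show "(act (free_talented G) g a, act (free_talented G) g b) \<in> tcong" if "(a, b) \<in> tcong" for g a b
    using that
  proof (induction rule: tcong_induct)
    case (base v i)
    then show ?case by (simp add: shift_nexts tcong_base)
  next
    case (refl a)
    then have "set_mset (act (free_talented G) g a) \<subseteq> verts G \<times> UNIV" by auto
    then show ?case unfolding tcong_def by (intro gen_cong.refl) simp
  next
    case (sym a b)
    then show ?case unfolding tcong_def by (rule gen_cong.sym)
  next
    case (trans a b c)
    then show ?case unfolding tcong_def by (rule gen_cong.trans)
  next
    case (add a b c d)
    then show ?case by (simp add: tcong_add)
  qed
qed

definition cls :: "('a \<times> int) multiset \<Rightarrow> ('a \<times> int) multiset set" where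
  "cls a = tcong `` {a}"

abbreviation TM :: "(('a \<times> int) multiset set, int) gamma_monoid" where "TM \<equiv> talented_monoid G"

lemma TM_eq: "TM = quot_gamma_monoid (free_talented G) tcong"
  by (simp add: talented_monoid_def tcong_def)

lemma TM_carrier: "carrier TM = cls ` {a. set_mset a \<subseteq> verts G \<times> UNIV}"
  and TM_one: "\<one>\<^bsub>TM\<^esub> = cls {#}"
  and TM_mult: "set_mset a \<subseteq> verts G \<times> UNIV \<Longrightarrow> set_mset b \<subseteq> verts G \<times> UNIV \<Longrightarrow>
      cls a \<otimes>\<^bsub>TM\<^esub> cls b = cls (a + b)"
  and TM_act: "set_mset a \<subseteq> verts G \<times> UNIV \<Longrightarrow> act TM g (cls a) = cls (image_mset (\<lambda>(v, i). (v, i + g)) a)"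
  and cls_eq_iff: "set_mset a \<subseteq> verts G \<times> UNIV \<Longrightarrow> set_mset b \<subseteq> verts G \<times> UNIV \<Longrightarrow>
      cls a = cls b \<longleftrightarrow> (a, b) \<in> tcong"
  using tal.Q_carrier tal.Q_one tal.Q_mult[of a b] tal.Q_act[of a g] tal.Q_eq_iff[of a b]
  by (simp_all add: TM_eq cls_def[abs_def])

lemma cls_nexts: "v \<in> verts G \<Longrightarrow> out_arcs G v \<noteq> {} \<Longrightarrow> cls {#(v, i)#} = cls (nexts v i)"
  by (subst cls_eq_iff) (auto simp: set_nexts tcong_base)

sublocale TM: gamma_monoid TM
  by (rule gamma_monoid_talented_monoid) unfold_locales

text \<open>Hereditary and saturated. The premise \<open>out_arcs G v \<noteq> {}\<close> exempts
  sinks, which would otherwise belong to every saturated set.\<close>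

definition hersat :: "'a set \<Rightarrow> bool" where
  "hersat S \<longleftrightarrow> S \<subseteq> verts G \<and> (\<forall>e\<in>arcs G. tail G e \<in> S \<longrightarrow> head G e \<in> S) \<and>
     (\<forall>v\<in>verts G. out_arcs G v \<noteq> {} \<longrightarrow> head G ` out_arcs G v \<subseteq> S \<longrightarrow> v \<in> S)"

definition ideal_of :: "'a set \<Rightarrow> ('a \<times> int) multiset set set" where
  "ideal_of S = cls ` {a. set_mset a \<subseteq> S \<times> UNIV}"

text \<open>A defining relation replaces \<open>v\<close> by the heads of its arcs; heredity carries
  membership in \<open>S\<close> forwards and saturation carries it backwards. Hence the support
  condition does not depend on the representative.\<close>

lemma hersat_supp:
  assumes "hersat S" "(a, b) \<in> tcong"
  shows "set_mset a \<subseteq> S \<times> UNIV \<longleftrightarrow> set_mset b \<subseteq> S \<times> UNIV"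
  using assms(2)
proof (induction rule: tcong_induct)
  case (base v i)
  have "v \<in> S \<longleftrightarrow> head G ` out_arcs G v \<subseteq> S"
    using base assms(1) unfolding hersat_def by auto
  then show ?case by (auto simp: set_nexts)
qed auto

lemma hersat_sub: "hersat S \<Longrightarrow> S \<subseteq> verts G" by (simp add: hersat_def)

lemma cls_in_ideal_of:
  assumes "hersat S" "set_mset a \<subseteq> verts G \<times> UNIV"
  shows "cls a \<in> ideal_of S \<longleftrightarrow> set_mset a \<subseteq> S \<times> UNIV"
proof -
  have "set_mset a \<subseteq> S \<times> UNIV" if "set_mset b \<subseteq> S \<times> UNIV" "cls a = cls b" for b
  proof -
    have "set_mset b \<subseteq> verts G \<times> UNIV" using that(1) hersat_sub[OF assms(1)] by auto
    then have "(a, b) \<in> tcong" using that(2) assms(2) cls_eq_iff by blast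
    then show ?thesis using hersat_supp[OF assms(1)] that(1) by blast
  qed
  then show ?thesis unfolding ideal_of_def by blast
qed

lemma order_ideal_ideal_of:
  assumes S: "hersat S"
  shows "order_ideal TM (ideal_of S)"
proof (rule order_idealI)
  have sub: "set_mset a \<subseteq> verts G \<times> UNIV" if "set_mset a \<subseteq> S \<times> UNIV" for a :: "('a \<times> int) multiset"
    using that hersat_sub[OF S] by auto
  have E: thesis if "x \<in> ideal_of S" "\<And>a. set_mset a \<subseteq> S \<times> UNIV \<Longrightarrow> x = cls a \<Longrightarrow> thesis" for x thesis
    using that unfolding ideal_of_def by blast
  show "submonoid (ideal_of S) TM"
  proof
    show "ideal_of S \<subseteq> carrier TM" unfolding ideal_of_def TM_carrier using sub by (intro image_mono) blast
    show "\<one>\<^bsub>TM\<^esub> \<in> ideal_of S" unfolding ideal_of_def TM_one by (intro imageI) simp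
    fix x y assume xy: "x \<in> ideal_of S" "y \<in> ideal_of S"
    obtain a where a: "set_mset a \<subseteq> S \<times> UNIV" "x = cls a" using E[OF xy(1)] by metis
    obtain b where b: "set_mset b \<subseteq> S \<times> UNIV" "y = cls b" using E[OF xy(2)] by metis
    note ab = a b
    then have "x \<otimes>\<^bsub>TM\<^esub> y = cls (a + b)" using TM_mult sub by simp
    then show "x \<otimes>\<^bsub>TM\<^esub> y \<in> ideal_of S" using ab unfolding ideal_of_def by simp
  qed
  show "act TM g x \<in> ideal_of S" if x: "x \<in> ideal_of S" for g x
  proof -
    obtain a where a: "set_mset a \<subseteq> S \<times> UNIV" "x = cls a" using E[OF x] by metis
    then have "act TM g x = cls (image_mset (\<lambda>(v, i). (v, i + g)) a)" using TM_act sub by simp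
    moreover have "set_mset (image_mset (\<lambda>(v, i). (v, i + g)) a) \<subseteq> S \<times> UNIV" using a by auto
    ultimately show ?thesis unfolding ideal_of_def by simp
  qed
  fix x y assume "x \<in> carrier TM" "y \<in> carrier TM" and xy: "x \<otimes>\<^bsub>TM\<^esub> y \<in> ideal_of S"
  then obtain a b where ab: "set_mset a \<subseteq> verts G \<times> UNIV" "x = cls a" "set_mset b \<subseteq> verts G \<times> UNIV" "y = cls b"
    unfolding TM_carrier by blast
  then have "cls (a + b) \<in> ideal_of S" using xy TM_mult by simp
  then have "set_mset (a + b) \<subseteq> S \<times> UNIV" using cls_in_ideal_of[OF S, of "a + b"] ab by simp
  then show "x \<in> ideal_of S \<and> y \<in> ideal_of S" using ab unfolding ideal_of_def by simp
qed

text \<open>Time 0 represents all times, since an order ideal is closed under shifts.\<close>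

definition verts_of :: "('a \<times> int) multiset set set \<Rightarrow> 'a set" where
  "verts_of L = {v \<in> verts G. cls {#(v, 0)#} \<in> L}"

text \<open>An order ideal contains a sum exactly when it contains every summand, so it is
  determined by the generators in it.\<close>

lemma cls_in_ideal:
  assumes L: "order_ideal TM L" and a: "set_mset a \<subseteq> verts G \<times> UNIV"
  shows "cls a \<in> L \<longleftrightarrow> set_mset a \<subseteq> verts_of L \<times> UNIV"
proof -
  note LD = order_idealD[OF L]
  have sh: "cls {#(v, i)#} \<in> L \<longleftrightarrow> v \<in> verts_of L" if v: "v \<in> verts G" for v i
  proof -
    have "act TM i (cls {#(v, 0)#}) = cls {#(v, i)#}" "act TM (- i) (cls {#(v, i)#}) = cls {#(v, 0)#}"
      using v TM_act[of "{#(v, 0)#}" i] TM_act[of "{#(v, i)#}" "- i"] by auto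
    then show ?thesis using LD(2)[of "cls {#(v, 0)#}" i] LD(2)[of "cls {#(v, i)#}" "- i"] v
      by (auto simp: verts_of_def)
  qed
  show ?thesis using a
  proof (induction a)
    case empty
    then show ?case using submonoid.one_closed[OF LD(1)] by (simp add: TM_one)
  next
    case (add p a)
    obtain v i where p: "p = (v, i)" by fastforce
    have v: "v \<in> verts G" and a: "set_mset a \<subseteq> verts G \<times> UNIV" using add.prems p by auto
    have eq: "cls (add_mset p a) = cls {#(v, i)#} \<otimes>\<^bsub>TM\<^esub> cls a" using TM_mult[of "{#(v, i)#}" a] v a p by simp
    have c: "cls {#(v, i)#} \<in> carrier TM" "cls a \<in> carrier TM" using v a unfolding TM_carrier by auto
    have "cls (add_mset p a) \<in> L \<longleftrightarrow> cls {#(v, i)#} \<in> L \<and> cls a \<in> L"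
      unfolding eq using LD(3,4)[OF c] submonoid.m_closed[OF LD(1), of "cls {#(v, i)#}" "cls a"] by blast
    then show ?case using sh[OF v] add.IH[OF a] p by auto
  qed
qed

text \<open>\<open>v(0)\<close> equals the sum over its arcs, and this sum lies in \<open>L\<close>
  iff all heads do; the two directions are heredity and saturation.\<close>

lemma order_ideal_hersat:
  assumes L: "order_ideal TM L"
  shows "hersat (verts_of L)"
proof -
  have *: "v \<in> verts_of L \<longleftrightarrow> head G ` out_arcs G v \<subseteq> verts_of L" if v: "v \<in> verts G" "out_arcs G v \<noteq> {}" for v
  proof -
    have "set_mset (nexts v 0) \<subseteq> verts G \<times> UNIV" by (auto simp: set_nexts)
    then show ?thesis using cls_nexts[OF v, of 0] cls_in_ideal[OF L, of "{#(v, 0)#}"] cls_in_ideal[OF L, of "nexts v 0"] v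
      by (auto simp: set_nexts)
  qed
  have "head G e \<in> verts_of L" if "e \<in> arcs G" "tail G e \<in> verts_of L" for e
  proof -
    have "e \<in> out_arcs G (tail G e)" using that by simp
    then have "head G ` out_arcs G (tail G e) \<subseteq> verts_of L" using *[of "tail G e"] that tail_in_verts[of e] by auto
    then show ?thesis using that by auto
  qed
  moreover have "verts_of L \<subseteq> verts G" by (auto simp: verts_of_def)
  ultimately show ?thesis unfolding hersat_def using * by blast
qed

lemma ideal_of_verts_of:
  assumes L: "order_ideal TM L"
  shows "ideal_of (verts_of L) = L"
proof -
  have "L \<subseteq> carrier TM" using order_idealD(1)[OF L] by (rule submonoid.subset)
  then have "L = cls ` {a. set_mset a \<subseteq> verts G \<times> UNIV \<and> cls a \<in> L}" unfolding TM_carrier by blast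
  also have "{a. set_mset a \<subseteq> verts G \<times> UNIV \<and> cls a \<in> L} = {a. set_mset a \<subseteq> verts_of L \<times> UNIV}"
  proof (intro Collect_cong iffI conjI; (elim conjE)?)
    fix a :: "('a \<times> int) multiset"
    assume a: "set_mset a \<subseteq> verts_of L \<times> UNIV"
    then show v: "set_mset a \<subseteq> verts G \<times> UNIV" using hersat_sub[OF order_ideal_hersat[OF L]] by auto
    show "cls a \<in> L" using a cls_in_ideal[OF L v] by simp
  qed (simp add: cls_in_ideal[OF L])
  finally show ?thesis unfolding ideal_of_def by simp
qed

lemma verts_of_ideal_of: "hersat S \<Longrightarrow> verts_of (ideal_of S) = S"
  using cls_in_ideal_of[of S "{#(_, 0)#}"] hersat_sub[of S] by (auto simp: verts_of_def)

lemma ideal_of_mono: "S \<subseteq> S' \<Longrightarrow> ideal_of S \<subseteq> ideal_of S'"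
  unfolding ideal_of_def by (intro image_mono) auto

lemma hersat_empty: "hersat {}" and hersat_verts: "hersat (verts G)"
  by (auto simp: hersat_def)

lemma ideal_of_empty: "ideal_of {} = {\<one>\<^bsub>TM\<^esub>}" and ideal_of_verts: "ideal_of (verts G) = carrier TM"
  by (auto simp: ideal_of_def TM_one TM_carrier)

end

section \<open>Quotients of order ideals of the talented monoid\<close>

text \<open>A nonzero value at \<open>m\<close> propagates to \<open>m + g\<close>,
  \<open>m + 2 * g\<close> and so on, against the finiteness of the support.\<close>

lemma finite_support_shift:
  fixes f :: "int \<Rightarrow> nat"
  assumes fin: "finite {m. f m \<noteq> 0}" and g: "g \<noteq> 0" and le: "\<And>m. f (m - g) \<le> f m"
  shows "f m = 0"
proof (rule ccontr)
  assume m: "f m \<noteq> 0"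
  have "f (m + int k * g) \<noteq> 0" for k
  proof (induction k)
    case (Suc k)
    have "f (m + int k * g) \<le> f (m + int (Suc k) * g)" using le[of "m + int (Suc k) * g"] by (simp add: algebra_simps)
    then show ?case using Suc by simp
  qed (use m in simp)
  then have "range (\<lambda>k. m + int k * g) \<subseteq> {m. f m \<noteq> 0}" by auto
  moreover have "inj (\<lambda>k. m + int k * g)" using g by (auto intro: injI)
  ultimately show False using fin finite_subset range_inj_infinite by blast
qed

section \<open>Saturation and additive invariants\<close>

context fin_digraph begin

inductive_set saturation :: "'a set \<Rightarrow> 'a set" for X :: "'a set" where
  base: "v \<in> X \<Longrightarrow> v \<in> saturation X"
| step: "v \<in> verts G \<Longrightarrow> out_arcs G v \<noteq> {} \<Longrightarrow> (\<And>e. e \<in> out_arcs G v \<Longrightarrow> head G e \<in> saturation X) \<Longrightarrow> v \<in> saturation X"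

lemma hersat_saturation:
  assumes "X \<subseteq> verts G" and her: "\<And>e. e \<in> arcs G \<Longrightarrow> tail G e \<in> X \<Longrightarrow> head G e \<in> X"
  shows "hersat (saturation X)"
proof -
  have "v \<in> verts G" if "v \<in> saturation X" for v using that assms(1) by cases auto
  moreover have "head G e \<in> saturation X" if "e \<in> arcs G" "tail G e \<in> saturation X" for e
    using that(2) by cases (use that her in \<open>auto intro: saturation.base\<close>)
  moreover have "v \<in> saturation X" if "v \<in> verts G" "out_arcs G v \<noteq> {}" "head G ` out_arcs G v \<subseteq> saturation X" for v
    by (rule saturation.step[OF that(1,2)]) (use that(3) in blast)
  ultimately show ?thesis unfolding hersat_def by blast
qed

lemma saturation_least: 
  assumes "X \<subseteq> S" "hersat S"
  shows "saturation X \<subseteq> S"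
proof
  fix v assume "v \<in> saturation X"
  then show "v \<in> S"
  proof induction
    case (step v)
    then have "head G ` out_arcs G v \<subseteq> S" by blast
    then show ?case using assms(2) step(1,2) unfolding hersat_def by blast
  qed (use assms in auto)
qed

lemma hersat_walk: "hersat S \<Longrightarrow> awalk u p x \<Longrightarrow> u \<in> S \<Longrightarrow> x \<in> S"
  by (induction p arbitrary: u) (auto simp: awalk_simps hersat_def)

lemma hersat_nexts: "hersat S \<Longrightarrow> v \<in> S \<Longrightarrow> set_mset (nexts v i) \<subseteq> S \<times> UNIV"
  by (auto simp: set_nexts hersat_def)

definition weight :: "('a \<Rightarrow> int \<Rightarrow> nat) \<Rightarrow> ('a \<times> int) multiset \<Rightarrow> nat" where
  "weight f a = (\<Sum>(v, i)\<in>#a. f v i)"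

lemma weight_simps [simp]: "weight f {#} = 0" "weight f (a + b) = weight f a + weight f b"
  "weight f (add_mset (v, i) a) = f v i + weight f a"
  by (simp_all add: weight_def)

lemma weight_nexts: "weight f (nexts v i) = (\<Sum>e\<in>out_arcs G v. f (head G e) (i + 1))"
  by (simp add: weight_def nexts_def sum_unfold_sum_mset image_mset.compositionality comp_def)

lemma weight_zero_iff: "weight f a = 0 \<longleftrightarrow> (\<forall>(v, i)\<in>#a. f v i = 0)"
  by (induction a) auto

text \<open>If \<open>f\<close> respects the relations, its additive extension is constant on
  congruence classes. A derivation uses finitely many relations, so it is enough that each of them
  holds eventually; the threshold may depend on \<open>v\<close> and \<open>i\<close>.\<close>

lemma tcong_weight:
  assumes "(a, b) \<in> tcong"
    and "\<And>v i. v \<in> verts G \<Longrightarrow> out_arcs G v \<noteq> {} \<Longrightarrow>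
      \<forall>\<^sub>F n in F. f n v i = (\<Sum>e\<in>out_arcs G v. f n (head G e) (i + 1))"
  shows "\<forall>\<^sub>F n in F. weight (f n) a = weight (f n) b"
  using assms(1)
proof (induction rule: tcong_induct)
  case (base v i)
  then show ?case using assms(2)[of v i] by (simp add: weight_nexts)
next
  case (trans a b c)
  from trans(1,2) show ?case by eventually_elim simp
next
  case (sym a b)
  from sym(1) show ?case by eventually_elim simp
next
  case (add a b c d)
  from add(3,4) show ?case by eventually_elim simp
qed simp

end

section \<open>Quotients by nested hereditary saturated sets\<close>

locale hersat_pair = fin_digraph +
  fixes S S' :: "'a set"
  assumes S: "hersat S" and S': "hersat S'" and sub: "S' \<subseteq> S"
begin

sublocale pr: ideal_pair TM "ideal_of S" "ideal_of S'"
  by (intro ideal_pair.intro ideal_pair_axioms.intro TM.gamma_monoid_axioms order_ideal_ideal_of S S' ideal_of_mono sub)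

definition qcls :: "('a \<times> int) multiset \<Rightarrow> ('a \<times> int) multiset set set" where
  "qcls a = pr.qc (cls a)"

abbreviation "QT \<equiv> ideal_quot TM (ideal_of S) (ideal_of S')"

lemma MS_verts: "set_mset a \<subseteq> S \<times> UNIV \<Longrightarrow> set_mset a \<subseteq> verts G \<times> UNIV"
  using hersat_sub[OF S] by auto

lemma cls_ideal_of: "set_mset a \<subseteq> S \<times> UNIV \<Longrightarrow> cls a \<in> ideal_of S"
  by (simp add: ideal_of_def)

sublocale QT: gamma_monoid QT
  by (rule gamma_monoid_ideal_quot) (rule TM.gamma_monoid_axioms pr.J pr.I pr.IJ)+

lemma qcls_carrier: "carrier QT = qcls ` {a. set_mset a \<subseteq> S \<times> UNIV}"
  unfolding pr.iq_carrier by (auto simp: qcls_def ideal_of_def)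

lemma qcls_one: "\<one>\<^bsub>QT\<^esub> = qcls {#}"
  by (simp add: pr.iq_one qcls_def TM_one)

lemma qcls_mult: "set_mset a \<subseteq> S \<times> UNIV \<Longrightarrow> set_mset b \<subseteq> S \<times> UNIV \<Longrightarrow>
    qcls a \<otimes>\<^bsub>QT\<^esub> qcls b = qcls (a + b)"
  by (simp add: qcls_def pr.iq_mult cls_ideal_of TM_mult MS_verts)

lemma qcls_mle_iff:
  assumes "set_mset a \<subseteq> S \<times> UNIV"
  shows "mle QT (qcls a) y \<longleftrightarrow> (\<exists>c. set_mset c \<subseteq> S \<times> UNIV \<and> y = qcls (a + c))"
  using qcls_mult[OF assms] by (auto simp: mle_def qcls_carrier)

lemma qcls_act: "set_mset a \<subseteq> S \<times> UNIV \<Longrightarrow> act QT g (qcls a) = qcls (image_mset (\<lambda>(v, i). (v, i + g)) a)"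
  by (simp add: qcls_def pr.iq_act cls_ideal_of TM_act MS_verts)

lemma qcls_one_iff: "set_mset a \<subseteq> S \<times> UNIV \<Longrightarrow> qcls a = \<one>\<^bsub>QT\<^esub> \<longleftrightarrow> set_mset a \<subseteq> S' \<times> UNIV"
  unfolding pr.iq_one qcls_def by (simp add: pr.qc_one_iff cls_ideal_of cls_in_ideal_of[OF S' MS_verts])

lemma qcls_nexts: "v \<in> S \<Longrightarrow> out_arcs G v \<noteq> {} \<Longrightarrow> qcls {#(v, i)#} = qcls (nexts v i)"
  unfolding qcls_def using hersat_sub[OF S] by (subst cls_nexts) auto

lemma qcls_eqD:
  assumes "set_mset a \<subseteq> S \<times> UNIV" "set_mset b \<subseteq> S \<times> UNIV" "qcls a = qcls b"
  obtains c d where "set_mset c \<subseteq> S' \<times> UNIV" "set_mset d \<subseteq> S' \<times> UNIV" "(a + c, b + d) \<in> tcong"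
proof -
  have "\<exists>i\<in>ideal_of S'. \<exists>j\<in>ideal_of S'. cls a \<otimes>\<^bsub>TM\<^esub> i = cls b \<otimes>\<^bsub>TM\<^esub> j"
    using assms pr.qc_eq_iff[of "cls a" "cls b"] by (simp add: cls_ideal_of qcls_def)
  then obtain c d where cd: "set_mset c \<subseteq> S' \<times> UNIV" "set_mset d \<subseteq> S' \<times> UNIV"
    "cls a \<otimes>\<^bsub>TM\<^esub> cls c = cls b \<otimes>\<^bsub>TM\<^esub> cls d" by (auto simp: ideal_of_def)
  have v: "set_mset x \<subseteq> verts G \<times> UNIV" if "x \<in> {a, b, c, d}" for x
    using that assms cd hersat_sub[OF S] sub by auto
  then have "cls (a + c) = cls (b + d)" using cd(3) by (simp add: TM_mult)
  then have "(a + c, b + d) \<in> tcong" using v by (subst (asm) cls_eq_iff) auto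
  with cd show thesis using that by blast
qed

text \<open>Equality in the quotient permits corrections supported in \<open>S'\<close> on both
  sides; as \<open>f\<close> vanishes there, they have weight 0.\<close>

lemma qcls_weight:
  assumes "set_mset a \<subseteq> S \<times> UNIV" "set_mset b \<subseteq> S \<times> UNIV" "qcls a = qcls b"
    and inv: "\<And>v i. v \<in> verts G \<Longrightarrow> out_arcs G v \<noteq> {} \<Longrightarrow>
      \<forall>\<^sub>F n in F. f n v i = (\<Sum>e\<in>out_arcs G v. f n (head G e) (i + 1))"
    and zero: "\<And>n v i. v \<in> S' \<Longrightarrow> f n v i = 0"
  shows "\<forall>\<^sub>F n in F. weight (f n) a = weight (f n) b"
proof -
  obtain c d where cd: "set_mset c \<subseteq> S' \<times> UNIV" "set_mset d \<subseteq> S' \<times> UNIV" "(a + c, b + d) \<in> tcong"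
    by (rule qcls_eqD[OF assms(1-3)])
  have z: "weight (f n) x = 0" if "set_mset x \<subseteq> S' \<times> UNIV" for n x
    using that zero unfolding weight_zero_iff by blast
  have "\<forall>\<^sub>F n in F. weight (f n) (a + c) = weight (f n) (b + d)" using cd(3) inv by (rule tcong_weight)
  then show ?thesis by eventually_elim (simp add: z cd)
qed

lemma act_funpow:
  assumes "x \<in> carrier QT" "act QT n x = x"
  shows "act QT (int k * n) x = x"
  using assms by (induction k) (simp_all add: QT.act_zero QT.act_add distrib_right)

end

section \<open>Walks into a sink\<close>

context fin_digraph begin

text \<open>
  \<open>num_walks v n u\<close> is the number of walks of length \<open>n\<close> from \<open>u\<close> to \<open>v\<close>. Time runs upwards in the
  talented monoid, so \<open>arrivals v m u i\<close> counts the walks that start from \<open>u\<close> at time \<open>i\<close> and are in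
  \<open>v\<close> at time \<open>m\<close>. For a sink \<open>v\<close> this respects the defining relations.
\<close>

primrec num_walks :: "'a \<Rightarrow> nat \<Rightarrow> 'a \<Rightarrow> nat" where
  "num_walks v 0 u = (if u = v then 1 else 0)"
| "num_walks v (Suc n) u = (\<Sum>e\<in>out_arcs G u. num_walks v n (head G e))"

definition arrivals :: "'a \<Rightarrow> int \<Rightarrow> 'a \<Rightarrow> int \<Rightarrow> nat" where
  "arrivals v m u i = (if i \<le> m then num_walks v (nat (m - i)) u else 0)"

lemma arrivals_step:
  assumes "out_arcs G v = {}" "out_arcs G u \<noteq> {}"
  shows "arrivals v m u i = (\<Sum>e\<in>out_arcs G u. arrivals v m (head G e) (i + 1))"
proof (cases "i < m")
  case True
  then have "nat (m - i) = Suc (nat (m - (i + 1)))" by simp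
  then show ?thesis using True by (simp add: arrivals_def)
next
  case False
  \<comment> \<open>For \<open>i > m\<close> both sides are 0. At \<open>i = m\<close> the right
    side is past its deadline, and the left side is 0 because \<open>u\<close> emits an arc while
    \<open>v\<close> is a sink, so \<open>u \<noteq> v\<close>.\<close>
  then show ?thesis using assms by (auto simp: arrivals_def)
qed

lemma num_walks_hersat_zero: "hersat R \<Longrightarrow> v \<notin> R \<Longrightarrow> u \<in> R \<Longrightarrow> num_walks v n u = 0"
  by (induction n arbitrary: u) (auto simp: hersat_def)

text \<open>No walk from \<open>R\<close> reaches \<open>v\<close>, and from the sink
  \<open>v\<close> only the trivial one does. Any other vertex enters the saturation through its
  finitely many heads, and its nonzero walk lengths are theirs plus one.\<close>

lemma num_walks_finite:
  assumes "hersat R" "v \<notin> R" "out_arcs G v = {}" "u \<in> saturation (R \<union> {v})"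
  shows "finite {n. num_walks v n u \<noteq> 0}"
  using assms(4)
proof induction
  case (base u)
  show ?case
  proof (cases "u \<in> R")
    case False
    then have "num_walks v (Suc n) u = 0" for n using base assms(3) by auto
    then have "n = 0" if "num_walks v n u \<noteq> 0" for n using that by (cases n) simp_all
    then have "{n. num_walks v n u \<noteq> 0} \<subseteq> {0}" by blast
    then show ?thesis by (rule finite_subset) simp
  qed (use num_walks_hersat_zero[OF assms(1,2)] in simp)
next
  case (step u)
  have "{n. num_walks v n u \<noteq> 0} \<subseteq> insert 0 (Suc ` (\<Union>e\<in>out_arcs G u. {n. num_walks v n (head G e) \<noteq> 0}))"
  proof
    fix n assume n: "n \<in> {n. num_walks v n u \<noteq> 0}"
    show "n \<in> insert 0 (Suc ` (\<Union>e\<in>out_arcs G u. {n. num_walks v n (head G e) \<noteq> 0}))"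
    proof (cases n)
      case (Suc k)
      have "\<exists>e\<in>out_arcs G u. num_walks v k (head G e) \<noteq> 0"
      proof (rule ccontr)
        assume "\<not> ?thesis"
        then have "num_walks v (Suc k) u = 0" by simp
        then show False using n Suc by simp
      qed
      then show ?thesis using Suc by blast
    qed simp
  qed
  then show ?case using step finite_out_arcs by (elim finite_subset) blast
qed

text \<open>The vertex \<open>v\<close> has the trivial walk to itself. If no head of
  \<open>u\<close> has a walk to \<open>v\<close>, all heads lie in \<open>R\<close>, and saturation
  of \<open>R\<close> puts \<open>u\<close> there too. Thus the arrival counts detect every class
  that is not the identity.\<close>

lemma num_walks_zero:
  assumes "hersat R" "u \<in> saturation (R \<union> {v})" "\<And>n. num_walks v n u = 0"
  shows "u \<in> R"
  using assms(2,3)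
proof induction
  case (base u)
  then show ?case using base(2)[of 0] by (auto split: if_splits)
next
  case (step u)
  have "num_walks v n (head G e) = 0" if "e \<in> out_arcs G u" for e n
    using step(5)[of "Suc n"] that finite_out_arcs by (auto simp: sum_eq_0_iff)
  then have "head G ` out_arcs G u \<subseteq> R" using step(4) by blast
  then show ?case using step(1,2) assms(1) unfolding hersat_def by blast
qed

lemma weight_psi_shift: "weight (arrivals v m) (image_mset (\<lambda>(u, i). (u, i + g)) a) = weight (arrivals v (m - g)) a"
proof (induction a)
  case (add p a)
  have "arrivals v m u (i + g) = arrivals v (m - g) u i" for u i
    by (auto simp: arrivals_def algebra_simps)
  then show ?case using add by (cases p) simp
qed simp

lemma finite_wt_arrivals:
  assumes "\<And>u i. (u, i) \<in># a \<Longrightarrow> finite {n. num_walks v n u \<noteq> 0}"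
  shows "finite {m. weight (arrivals v m) a \<noteq> 0}"
proof -
  have "{m. weight (arrivals v m) a \<noteq> 0} \<subseteq> (\<Union>(u, i)\<in>set_mset a. (\<lambda>n. i + int n) ` {n. num_walks v n u \<noteq> 0})"
  proof
    fix m assume "m \<in> {m. weight (arrivals v m) a \<noteq> 0}"
    then obtain u i where ui: "(u, i) \<in># a" "arrivals v m u i \<noteq> 0" by (auto simp: weight_zero_iff)
    then have "i \<le> m" "num_walks v (nat (m - i)) u \<noteq> 0" by (auto simp: arrivals_def split: if_splits)
    then have "m \<in> (\<lambda>n. i + int n) ` {n. num_walks v n u \<noteq> 0}" by (intro image_eqI[of _ _ "nat (m - i)"]) auto
    then show "m \<in> (\<Union>(u, i)\<in>set_mset a. (\<lambda>n. i + int n) ` {n. num_walks v n u \<noteq> 0})" using ui(1) by blast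
  qed
  moreover have "finite (\<Union>(u, i)\<in>set_mset a. (\<lambda>n. i + int n) ` {n. num_walks v n u \<noteq> 0})"
    using assms by (intro finite_UN_I) auto
  ultimately show ?thesis by (rule finite_subset)
qed

end

section \<open>Covers and the non-comparable case\<close>

locale hersat_cover = hersat_pair +
  assumes cover: "\<And>R. hersat R \<Longrightarrow> S' \<subset> R \<Longrightarrow> R \<subseteq> S \<Longrightarrow> R = S"
begin

lemma simple_QT: "simple_gamma_monoid QT"
proof (rule pr.simple_ideal_quotI)
  fix L assume L: "order_ideal TM L" "ideal_of S' \<subseteq> L" "L \<subseteq> ideal_of S"
  have "verts_of (ideal_of S') \<subseteq> verts_of L" "verts_of L \<subseteq> verts_of (ideal_of S)" using L(2,3) by (auto simp: verts_of_def)
  then have "S' \<subseteq> verts_of L" "verts_of L \<subseteq> S" by (simp_all add: verts_of_ideal_of S S')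
  then have "verts_of L = S' \<or> verts_of L = S" using cover[OF order_ideal_hersat[OF L(1)]] by blast
  then show "L = ideal_of S' \<or> L = ideal_of S" using ideal_of_verts_of[OF L(1)] by auto
qed

text \<open>\<open>D\<close> is hereditary modulo \<open>S'\<close>, so the saturation is
  hereditary, saturated and strictly above \<open>S'\<close>; the cover leaves only
  \<open>S\<close>. It is applied to a sink and to a strongly connected part.\<close>

lemma saturation_eq:
  assumes "D \<subseteq> S" "\<not> D \<subseteq> S'" "\<And>e. e \<in> arcs G \<Longrightarrow> tail G e \<in> D \<Longrightarrow> head G e \<in> S' \<union> D"
  shows "saturation (S' \<union> D) = S"
proof (rule cover)
  show "hersat (saturation (S' \<union> D))" using assms hersat_sub[OF S] sub S' by (intro hersat_saturation) (auto simp: hersat_def)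
  show "S' \<subset> saturation (S' \<union> D)" using assms(2) saturation.base[of _ "S' \<union> D"] by blast
  show "saturation (S' \<union> D) \<subseteq> S" using assms(1) sub S by (intro saturation_least) auto
qed

lemma noncomparable_QT:
  assumes v: "v \<in> S" "v \<notin> S'" "out_arcs G v = {}"
  shows "noncomparable_gamma_monoid QT"
  unfolding noncomparable_gamma_monoid_def
proof (intro ballI allI impI, elim conjE)
  fix x g assume "x \<in> carrier QT" and x1: "x \<noteq> \<one>\<^bsub>QT\<^esub>" and g: "g \<noteq> (0::int)"
  then obtain a where a: "set_mset a \<subseteq> S \<times> UNIV" "x = qcls a" unfolding qcls_carrier by blast
  have SS: "saturation (S' \<union> {v}) = S" using v by (intro saturation_eq) auto
  define f where "f m = weight (arrivals v m) a" for m
  have inv: "weight (arrivals v m) b = weight (arrivals v m) c"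
    if "set_mset b \<subseteq> S \<times> UNIV" "set_mset c \<subseteq> S \<times> UNIV" "qcls b = qcls c" for b c m
  proof -
    \<comment> \<open>For each fixed \<open>m\<close> the arrival counts respect the relations
      exactly, so a principal filter turns the eventual statement into an equality.\<close>
    have "\<forall>\<^sub>F m in principal {m}. weight (arrivals v m) b = weight (arrivals v m) c"
      using arrivals_step[OF v(3)] num_walks_hersat_zero[OF S' v(2)]
      by (intro qcls_weight that) (auto simp: eventually_principal arrivals_def)
    then show ?thesis by (simp add: eventually_principal)
  qed
  have fin: "finite {m. f m \<noteq> 0}" unfolding f_def
    using a num_walks_finite[OF S' v(2,3)] SS by (intro finite_wt_arrivals) auto
  have ne: "\<exists>m. f m \<noteq> 0"
  proof (rule ccontr)
    assume "\<nexists>m. f m \<noteq> 0"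
    then have *: "arrivals v m u i = 0" if "(u, i) \<in># a" for m u i
    proof -
      have "weight (arrivals v m) a = 0" using \<open>\<nexists>m. f m \<noteq> 0\<close> by (simp add: f_def)
      then show ?thesis using that unfolding weight_zero_iff by blast
    qed
    have "u \<in> S'" if "(u, i) \<in># a" for u i
    proof (rule num_walks_zero[OF S'])
      show "u \<in> saturation (S' \<union> {v})" using SS that a by auto
      show "num_walks v n u = 0" for n using *[OF that, of "i + int n"] by (simp add: arrivals_def)
    qed
    then have "x = \<one>\<^bsub>QT\<^esub>" using qcls_one_iff[OF a(1)] a(2) by auto
    then show False using x1 by simp
  qed
  let ?ga = "image_mset (\<lambda>(v, i). (v, i + g)) a"
  have ga: "set_mset ?ga \<subseteq> S \<times> UNIV" "act QT g x = qcls ?ga" using a qcls_act by auto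
  have "\<not> mle QT (act QT g x) x"
  proof
    assume "mle QT (act QT g x) x"
    then obtain c where c: "set_mset c \<subseteq> S \<times> UNIV" "qcls a = qcls (?ga + c)"
      unfolding ga(2) unfolding a(2) qcls_mle_iff[OF ga(1)] by blast
    have fm: "f m = f (m - g) + weight (arrivals v m) c" for m
      using inv[of a "?ga + c" m] ga(1) a(1) c by (simp add: f_def weight_psi_shift)
    have "f (m - g) \<le> f m" for m using fm[of m] by linarith
    then have "f m = 0" for m by (rule finite_support_shift[OF fin g])
    then show False using ne by simp
  qed
  moreover have "\<not> mle QT x (act QT g x)"
  proof
    assume "mle QT x (act QT g x)"
    then obtain c where c: "set_mset c \<subseteq> S \<times> UNIV" "qcls ?ga = qcls (a + c)"
      unfolding ga(2) unfolding a(2) qcls_mle_iff[OF a(1)] by blast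
    have fm: "f (m - g) = f m + weight (arrivals v m) c" for m
      using inv[of ?ga "a + c" m] ga(1) a(1) c by (simp add: f_def weight_psi_shift)
    \<comment> \<open>The opposite comparison is the same argument for the shift by
      \<open>- g\<close>.\<close>
    have "f (m - (- g)) \<le> f m" for m using fm[of "m + g"] by simp
    then have "f m = 0" for m using g by (intro finite_support_shift[OF fin, of "- g"]) simp_all
    then show False using ne by simp
  qed
  ultimately show "incomparable QT (act QT g x) x" by (simp add: incomparable_def)
qed

end

section \<open>Two returning arcs exclude both types\<close>

context hersat_pair begin

lemma qcls_add:
  assumes "set_mset a \<subseteq> S \<times> UNIV" "set_mset b \<subseteq> S \<times> UNIV" "qcls a = qcls a'" "qcls b = qcls b'"
    "set_mset a' \<subseteq> S \<times> UNIV" "set_mset b' \<subseteq> S \<times> UNIV"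
  shows "qcls (a + b) = qcls (a' + b')"
  using assms by (simp flip: qcls_mult)

text \<open>Expand the generator once for each arc of \<open>p\<close>; the arcs that are not
  followed are collected in \<open>c\<close>.\<close>

lemma qcls_walk:
  assumes "awalk x p y" "x \<in> S"
  shows "\<exists>c. set_mset c \<subseteq> S \<times> UNIV \<and> qcls {#(x, i)#} = qcls (add_mset (y, i + int (length p)) c)"
  using assms
proof (induction p arbitrary: x i)
  case Nil
  then show ?case by (intro exI[of _ "{#}"]) (simp add: awalk_simps)
next
  case (Cons e p)
  then have e: "e \<in> arcs G" "tail G e = x" and w: "awalk (head G e) p y" by (simp_all add: awalk_simps)
  have h: "head G e \<in> S" using e Cons.prems S by (auto simp: hersat_def)
  obtain c where c: "set_mset c \<subseteq> S \<times> UNIV"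
    "qcls {#(head G e, i + 1)#} = qcls (add_mset (y, i + 1 + int (length p)) c)"
    using Cons.IH[OF w h] by blast
  have y: "y \<in> S" using hersat_walk[OF S w h] .
  have "(head G e, i + 1) \<in># nexts x i" using e unfolding set_nexts by auto
  then obtain d where d: "nexts x i = {#(head G e, i + 1)#} + d" by (metis add_mset_add_single insert_DiffM union_commute)
  have dS: "set_mset d \<subseteq> S \<times> UNIV" using hersat_nexts[OF S Cons.prems(2), of i] d by simp
  have "out_arcs G x \<noteq> {}" using e by auto
  then have "qcls {#(x, i)#} = qcls (nexts x i)" by (rule qcls_nexts[OF Cons.prems(2)])
  also have "\<dots> = qcls (add_mset (y, i + 1 + int (length p)) c + d)"
    unfolding d using c h dS y by (intro qcls_add) auto
  finally show ?case using c dS by (intro exI[of _ "c + d"]) (simp add: algebra_simps)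
qed

text \<open>
  The number of walks of length \<open>n\<close> from \<open>u\<close> that stay outside \<open>S'\<close>, where a walk that has reached a sink
  waits there.
\<close>

primrec surviving :: "nat \<Rightarrow> 'a \<Rightarrow> nat" where
  "surviving 0 u = (if u \<in> S' then 0 else 1)"
| "surviving (Suc n) u = (if u \<in> S' then 0 else if out_arcs G u = {} then 1 else \<Sum>e\<in>out_arcs G u. surviving n (head G e))"

lemma surviving_zero: "u \<in> S' \<Longrightarrow> surviving n u = 0"
  by (cases n) auto

text \<open>A sink outside \<open>S'\<close> waits; any other vertex outside \<open>S'\<close> has
  an arc that stays outside, because \<open>S'\<close> is saturated.\<close>

lemma surviving_pos: "u \<in> verts G \<Longrightarrow> u \<notin> S' \<Longrightarrow> surviving n u > 0"
proof (induction n arbitrary: u)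
  case (Suc n)
  show ?case
  proof (cases "out_arcs G u = {}")
    case False
    have "\<not> head G ` out_arcs G u \<subseteq> S'" using S' False Suc.prems unfolding hersat_def by blast
    then obtain e where e: "e \<in> out_arcs G u" "head G e \<notin> S'" by blast
    have "0 < surviving n (head G e)" using Suc.IH e by simp
    also have "\<dots> \<le> (\<Sum>e\<in>out_arcs G u. surviving n (head G e))"
      using e finite_out_arcs by (intro member_le_sum) auto
    finally show ?thesis using Suc.prems False by simp
  qed (use Suc.prems in simp)
qed simp

lemma surviving_step:
  assumes "v \<in> verts G" "out_arcs G v \<noteq> {}"
  shows "surviving (Suc n) v = (\<Sum>e\<in>out_arcs G v. surviving n (head G e))"
proof (cases "v \<in> S'")
  case True
  then have "head G e \<in> S'" if "e \<in> out_arcs G v" for e using that S' by (auto simp: hersat_def)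
  then show ?thesis using True surviving_zero by simp
qed (use assms in simp)

text \<open>Substituting the equation into its own shift replaces \<open>n\<close> by its multiples.
  \<open>Y\<close> is kept as a visible summand, because the later contradiction needs a remainder
  that does not vanish.\<close>

lemma iterate_absorb:
  assumes X: "X \<in> carrier QT" and Y: "Y \<in> carrier QT" and eq: "X = act QT n X \<otimes>\<^bsub>QT\<^esub> Y"
  shows "\<exists>Z\<in>carrier QT. X = act QT (int (Suc k) * n) X \<otimes>\<^bsub>QT\<^esub> (Y \<otimes>\<^bsub>QT\<^esub> Z)"
proof (induction k)
  case 0
  then show ?case using X Y eq by (intro bexI[of _ "\<one>\<^bsub>QT\<^esub>"]) simp_all
next
  case (Suc k)
  then obtain Z where Z: "Z \<in> carrier QT" "X = act QT (int (Suc k) * n) X \<otimes>\<^bsub>QT\<^esub> (Y \<otimes>\<^bsub>QT\<^esub> Z)" by blast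
  note cl = X Y Z(1) QT.act_closed QT.m_closed
  have "act QT n X = act QT n (act QT (int (Suc k) * n) X) \<otimes>\<^bsub>QT\<^esub> act QT n (Y \<otimes>\<^bsub>QT\<^esub> Z)"
    using arg_cong[OF Z(2), of "act QT n"] cl by (simp only: QT.act_mult)
  also have "act QT n (act QT (int (Suc k) * n) X) = act QT (int (Suc (Suc k)) * n) X"
    using X by (simp flip: QT.act_add add: algebra_simps)
  finally have "X = act QT (int (Suc (Suc k)) * n) X \<otimes>\<^bsub>QT\<^esub> act QT n (Y \<otimes>\<^bsub>QT\<^esub> Z) \<otimes>\<^bsub>QT\<^esub> Y"
    using eq by metis
  also have "\<dots> = act QT (int (Suc (Suc k)) * n) X \<otimes>\<^bsub>QT\<^esub> (Y \<otimes>\<^bsub>QT\<^esub> act QT n (Y \<otimes>\<^bsub>QT\<^esub> Z))"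
    by (simp only: QT.m_ac cl)
  finally show ?case using cl by (intro bexI[of _ "act QT n (Y \<otimes>\<^bsub>QT\<^esub> Z)"]) simp_all
qed

text \<open>Expand \<open>u(0)\<close> once and follow \<open>e\<close> and \<open>f\<close> home
  separately; the first arc makes both return times positive.\<close>

lemma double_return:
  assumes ef: "e \<in> arcs G" "f \<in> arcs G" "e \<noteq> f" "tail G e = u" "tail G f = u"
    and ret: "head G e \<rightarrow>\<^sup>* u" "head G f \<rightarrow>\<^sup>* u" and u: "u \<in> S"
  obtains a b c where "0 < a" "0 < b" "set_mset c \<subseteq> S \<times> UNIV"
    "qcls {#(u, 0)#} = qcls ({#(u, int a)#} + add_mset (u, int b) c)"
proof -
  have h: "head G e \<in> S" "head G f \<in> S" using ef u S by (auto simp: hersat_def)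
  obtain p where p: "awalk (head G e) p u" using ret reachable_awalk by blast
  obtain q where q: "awalk (head G f) q u" using ret reachable_awalk by blast
  obtain c where c: "set_mset c \<subseteq> S \<times> UNIV"
    "qcls {#(head G e, 1)#} = qcls (add_mset (u, 1 + int (length p)) c)" using qcls_walk[OF p h(1)] by blast
  obtain d where d: "set_mset d \<subseteq> S \<times> UNIV"
    "qcls {#(head G f, 1)#} = qcls (add_mset (u, 1 + int (length q)) d)" using qcls_walk[OF q h(2)] by blast
  define w where "w = {#(head G e, 1::int). e \<in># mset_set (out_arcs G u - {e, f})#}"
  have "out_arcs G u = insert e (insert f (out_arcs G u - {e, f}))" using ef by auto
  then have "mset_set (out_arcs G u) = mset_set (insert e (insert f (out_arcs G u - {e, f})))" by simp
  also have "\<dots> = {#e, f#} + mset_set (out_arcs G u - {e, f})" using ef(3) finite_out_arcs[of u] by simp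
  finally have n: "nexts u 0 = {#(head G e, 1)#} + ({#(head G f, 1)#} + w)" unfolding nexts_def w_def by simp
  have wS: "set_mset w \<subseteq> S \<times> UNIV" using hersat_nexts[OF S u, of 0] n by simp
  have "qcls {#(u, 0)#} = qcls (nexts u 0)" using u ef by (intro qcls_nexts) auto
  also have "\<dots> = qcls (add_mset (u, 1 + int (length p)) c + (add_mset (u, 1 + int (length q)) d + w))"
    unfolding n using c d wS h u by (intro qcls_add) auto
  finally show thesis using c d wS
    by (intro that[of "Suc (length p)" "Suc (length q)" "c + d + w"]) (auto simp: algebra_simps)
qed

lemma double_return_not_types:
  assumes ef: "e \<in> arcs G" "f \<in> arcs G" "e \<noteq> f" "tail G e = u" "tail G f = u"
    and ret: "head G e \<rightarrow>\<^sup>* u" "head G f \<rightarrow>\<^sup>* u" and u: "u \<in> S" "u \<notin> S'"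
  shows "\<not> noncomparable_gamma_monoid QT" "\<not> cyclic_gamma_monoid QT"
proof -
  obtain a b c where abc: "0 < a" "0 < b" "set_mset c \<subseteq> S \<times> UNIV"
    "qcls {#(u, 0)#} = qcls ({#(u, int a)#} + add_mset (u, int b) c)"
    using double_return[OF ef ret u(1)] by blast
  define X where "X = qcls {#(u, 0)#}"
  define Y where "Y = qcls (add_mset (u, int b) c)"
  have XY: "X \<in> carrier QT" "Y \<in> carrier QT" using u abc by (auto simp: X_def Y_def qcls_carrier)
  have actX: "act QT (int a) X = qcls {#(u, int a)#}" using u by (simp add: X_def qcls_act)
  have eq: "X = act QT (int a) X \<otimes>\<^bsub>QT\<^esub> Y"
    unfolding actX using u abc by (simp add: X_def Y_def qcls_mult)
  have "X \<noteq> \<one>\<^bsub>QT\<^esub>" using u qcls_one_iff[of "{#(u, 0)#}"] by (auto simp: X_def)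
  moreover have "mle QT (act QT (int a) X) X" unfolding mle_def using eq XY(2) by blast
  moreover have "int a \<noteq> 0" using abc(1) by simp
  ultimately show "\<not> noncomparable_gamma_monoid QT"
    using XY(1) unfolding noncomparable_gamma_monoid_def incomparable_def by blast
  show "\<not> cyclic_gamma_monoid QT"
  proof
    assume "cyclic_gamma_monoid QT"
    then obtain g where g: "g \<noteq> 0" "act QT g X = X" using XY(1) unfolding cyclic_gamma_monoid_def by blast
    \<comment> \<open>A negative period is replaced by its absolute value, since only natural
      multiples are iterated.\<close>
    have "act QT (- g) X = act QT (- g) (act QT g X)" using g by simp
    also have "\<dots> = X" using XY(1) by (simp flip: QT.act_add add: QT.act_zero)
    finally have "act QT \<bar>g\<bar> X = X" using g by (simp add: abs_if)
    \<comment> \<open>The shift by \<open>int a * \<bar>g\<bar>\<close> is both a multiple of the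
      period and an iterate of the absorbing shift by \<open>a\<close>: it fixes \<open>X\<close>,
      yet \<open>Y\<close> is left over. Absorption happens at least once, hence
      \<open>Suc k\<close>.\<close>
    then have "act QT (int a * \<bar>g\<bar>) X = X" using act_funpow XY(1) by blast
    moreover obtain k where k: "int (Suc k) = \<bar>g\<bar>" using g by (intro that[of "nat \<bar>g\<bar> - 1"]) simp
    obtain Z where Z: "Z \<in> carrier QT" "X = act QT (int (Suc k) * int a) X \<otimes>\<^bsub>QT\<^esub> (Y \<otimes>\<^bsub>QT\<^esub> Z)"
      using iterate_absorb[OF XY eq] by blast
    ultimately have "X = X \<otimes>\<^bsub>QT\<^esub> (Y \<otimes>\<^bsub>QT\<^esub> Z)" unfolding k by (simp add: mult.commute)
    moreover obtain d where d: "set_mset d \<subseteq> S \<times> UNIV" "Z = qcls d" using Z(1) unfolding qcls_carrier by blast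
    ultimately have "qcls {#(u, 0)#} = qcls ({#(u, 0)#} + (add_mset (u, int b) c + d))"
      using u abc(3) by (simp add: X_def Y_def qcls_mult)
    then have "\<forall>\<^sub>F n in at_top. weight (\<lambda>v i. surviving (nat (n - i)) v) {#(u, 0)#} =
        weight (\<lambda>v i. surviving (nat (n - i)) v) ({#(u, 0)#} + (add_mset (u, int b) c + d))"
    proof (rule qcls_weight[rotated 2])
      \<comment> \<open>The recursion for \<open>surviving\<close> needs a step still to be made, so
        it is valid only for horizons beyond time \<open>i\<close>.\<close>
      fix v i assume v: "v \<in> verts G" "out_arcs G v \<noteq> {}"
      show "\<forall>\<^sub>F n in at_top. surviving (nat (n - i)) v = (\<Sum>e\<in>out_arcs G v. surviving (nat (n - (i + 1))) (head G e))"
        using eventually_gt_at_top[of i]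
      proof eventually_elim
        case (elim n)
        then have "nat (n - i) = Suc (nat (n - (i + 1)))" by simp
        then show ?case using surviving_step[OF v] by simp
      qed
    qed (use u abc d in \<open>auto simp: surviving_zero\<close>)
    \<comment> \<open>The count for \<open>u\<close> at time 0 cancels, and the positive count for
      \<open>u\<close> at time \<open>b\<close> remains on one side only.\<close>
    then have "\<forall>\<^sub>F n::int in at_top. False"
    proof eventually_elim
      case (elim n)
      then show ?case using surviving_pos[of u "nat (n - int b)"] u hersat_sub[OF S] by auto
    qed
    then show False by simp
  qed
qed

end

section \<open>Periodic elements and the cyclic case\<close>

context hersat_pair begin

text \<open>Periods are positive naturals, so the product of two of them is a common period.\<close>

definition periodic :: "('a \<times> int) multiset set set \<Rightarrow> bool" where
  "periodic x \<longleftrightarrow> (\<exists>N>0. act QT (int N) x = x)"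

lemma periodic_mult:
  assumes "x \<in> carrier QT" "y \<in> carrier QT" "periodic x" "periodic y"
  shows "periodic (x \<otimes>\<^bsub>QT\<^esub> y)"
proof -
  obtain M N where MN: "M > 0" "N > 0" "act QT (int M) x = x" "act QT (int N) y = y"
    using assms(3,4) unfolding periodic_def by blast
  have "act QT (int N * int M) x = x" "act QT (int M * int N) y = y"
    using act_funpow assms(1,2) MN(3,4) by blast+
  then have "act QT (int (M * N)) (x \<otimes>\<^bsub>QT\<^esub> y) = x \<otimes>\<^bsub>QT\<^esub> y"
    using assms(1,2) by (simp add: QT.act_mult mult.commute)
  then show ?thesis using MN unfolding periodic_def by (intro exI[of _ "M * N"]) simp
qed

lemma periodic_one: "periodic \<one>\<^bsub>QT\<^esub>"
  unfolding periodic_def by (intro exI[of _ 1]) (simp add: QT.act_one)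

lemma periodic_qcls:
  assumes "set_mset a \<subseteq> S \<times> UNIV" "\<And>v i. (v, i) \<in># a \<Longrightarrow> periodic (qcls {#(v, i)#})"
  shows "periodic (qcls a)"
  using assms
proof (induction a)
  case empty
  then show ?case using periodic_one by (simp add: qcls_one)
next
  case (add p a)
  have "periodic (qcls {#p#} \<otimes>\<^bsub>QT\<^esub> qcls a)"
    using add by (intro periodic_mult) (auto simp: qcls_carrier)
  then show ?case using add.prems qcls_mult[of "{#p#}" a] by simp
qed

text \<open>The arcs other than \<open>e\<close> contribute trivial classes modulo
  \<open>S'\<close>, so expansion merely moves the generator along \<open>e\<close>.\<close>

lemma qcls_single_arc:
  assumes e: "e \<in> out_arcs G v" "v \<in> S" and only: "\<And>f. f \<in> out_arcs G v \<Longrightarrow> f \<noteq> e \<Longrightarrow> head G f \<in> S'"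
  shows "qcls {#(v, i)#} = qcls {#(head G e, i + 1)#}"
proof -
  define w where "w = {#(head G e, i + 1). e \<in># mset_set (out_arcs G v - {e})#}"
  have n: "nexts v i = {#(head G e, i + 1)#} + w"
    using e(1) finite_out_arcs[of v] unfolding nexts_def w_def
    by (subst mset_set.remove[of _ e]) auto
  have w: "set_mset w \<subseteq> S' \<times> UNIV" using only finite_out_arcs[of v] by (auto simp: w_def)
  then have wS: "set_mset w \<subseteq> S \<times> UNIV" using sub by auto
  have h: "head G e \<in> S" using e S by (auto simp: hersat_def)
  have "out_arcs G v \<noteq> {}" using e(1) by blast
  then have "qcls {#(v, i)#} = qcls ({#(head G e, i + 1)#} + w)" using qcls_nexts[OF e(2), of i] n by simp
  also have "\<dots> = qcls {#(head G e, i + 1)#} \<otimes>\<^bsub>QT\<^esub> qcls w" using h wS by (subst qcls_mult) auto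
  also have "qcls w = \<one>\<^bsub>QT\<^esub>" using qcls_one_iff[OF wS] w by simp
  finally show ?thesis using h by (simp add: qcls_carrier)
qed

end

context hersat_cover begin

lemma cyclic_QT:
  assumes dc: "\<And>e f. e \<in> arcs G \<Longrightarrow> f \<in> arcs G \<Longrightarrow> tail G e = tail G f \<Longrightarrow>
      head G e \<rightarrow>\<^sup>* tail G e \<Longrightarrow> head G f \<rightarrow>\<^sup>* tail G f \<Longrightarrow> e = f"
    and nosink: "\<And>v. v \<in> S - S' \<Longrightarrow> out_arcs G v \<noteq> {}" and ne: "S - S' \<noteq> {}"
  shows "cyclic_gamma_monoid QT"
proof -
  define R where "R w = {u \<in> S - S'. w \<rightarrow>\<^sup>* u}" for w
  have finS: "finite S" using hersat_sub[OF S] finite_verts by (rule finite_subset)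
  have finR: "finite (R w)" for w using finS by (simp add: R_def)
  have self: "w \<in> R w" if "w \<in> S - S'" for w using that hersat_sub[OF S] by (auto simp: R_def)
  \<comment> \<open>Choose a vertex that reaches as few vertices of \<open>S - S'\<close> as
    possible. Whatever it reaches there has the same reachable set, so this set is strongly
    connected.\<close>
  obtain w where w: "w \<in> S - S'" "\<And>u. u \<in> S - S' \<Longrightarrow> card (R w) \<le> card (R u)"
    using arg_min_if_finite[of "S - S'" "card \<circ> R"] finS ne
    by (metis (no_types, lifting) comp_apply finite_Diff not_le)
  define D where "D = R w"
  have D: "w \<in> D" "D \<subseteq> S - S'" using self[OF w(1)] by (auto simp: D_def R_def)
  have DR: "R u = D" if "u \<in> D" for u
  proof -
    have "R u \<subseteq> D" using that by (auto simp: D_def R_def intro: reachable_trans)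
    moreover have "card D \<le> card (R u)" using w(2)[of u] that D by (auto simp: D_def)
    ultimately show ?thesis using finR[of w] unfolding D_def by (intro card_seteq) auto
  qed
  have mutual: "u \<rightarrow>\<^sup>* x" if "u \<in> D" "x \<in> D" for u x
    using DR[OF that(1)] that(2) by (auto simp: R_def)
  have head_D: "head G e \<in> D" if "e \<in> arcs G" "tail G e \<in> D" "head G e \<notin> S'" for e
  proof -
    have "head G e \<in> S" using that D S by (auto simp: hersat_def)
    moreover have "tail G e \<rightarrow>\<^sup>* head G e" using that(1) by (intro reachable_adjI in_arcs_imp_in_arcs_ends)
    ultimately have "head G e \<in> R (tail G e)" using that by (simp add: R_def)
    then show ?thesis using DR that by simp
  qed
  have step: "qcls {#(tail G e, i)#} = qcls {#(head G e, i + 1)#}"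
    if e: "e \<in> arcs G" "tail G e \<in> D" "head G e \<notin> S'" for e i
  proof (rule qcls_single_arc)
    show "e \<in> out_arcs G (tail G e)" "tail G e \<in> S" using e D by auto
    \<comment> \<open>A second arc that stays outside \<open>S'\<close> would end in
      \<open>D\<close> and return as well, contrary to \<open>dc\<close>.\<close>
    show "head G f \<in> S'" if f: "f \<in> out_arcs G (tail G e)" "f \<noteq> e" for f
    proof (rule ccontr)
      assume "head G f \<notin> S'"
      then have "head G f \<in> D" "head G e \<in> D" using head_D[of f] head_D[OF e] f e by auto
      then have "f = e" using mutual e f by (intro dc) auto
      then show False using f by simp
    qed
  qed
  have walk: "qcls {#(u, i)#} = qcls {#(x, i + int (length p))#}"
    if "awalk u p x" "u \<in> D" "x \<notin> S'" for u p x i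
    using that
  proof (induction p arbitrary: u i)
    case (Cons e p)
    then have e: "e \<in> arcs G" "tail G e = u" and p: "awalk (head G e) p x" by (simp_all add: awalk_simps)
    have h: "head G e \<notin> S'" using hersat_walk[OF S' p] Cons.prems by blast
    have "qcls {#(u, i)#} = qcls {#(head G e, i + 1)#}" using step[OF e(1) _ h] e Cons.prems by simp
    also have "\<dots> = qcls {#(x, i + 1 + int (length p))#}"
      using Cons.IH[OF p] head_D[OF e(1) _ h] e Cons.prems by simp
    finally show ?case by (simp add: algebra_simps)
  qed (simp add: awalk_simps)
  have periodic_D: "periodic (qcls {#(u, i)#})" if u: "u \<in> D" for u i
  proof -
    have uS: "u \<in> S" "u \<notin> S'" using u D by auto
    \<comment> \<open>\<open>u\<close> is no sink and \<open>S'\<close> is saturated, so some arc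
      stays outside \<open>S'\<close>; closing it up inside \<open>D\<close> gives the
      period.\<close>
    have "\<not> head G ` out_arcs G u \<subseteq> S'"
      using nosink[of u] uS S' hersat_sub[OF S] unfolding hersat_def by blast
    then obtain e where "e \<in> out_arcs G u" "head G e \<notin> S'" by blast
    then have e: "e \<in> arcs G" "tail G e = u" "head G e \<notin> S'" by auto
    then have "head G e \<in> D" using head_D u by blast
    then obtain p where p: "awalk (head G e) p u" using mutual u reachable_awalk by blast
    then have "awalk u (e # p) u" using e by (simp add: awalk_simps)
    from walk[OF this u uS(2), of i] have "act QT (int (length (e # p))) (qcls {#(u, i)#}) = qcls {#(u, i)#}"
      using qcls_act[of "{#(u, i)#}"] uS by simp
    then show ?thesis unfolding periodic_def by (intro exI[of _ "length (e # p)"]) simp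
  qed
  have SS: "saturation (S' \<union> D) = S" using D head_D by (intro saturation_eq) blast+
  \<comment> \<open>Along the saturation, a vertex inherits periodicity from the finite sum over its
    arcs.\<close>
  have "periodic (qcls {#(u, i)#})" if "u \<in> saturation (S' \<union> D)" for u i
    using that
  proof (induction arbitrary: i)
    case (base u)
    show ?case
    proof (cases "u \<in> S'")
      case True
      then have "qcls {#(u, i)#} = \<one>\<^bsub>QT\<^esub>" using qcls_one_iff[of "{#(u, i)#}"] sub by auto
      then show ?thesis using periodic_one by simp
    qed (use base periodic_D in blast)
  next
    case (step u)
    have u: "u \<in> S" using saturation.step[OF step(1,2,3)] SS by blast
    have "periodic (qcls (nexts u i))"
    proof (rule periodic_qcls[OF hersat_nexts[OF S u]])
      fix v j assume "(v, j) \<in># nexts u i"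
      then obtain e where "e \<in> out_arcs G u" "v = head G e" unfolding set_nexts by blast
      then show "periodic (qcls {#(v, j)#})" using step(4) by blast
    qed
    then show ?case using qcls_nexts[OF u step(2)] by simp
  qed
  then have periodic_single: "periodic (qcls {#(u, i)#})" if "u \<in> S" for u i using that SS by simp
  show ?thesis unfolding cyclic_gamma_monoid_def
  proof
    fix x assume "x \<in> carrier QT"
    then obtain a where a: "set_mset a \<subseteq> S \<times> UNIV" "x = qcls a" unfolding qcls_carrier by blast
    have "v \<in> S" if "(v, i) \<in># a" for v i using a(1) that by blast
    then have "periodic x" unfolding a(2) by (intro periodic_qcls[OF a(1)] periodic_single)
    then obtain N where "N > 0" "act QT (int N) x = x" unfolding periodic_def by blast
    then show "\<exists>g. g \<noteq> 0 \<and> act QT g x = x" by (intro exI[of _ "int N"]) simp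
  qed
qed

end

section \<open>Composition series\<close>

context fin_digraph begin

text \<open>\<open>composition_series\<close> fixes the top to be the whole monoid. Induction on
  \<open>card S\<close> needs a chain that ends at an arbitrary \<open>ideal_of S\<close>, so the
  conditions are spelled out.\<close>

lemma hersat_chain:
  assumes dc: "disjoint_cycles G" and S: "hersat S"
  shows "\<exists>n I. (I 0 = {\<one>\<^bsub>TM\<^esub>} \<and> I n = ideal_of S \<and> (\<forall>i\<le>n. order_ideal TM (I i)) \<and>
     (\<forall>i<n. I i \<subset> I (Suc i) \<and> simple_gamma_monoid (ideal_quot TM (I (Suc i)) (I i)))) \<and>
     (\<forall>i<n. cyclic_gamma_monoid (ideal_quot TM (I (Suc i)) (I i)) \<or>
        noncomparable_gamma_monoid (ideal_quot TM (I (Suc i)) (I i)))"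
  using S
proof (induction "card S" arbitrary: S rule: less_induct)
  case less
  show ?case
  proof (cases "S = {}")
    case True
    then show ?thesis using order_ideal_ideal_of[OF hersat_empty] ideal_of_empty
      by (intro exI[of _ 0] exI[of _ "\<lambda>_. {\<one>\<^bsub>TM\<^esub>}"]) simp
  next
    case False
    have finS: "finite S" using hersat_sub[OF less.prems] finite_verts by (rule finite_subset)
    define P where "P = {R. hersat R \<and> R \<subset> S}"
    have "finite P" using finS by (intro finite_subset[of P "Pow S"]) (auto simp: P_def)
    moreover have "{} \<in> P" using False hersat_empty by (auto simp: P_def)
    \<comment> \<open>A maximal proper hereditary saturated subset makes the last factor a
      cover.\<close>
    ultimately obtain S' where S': "S' \<in> P" "\<And>R. R \<in> P \<Longrightarrow> S' \<subseteq> R \<Longrightarrow> S' = R"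
      using finite_has_maximal[of P] by blast
    have hsS': "hersat S'" "S' \<subset> S" using S'(1) by (auto simp: P_def)
    interpret hersat_cover G S S'
    proof unfold_locales
      show "hersat S" "hersat S'" "S' \<subseteq> S" using less.prems hsS' by auto
      show "R = S" if "hersat R" "S' \<subset> R" "R \<subseteq> S" for R
        using S'(2)[of R] that by (auto simp: P_def)
    qed
    have ty: "cyclic_gamma_monoid QT \<or> noncomparable_gamma_monoid QT"
    proof (cases "\<exists>v\<in>S - S'. out_arcs G v = {}")
      case True
      then show ?thesis using noncomparable_QT by blast
    next
      case False
      have "cyclic_gamma_monoid QT"
      proof (rule cyclic_QT)
        show "S - S' \<noteq> {}" using hsS'(2) by blast
      qed (use False dc disjoint_cycles_iff in blast)+
      then show ?thesis ..
    qed
    have "card S' < card S" using psubset_card_mono[OF finS hsS'(2)] .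
    from less.hyps[OF this hsS'(1)] obtain n I where I: "I 0 = {\<one>\<^bsub>TM\<^esub>}" "I n = ideal_of S'"
      "\<forall>i\<le>n. order_ideal TM (I i)"
      "\<forall>i<n. I i \<subset> I (Suc i) \<and> simple_gamma_monoid (ideal_quot TM (I (Suc i)) (I i))"
      "\<forall>i<n. cyclic_gamma_monoid (ideal_quot TM (I (Suc i)) (I i)) \<or>
        noncomparable_gamma_monoid (ideal_quot TM (I (Suc i)) (I i))" by (elim exE conjE)
    have "ideal_of S' \<noteq> ideal_of S"
    proof
      assume "ideal_of S' = ideal_of S"
      then have "verts_of (ideal_of S') = verts_of (ideal_of S)" by (rule arg_cong)
      then show False using hsS'(2) by (simp add: verts_of_ideal_of less.prems hsS'(1))
    qed
    moreover have "ideal_of S' \<subseteq> ideal_of S" using hsS'(2) by (intro ideal_of_mono psubset_imp_subset)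
    ultimately have lt: "ideal_of S' \<subset> ideal_of S" by (rule psubsetI[rotated])
    show ?thesis
    proof (intro exI[of _ "Suc n"] exI[of _ "I(Suc n := ideal_of S)"] conjI allI impI)
      fix i assume "i < Suc n"
      then consider "i < n" | "i = n" by linarith
      then show "(I(Suc n := ideal_of S)) i \<subset> (I(Suc n := ideal_of S)) (Suc i)"
        "simple_gamma_monoid (ideal_quot TM ((I(Suc n := ideal_of S)) (Suc i)) ((I(Suc n := ideal_of S)) i))"
        "cyclic_gamma_monoid (ideal_quot TM ((I(Suc n := ideal_of S)) (Suc i)) ((I(Suc n := ideal_of S)) i)) \<or>
         noncomparable_gamma_monoid (ideal_quot TM ((I(Suc n := ideal_of S)) (Suc i)) ((I(Suc n := ideal_of S)) i))"
        using I(2,4,5) lt ty simple_QT by (cases; simp)+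
    next
      fix i assume "i \<le> Suc n"
      then show "order_ideal TM ((I(Suc n := ideal_of S)) i)"
        using I(3) order_ideal_ideal_of[OF less.prems] by (cases "i = Suc n") auto
    qed (use I in auto)
  qed
qed

theorem disjoint_cycles_iff_composition_series:
  "disjoint_cycles G \<longleftrightarrow> (\<exists>n I. composition_series TM n I \<and>
     (\<forall>i<n. cyclic_gamma_monoid (ideal_quot TM (I (Suc i)) (I i)) \<or>
            noncomparable_gamma_monoid (ideal_quot TM (I (Suc i)) (I i))))" (is "_ \<longleftrightarrow> ?R")
proof
  assume "disjoint_cycles G"
  from hersat_chain[OF this hersat_verts] show ?R
    unfolding composition_series_def ideal_of_verts .
next
  assume ?R
  then obtain n I where coset: "composition_series TM n I"
    and ty': "\<forall>i<n. cyclic_gamma_monoid (ideal_quot TM (I (Suc i)) (I i)) \<or>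
            noncomparable_gamma_monoid (ideal_quot TM (I (Suc i)) (I i))"
    by (elim exE conjE)
  note coset = coset[unfolded composition_series_def]
  have I: "I 0 = {\<one>\<^bsub>TM\<^esub>}" "I n = carrier TM" by (rule coset[THEN conjunct1], rule coset[THEN conjunct2, THEN conjunct1])
  have oi: "order_ideal TM (I i)" if "i \<le> n" for i using coset that by simp
  have mono: "I i \<subset> I (Suc i)" if "i < n" for i using coset that by simp
  have ty: "cyclic_gamma_monoid (ideal_quot TM (I (Suc i)) (I i)) \<or>
            noncomparable_gamma_monoid (ideal_quot TM (I (Suc i)) (I i))" if "i < n" for i
    using ty' that by (elim allE impE)
  show "disjoint_cycles G" unfolding disjoint_cycles_iff
  proof (intro ballI impI, elim conjE, rule ccontr)
    fix e f assume ef: "e \<in> arcs G" "f \<in> arcs G" "tail G e = tail G f"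
      "head G e \<rightarrow>\<^sup>* tail G e" "head G f \<rightarrow>\<^sup>* tail G f" "e \<noteq> f"
    define u where "u = tail G e"
    have u: "u \<in> verts G" using ef by (simp add: u_def)
    have "u \<notin> verts_of (I 0)" using verts_of_ideal_of[OF hersat_empty] by (simp add: I(1) ideal_of_empty)
    moreover have "u \<in> verts_of (I n)" using verts_of_ideal_of[OF hersat_verts] u by (simp add: I(2) ideal_of_verts)
    \<comment> \<open>The chain grows from zero to everything, so \<open>u\<close> is new in some
      factor; that factor will contradict both types.\<close>
    ultimately obtain k where k: "k < n" "u \<notin> verts_of (I k)" "u \<in> verts_of (I (Suc k))"
      using ex_least_nat_less[of "\<lambda>i. u \<in> verts_of (I i)" n] by auto
    have oik: "order_ideal TM (I k)" "order_ideal TM (I (Suc k))" using oi k by auto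
    interpret hersat_pair G "verts_of (I (Suc k))" "verts_of (I k)"
    proof unfold_locales
      show "verts_of (I k) \<subseteq> verts_of (I (Suc k))" using mono[OF k(1)] by (auto simp: verts_of_def)
    qed (use order_ideal_hersat oik in blast)+
    have tu: "tail G e = u" "tail G f = u" using ef(3) by (simp_all add: u_def)
    have "\<not> noncomparable_gamma_monoid QT \<and> \<not> cyclic_gamma_monoid QT"
      using double_return_not_types[OF ef(1,2,6) tu ef(4)[unfolded tu] ef(5)[unfolded tu] k(3,2)] by (rule conjI)
    then show False using ty[OF k(1)] unfolding ideal_of_verts_of[OF oik(1)] ideal_of_verts_of[OF oik(2)] by blast
  qed
qed

end

section \<open>Growth of algebras\<close>

context kalgebra begin

lemma zero_mult: "x \<in> carrier A \<Longrightarrow> \<zero>\<^bsub>A\<^esub> \<otimes>\<^bsub>A\<^esub> x = \<zero>\<^bsub>A\<^esub>" "x \<in> carrier A \<Longrightarrow> x \<otimes>\<^bsub>A\<^esub> \<zero>\<^bsub>A\<^esub> = \<zero>\<^bsub>A\<^esub>"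
  using kalg_smult_l[of "\<zero>\<^bsub>K\<^esub>" x x] kalg_smult_r[of "\<zero>\<^bsub>K\<^esub>" x x] kalg_m_closed[of x x] by simp_all

lemma span_induct [consumes 2, case_names base zero add smult]:
  assumes "S \<subseteq> carrier A" "x \<in> span S"
    and "\<And>x. x \<in> S \<Longrightarrow> P x" "P \<zero>\<^bsub>A\<^esub>"
    and "\<And>x y. x \<in> carrier A \<Longrightarrow> y \<in> carrier A \<Longrightarrow> P x \<Longrightarrow> P y \<Longrightarrow> P (x \<oplus>\<^bsub>A\<^esub> y)"
    and "\<And>c x. c \<in> carrier K \<Longrightarrow> x \<in> carrier A \<Longrightarrow> P x \<Longrightarrow> P (c \<odot>\<^bsub>A\<^esub> x)"
  shows "P x"
proof -
  have "LinearCombinations.submodule K {x \<in> carrier A. P x} A"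
    using assms(4-6) by (intro LinearCombinations.submodule.intro module_axioms) auto
  then have "span S \<subseteq> {x \<in> carrier A. P x}"
    using assms(1,3) by (intro span_is_subset) auto
  then show ?thesis using assms(2) by blast
qed

lemma span_closed_ops:
  assumes "S \<subseteq> carrier A"
  shows "x \<in> span S \<Longrightarrow> y \<in> span S \<Longrightarrow> x \<oplus>\<^bsub>A\<^esub> y \<in> span S"
    "c \<in> carrier K \<Longrightarrow> x \<in> span S \<Longrightarrow> c \<odot>\<^bsub>A\<^esub> x \<in> span S" "\<zero>\<^bsub>A\<^esub> \<in> span S"
  using span_is_submodule[OF assms]
  by (simp_all add: LinearCombinations.submodule.m_closed LinearCombinations.submodule.smult_closed
      LinearCombinations.submodule.zero_closed)

lemma span_carrier: "S \<subseteq> carrier A \<Longrightarrow> x \<in> span S \<Longrightarrow> x \<in> carrier A"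
  using span_is_subset2 by blast

lemma span_subsetI: "S \<subseteq> span S' \<Longrightarrow> S' \<subseteq> carrier A \<Longrightarrow> span S \<subseteq> span S'"
  by (intro span_is_subset span_is_submodule)

text \<open>Bilinear extension in two passes: first in the left factor against one element of
  \<open>Y\<close>, then in the right factor.\<close>

lemma span_mult:
  assumes X: "X \<subseteq> carrier A" and Y: "Y \<subseteq> carrier A" and Z: "Z \<subseteq> carrier A"
    and XY: "\<And>x y. x \<in> X \<Longrightarrow> y \<in> Y \<Longrightarrow> x \<otimes>\<^bsub>A\<^esub> y \<in> span Z"
    and x: "x \<in> span X" and y: "y \<in> span Y"
  shows "x \<otimes>\<^bsub>A\<^esub> y \<in> span Z"
proof -
  note ops = span_closed_ops[OF Z]
  have 1: "x \<otimes>\<^bsub>A\<^esub> y \<in> span Z" if "x \<in> span X" "y \<in> Y" for x y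
    using X that(1)
  proof (induction rule: span_induct)
    case (base x)
    then show ?case using XY that by blast
  next
    case zero
    then show ?case using zero_mult ops that(2) Y by auto
  next
    case (add x x')
    then show ?case using kalg_l_distr[of x x' y] ops that(2) Y by auto
  next
    case (smult c x)
    then show ?case using kalg_smult_l[of c x y] ops that(2) Y by auto
  qed
  have xc: "x \<in> carrier A" using span_carrier[OF X x] .
  show ?thesis using Y y
  proof (induction rule: span_induct)
    case (base y)
    then show ?case using 1 x by blast
  next
    case zero
    then show ?case using zero_mult ops xc by auto
  next
    case (add y y')
    then show ?case using kalg_r_distr[of y y' x] ops xc by auto
  next
    case (smult c y)
    then show ?case using kalg_smult_r[of c x y] ops xc by auto
  qed
qed

lemma prods_carrier: "V \<subseteq> carrier A \<Longrightarrow> prods A V j \<subseteq> carrier A"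
  by (induction j) (auto intro: kalg_m_closed)

text \<open>\<open>prods A V j\<close> has \<open>j + 1\<close> factors, so indices add up with one
  extra.\<close>

lemma prods_mult:
  assumes "V \<subseteq> carrier A" "x \<in> prods A V i" "y \<in> prods A V j"
  shows "x \<otimes>\<^bsub>A\<^esub> y \<in> prods A V (Suc (i + j))"
  using assms(3)
proof (induction j arbitrary: y)
  case 0
  then show ?case using assms(2) by auto
next
  case (Suc j)
  then obtain z v where z: "z \<in> prods A V j" "v \<in> V" "y = z \<otimes>\<^bsub>A\<^esub> v" by auto
  then have "x \<otimes>\<^bsub>A\<^esub> y = (x \<otimes>\<^bsub>A\<^esub> z) \<otimes>\<^bsub>A\<^esub> v"
    using assms(1,2) prods_carrier[OF assms(1)] by (simp add: kalg_m_assoc subset_iff)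
  then show ?case using Suc.IH[OF z(1)] z(2) by auto
qed

text \<open>This is \<open>V + V^2 + ... + V^k\<close>, whose dimension is the growth function;
  \<open>k\<close> counts factors, while the index of \<open>prods\<close> is one less.\<close>

definition prodspan :: "'c set \<Rightarrow> nat \<Rightarrow> 'c set" where
  "prodspan V k = span (\<Union>j<k. prods A V j)"

lemma Un_prods_carrier: "V \<subseteq> carrier A \<Longrightarrow> (\<Union>j\<in>J. prods A V j) \<subseteq> carrier A"
  using prods_carrier by blast

lemma prodspan_mono: "k \<le> l \<Longrightarrow> prodspan V k \<subseteq> prodspan V l"
  unfolding prodspan_def by (intro span_is_monotone UN_mono) auto

lemma prodspan_mult:
  assumes V: "V \<subseteq> carrier A" and "x \<in> prodspan V k" "y \<in> prodspan V l"
  shows "x \<otimes>\<^bsub>A\<^esub> y \<in> prodspan V (k + l)"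
  unfolding prodspan_def
proof (rule span_mult[OF Un_prods_carrier[OF V] Un_prods_carrier[OF V] Un_prods_carrier[OF V]])
  show "x \<in> span (\<Union>j<k. prods A V j)" "y \<in> span (\<Union>j<l. prods A V j)"
    using assms by (simp_all add: prodspan_def)
  fix x y assume "x \<in> (\<Union>j<k. prods A V j)" "y \<in> (\<Union>j<l. prods A V j)"
  then obtain i j where "i < k" "j < l" "x \<in> prods A V i" "y \<in> prods A V j" by blast
  then have "x \<otimes>\<^bsub>A\<^esub> y \<in> (\<Union>j<k + l. prods A V j)" using prods_mult[OF V] by (intro UN_I[of "Suc (i + j)"]) auto
  then show "x \<otimes>\<^bsub>A\<^esub> y \<in> span (\<Union>j<k + l. prods A V j)"
    using in_own_span[OF Un_prods_carrier[OF V]] by blast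
qed

lemma prods_prodspan:
  assumes V: "V \<subseteq> carrier A" and W: "W \<subseteq> prodspan V k"
  shows "prods A W j \<subseteq> prodspan V (k * Suc j)"
proof (induction j)
  case (Suc j)
  show ?case
  proof
    fix x assume "x \<in> prods A W (Suc j)"
    then obtain y z where "x = y \<otimes>\<^bsub>A\<^esub> z" "y \<in> prods A W j" "z \<in> W" by auto
    then have "x \<in> prodspan V (k * Suc j + k)" using prodspan_mult[OF V] Suc W by blast
    then show "x \<in> prodspan V (k * Suc (Suc j))" by (simp add: algebra_simps)
  qed
qed (use W in simp)

text \<open>If \<open>W\<close> lies in the span of products of at most \<open>k\<close> factors
  from \<open>V\<close>, replacing \<open>V\<close> by \<open>W\<close> only rescales the argument
  by \<open>k\<close>.\<close>

lemma prodspan_prodspan: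
  assumes V: "V \<subseteq> carrier A" and W: "W \<subseteq> prodspan V k"
  shows "prodspan W n \<subseteq> prodspan V (k * n)"
proof -
  have "prods A W j \<subseteq> prodspan V (k * n)" if "j < n" for j
  proof -
    have "k * Suc j \<le> k * n" using that by (intro mult_le_mono2) simp
    then show ?thesis using prods_prodspan[OF V W, of j] prodspan_mono by blast
  qed
  then have "(\<Union>j<n. prods A W j) \<subseteq> prodspan V (k * n)" by blast
  then show ?thesis unfolding prodspan_def by (intro span_subsetI Un_prods_carrier[OF V])
qed

lemma prodspan_exhaust:
  assumes V: "V \<subseteq> carrier A" and x: "x \<in> span (\<Union>j. prods A V j)"
  shows "\<exists>k. x \<in> prodspan V k"
  using Un_prods_carrier[OF V] x
proof (induction rule: span_induct)
  case (base x)
  then obtain j where "x \<in> prods A V j" by blast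
  then have "x \<in> (\<Union>j<Suc j. prods A V j)" by blast
  then show ?case unfolding prodspan_def using in_own_span[OF Un_prods_carrier[OF V]] by blast
next
  case zero
  show ?case unfolding prodspan_def using span_closed_ops(3)[OF Un_prods_carrier[OF V]] by blast
next
  case (add x y)
  then obtain k l where "x \<in> prodspan V k" "y \<in> prodspan V l" by blast
  then have "x \<in> prodspan V (max k l)" "y \<in> prodspan V (max k l)"
    using prodspan_mono[of k "max k l" V] prodspan_mono[of l "max k l" V] by auto
  then show ?case unfolding prodspan_def using span_closed_ops(1)[OF Un_prods_carrier[OF V]] by blast
next
  case (smult c x)
  then show ?case unfolding prodspan_def using span_closed_ops(2)[OF Un_prods_carrier[OF V]] by blast
qed

text \<open>\<open>A\<close> may have infinite dimension, so the bound comes from the exchange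
  theorem: an independent subset of \<open>U\<close> has at most \<open>card N\<close> elements, and
  a maximal one is a basis of \<open>U\<close>.\<close>

lemma subspace_fin_dim:
  assumes U: "VectorSpace.subspace K U A" and N: "finite N" "N \<subseteq> carrier A" "U \<subseteq> span N"
  shows "vectorspace.fin_dim K (A\<lparr>carrier := U\<rparr>)" "vectorspace.dim K (A\<lparr>carrier := U\<rparr>) \<le> card N"
proof -
  interpret U: vectorspace K "A\<lparr>carrier := U\<rparr>" using U by (rule subspace_is_vs)
  have sm: "LinearCombinations.submodule K U A" using U by simp
  have li: "U.lin_indpt B \<longleftrightarrow> lin_indpt B" if "B \<subseteq> U" for B
    using span_li_not_depend(2)[OF that sm] by simp
  have bnd: "card B \<le> card N" if B: "finite B" "lin_indpt B" "B \<subseteq> U" for B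
  proof -
    have "B \<subseteq> span N" using B(3) N(3) by (rule subset_trans)
    from replacement[OF B(1) N(1,2) B(2) this] obtain C :: "'c set"
      where "int (card C) \<le> int (card N) - int (card B)" by blast
    then show ?thesis by linarith
  qed
  have bnd': "finite B \<and> card B \<le> card N" if B: "B \<subseteq> U \<and> lin_indpt B" for B
  proof -
    have "finite B"
    proof (rule ccontr)
      assume "infinite B"
      then obtain C where C: "C \<subseteq> B" "finite C" "card C = Suc (card N)"
        using infinite_arbitrarily_large by blast
      then have "lin_indpt C" using B subset_li_is_li by blast
      then show False using bnd[of C] C B by auto
    qed
    then show ?thesis using bnd B by blast
  qed
  have "lin_indpt {}" unfolding lin_dep_def by simp
  then obtain B where B: "finite B" "maximal B (\<lambda>S. S \<subseteq> U \<and> lin_indpt S)"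
    using maximal_exists[of "\<lambda>S. S \<subseteq> U \<and> lin_indpt S" "card N" "{}"] bnd' by blast
  have "(\<lambda>S. S \<subseteq> U \<and> lin_indpt S) = (\<lambda>S. S \<subseteq> carrier (A\<lparr>carrier := U\<rparr>) \<and> U.lin_indpt S)"
    using li by auto
  then have bas: "U.basis B" using B(2) by (intro U.max_li_is_basis) simp
  then show "U.fin_dim" using B(1) unfolding U.fin_dim_def U.basis_def by blast
  have "U.dim = card B" using U.dim_basis[OF B(1) bas] .
  then show "U.dim \<le> card N" using bnd' B(2) unfolding maximal_def by simp
qed

lemma li_le_subspace_dim:
  assumes U: "VectorSpace.subspace K U A" and N: "finite N" "N \<subseteq> carrier A" "U \<subseteq> span N"
    and B: "B \<subseteq> U" "lin_indpt B"
  shows "card B \<le> vectorspace.dim K (A\<lparr>carrier := U\<rparr>)"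
proof -
  interpret U: vectorspace K "A\<lparr>carrier := U\<rparr>" using U by (rule subspace_is_vs)
  have "U.lin_indpt B" using span_li_not_depend(2)[OF B(1)] U B(2) by simp
  then show ?thesis using U.li_le_dim(2)[OF subspace_fin_dim(1)[OF U N]] B(1) by simp
qed

lemma subspace_generators:
  assumes V: "VectorSpace.subspace K V A" and fd: "vectorspace.fin_dim K (A\<lparr>carrier := V\<rparr>)"
  obtains B where "finite B" "B \<subseteq> V" "V = span B" "V \<subseteq> carrier A"
proof -
  interpret V: vectorspace K "A\<lparr>carrier := V\<rparr>" using V by (rule subspace_is_vs)
  obtain B where B: "finite B" "B \<subseteq> V" "V.span B = V" using fd unfolding V.fin_dim_def by auto
  have sm: "LinearCombinations.submodule K V A" using V by simp
  have "span B = V" using span_li_not_depend(1)[OF B(2) sm] B(3) by simp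
  then show thesis using that B LinearCombinations.submodule.subset[OF sm] by blast
qed

lemma alg_growth_eq: "alg_growth K A V n = vectorspace.dim K (A\<lparr>carrier := prodspan V n\<rparr>)"
  by (simp add: alg_growth_def prodspan_def)

end

section \<open>Polynomial and exponential growth\<close>

lemma limsup_log_poly:
  fixes f :: "nat \<Rightarrow> nat"
  assumes "\<And>n. n \<ge> 1 \<Longrightarrow> f n \<le> C * n ^ D"
  shows "limsup (\<lambda>n. ereal (log (real n) (real (f n)))) \<le> ereal (real (Suc D))"
proof (rule Limsup_bounded)
  \<comment> \<open>From 2 on the logarithm to base \<open>n\<close> is increasing. From
    \<open>C\<close> on the constant is absorbed by one more power of \<open>n\<close>, which is the
    origin of \<open>Suc D\<close>.\<close>
  show "\<forall>\<^sub>F n in sequentially. ereal (log (real n) (real (f n))) \<le> ereal (real (Suc D))"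
    using eventually_ge_at_top[of "max 2 C"]
  proof eventually_elim
    case (elim n)
    have "f n \<le> C * n ^ D" using assms elim by simp
    also have "\<dots> \<le> n ^ Suc D" using elim by simp
    finally have le: "real (f n) \<le> real n ^ Suc D" by (metis of_nat_le_iff of_nat_power)
    show ?case
    proof (cases "f n = 0")
      case False
      then have "log (real n) (real (f n)) \<le> log (real n) (real n ^ Suc D)"
        using le elim by (subst log_le_cancel_iff) auto
      also have "\<dots> = real (Suc D)" using elim by (subst log_nat_power) auto
      finally show ?thesis by simp
    \<comment> \<open>For \<open>f n = 0\<close> the convention \<open>ln 0 = 0\<close> makes the
      logarithm 0.\<close>
    qed (simp add: log_def)
  qed
qed

lemma limsup_log_exp:
  fixes f :: "nat \<Rightarrow> nat"
  assumes "\<And>n. n \<ge> 1 \<Longrightarrow> 2 ^ n \<le> f n"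
  shows "limsup (\<lambda>n. ereal (log (real n) (real (f n)))) = \<infinity>"
proof -
  have lim: "filterlim (\<lambda>n::nat. real n * ln 2 / ln (real n)) at_top sequentially"
    by real_asymp
  have "filterlim (\<lambda>n. log (real n) (real (f n))) at_top sequentially"
  proof (rule filterlim_at_top_mono[OF lim])
    show "\<forall>\<^sub>F n in sequentially. real n * ln 2 / ln (real n) \<le> log (real n) (real (f n))"
      using eventually_ge_at_top[of 2]
    proof eventually_elim
      case (elim n)
      have "real (2 ^ n) \<le> real (f n)" using assms[of n] elim by (simp only: of_nat_le_iff)
      then have le: "2 ^ n \<le> real (f n)" by simp
      have "real n * ln 2 / ln (real n) = log (real n) (2 ^ n)" by (simp add: log_def ln_realpow)
      also have "\<dots> \<le> log (real n) (real (f n))"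
        using le elim less_le_trans[OF zero_less_power[of "2::real" n] le] by simp
      finally show ?case .
    qed
  qed
  then have "(\<lambda>n. ereal (log (real n) (real (f n)))) \<longlonglongrightarrow> \<infinity>"
    by (simp add: tendsto_PInfty filterlim_at_top_dense)
  then show ?thesis by (intro lim_imp_Limsup) auto
qed

context kalgebra begin

text \<open>A finite-dimensional \<open>U\<close> is spanned by finitely many elements, so it lies
  in \<open>prodspan X k\<close> for some \<open>k\<close>, and its growth at \<open>n\<close> is
  bounded by the hypothesis on \<open>X\<close> at \<open>k * n\<close>. The degree of the bound
  does not change.\<close>

lemma gk_dim_le:
  assumes V: "X \<subseteq> carrier A" and gen: "carrier A = span (\<Union>j. prods A X j)"
    and poly: "\<And>m. \<exists>N. finite N \<and> N \<subseteq> carrier A \<and> card N \<le> C * Suc m ^ D \<and> (\<Union>j<m. prods A X j) \<subseteq> span N"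
  shows "gk_dim K A \<le> ereal (real (Suc D))"
  unfolding gk_dim_def
proof (rule SUP_least, elim CollectE conjE)
  fix U assume "VectorSpace.subspace K U A" "vectorspace.fin_dim K (A\<lparr>carrier := U\<rparr>)"
  then obtain B where B: "finite B" "B \<subseteq> U" "U = span B" "U \<subseteq> carrier A"
    by (rule subspace_generators)
  have "\<exists>k. B \<subseteq> prodspan X k"
    using B(1,2)
  proof (induction B rule: finite_induct)
    case (insert b B)
    then obtain k where k: "B \<subseteq> prodspan X k" by auto
    have "b \<in> span (\<Union>j. prods A X j)" using insert.prems B(4) unfolding gen[symmetric] by blast
    then obtain l where l: "b \<in> prodspan X l" using prodspan_exhaust[OF V] by blast
    have "insert b B \<subseteq> prodspan X (max k l)"
      using k l prodspan_mono[of k "max k l" X] prodspan_mono[of l "max k l" X] by auto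
    then show ?case by blast
  qed simp
  then obtain k where "B \<subseteq> prodspan X k" by blast
  then have "U \<subseteq> prodspan X k" unfolding B(3) prodspan_def by (intro span_subsetI Un_prods_carrier V)
  then have sub: "prodspan U n \<subseteq> prodspan X (k * n)" for n by (rule prodspan_prodspan[OF V])
  have "alg_growth K A U n \<le> (C * Suc k ^ D) * n ^ D" if n: "n \<ge> 1" for n
  proof -
    obtain N where N: "finite N" "N \<subseteq> carrier A" "card N \<le> C * Suc (k * n) ^ D" "(\<Union>j<k * n. prods A X j) \<subseteq> span N"
      using poly[of "k * n"] by (elim exE conjE)
    have "prodspan X (k * n) \<subseteq> span N" unfolding prodspan_def using N(4,2) by (rule span_subsetI)
    then have "prodspan U n \<subseteq> span N" using sub[of n] by (rule subset_trans[rotated])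
    moreover have "VectorSpace.subspace K (prodspan U n) A"
      unfolding prodspan_def by (intro span_is_subspace Un_prods_carrier B(4))
    ultimately have "alg_growth K A U n \<le> card N"
      unfolding alg_growth_eq using N(1,2) by (intro subspace_fin_dim(2))
    also have "\<dots> \<le> C * Suc (k * n) ^ D" by (rule N(3))
    \<comment> \<open>\<open>Suc (k * n) \<le> Suc k * n\<close> holds from \<open>n = 1\<close> on
      and lets \<open>n ^ D\<close> split off.\<close>
    also have "\<dots> \<le> C * (Suc k * n) ^ D" using n by (intro mult_le_mono2 power_mono) auto
    also have "\<dots> = (C * Suc k ^ D) * n ^ D" by (simp only: power_mult_distrib mult.assoc)
    finally show ?thesis .
  qed
  then show "limsup (\<lambda>n. ereal (log (real n) (real (alg_growth K A U n)))) \<le> ereal (real (Suc D))"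
    by (rule limsup_log_poly)
qed

lemma mult_finsum:
  assumes "x \<in> carrier A" "finite S" "g \<in> S \<rightarrow> carrier A"
  shows "x \<otimes>\<^bsub>A\<^esub> (\<Oplus>\<^bsub>A\<^esub>s\<in>S. g s) = (\<Oplus>\<^bsub>A\<^esub>s\<in>S. x \<otimes>\<^bsub>A\<^esub> g s)"
  using assms(2,3)
proof (induction S rule: finite_induct)
  case (insert s S)
  then have "g s \<in> carrier A" "(\<Oplus>\<^bsub>A\<^esub>s\<in>S. g s) \<in> carrier A" by (auto intro: M.finsum_closed)
  moreover have "(\<lambda>s. x \<otimes>\<^bsub>A\<^esub> g s) \<in> S \<rightarrow> carrier A" "x \<otimes>\<^bsub>A\<^esub> g s \<in> carrier A"
    using insert assms(1) by (auto intro: kalg_m_closed)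
  ultimately show ?case using insert assms(1) by (simp add: kalg_r_distr)
qed (use assms zero_mult in simp)

lemma smult_zero_cancel:
  assumes "c \<in> carrier K" "x \<in> carrier A" "x \<noteq> \<zero>\<^bsub>A\<^esub>" "c \<odot>\<^bsub>A\<^esub> x = \<zero>\<^bsub>A\<^esub>"
  shows "c = \<zero>\<^bsub>K\<^esub>"
proof (rule ccontr)
  assume "c \<noteq> \<zero>\<^bsub>K\<^esub>"
  then have c: "inv\<^bsub>K\<^esub> c \<in> carrier K" "inv\<^bsub>K\<^esub> c \<otimes>\<^bsub>K\<^esub> c = \<one>\<^bsub>K\<^esub>" using assms(1) field_Units by (auto simp: R.Units_inv_closed)
  have "x = (inv\<^bsub>K\<^esub> c \<otimes>\<^bsub>K\<^esub> c) \<odot>\<^bsub>A\<^esub> x" using c assms by simp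
  also have "\<dots> = inv\<^bsub>K\<^esub> c \<odot>\<^bsub>A\<^esub> (c \<odot>\<^bsub>A\<^esub> x)" using c assms by (intro smult_assoc1)
  also have "\<dots> = \<zero>\<^bsub>A\<^esub>" using assms(4) c by simp
  finally show False using assms(3) by simp
qed

text \<open>The words of length \<open>n\<close> in \<open>z True\<close> and \<open>z False\<close>
  are independent: multiplying a relation from the left by a dual word in the \<open>z'\<close>
  isolates one coefficient times \<open>v\<close>. So the growth of their span is at least
  \<open>2 ^ n\<close>.\<close>

lemma gk_dim_infinite:
  fixes z z' :: "bool \<Rightarrow> 'c"
  assumes c: "v \<in> carrier A" "\<And>b. z b \<in> carrier A" "\<And>b. z' b \<in> carrier A"
    and v: "v \<noteq> \<zero>\<^bsub>A\<^esub>" "v \<otimes>\<^bsub>A\<^esub> v = v" "\<And>b. v \<otimes>\<^bsub>A\<^esub> z b = z b"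
    and orth: "\<And>b b'. z' b \<otimes>\<^bsub>A\<^esub> z b' = (if b = b' then v else \<zero>\<^bsub>A\<^esub>)"
  shows "gk_dim K A = \<infinity>"
proof -
  \<comment> \<open>\<open>wd\<close> extends on the right and \<open>dw\<close> on the left, so in
    the product of \<open>dw\<close> and \<open>wd\<close> the tails of the two lists meet in the
    middle and collapse first.\<close>
  define wd where "wd = rec_list v (\<lambda>b _ w. w \<otimes>\<^bsub>A\<^esub> z b)"
  define dw where "dw = rec_list v (\<lambda>b _ w. z' b \<otimes>\<^bsub>A\<^esub> w)"
  have wd [simp]: "wd [] = v" "wd (b # bs) = wd bs \<otimes>\<^bsub>A\<^esub> z b" and
    dw [simp]: "dw [] = v" "dw (b # bs) = z' b \<otimes>\<^bsub>A\<^esub> dw bs" for b bs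
    by (simp_all add: wd_def dw_def)
  have cl: "wd bs \<in> carrier A" "dw bs \<in> carrier A" for bs
    by (induction bs) (auto intro: kalg_m_closed c)
  have dual: "dw bs \<otimes>\<^bsub>A\<^esub> wd bs' = (if bs = bs' then v else \<zero>\<^bsub>A\<^esub>)" if "length bs = length bs'" for bs bs'
    using that
  proof (induction bs bs' rule: list_induct2)
    case (Cons b bs b' bs')
    have "dw (b # bs) \<otimes>\<^bsub>A\<^esub> wd (b' # bs') = z' b \<otimes>\<^bsub>A\<^esub> ((dw bs \<otimes>\<^bsub>A\<^esub> wd bs') \<otimes>\<^bsub>A\<^esub> z b')"
      by (simp add: kalg_m_assoc kalg_m_closed cl c)
    also have "\<dots> = (if b # bs = b' # bs' then v else \<zero>\<^bsub>A\<^esub>)"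
      unfolding Cons.IH using orth[of b b'] by (auto simp: v c zero_mult)
    finally show ?case .
  qed (simp add: v)
  define Y where "Y = {z True, z False}"
  have Yc: "Y \<subseteq> carrier A" using c by (auto simp: Y_def)
  define U where "U = span Y"
  have Uc: "U \<subseteq> carrier A" unfolding U_def using Yc by (rule span_is_subset2)
  have Usub: "VectorSpace.subspace K U A" unfolding U_def using Yc by (rule span_is_subspace)
  have Ufd: "vectorspace.fin_dim K (A\<lparr>carrier := U\<rparr>)"
    using Usub by (rule subspace_fin_dim(1)[of U Y]) (auto simp: Y_def U_def c)
  have zU: "z b \<in> U" for b
  proof -
    have "z b \<in> Y" unfolding Y_def by (cases b) auto
    then show ?thesis using in_own_span[OF Yc] unfolding U_def by blast
  qed
  have wd_prods: "wd bs \<in> prods A U n" if "length bs = Suc n" for bs n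
    using that
  proof (induction n arbitrary: bs)
    case 0
    then obtain b where "bs = [b]" by (cases bs) auto
    then show ?case using zU v by simp
  next
    case (Suc n)
    then obtain b bs' where b: "bs = b # bs'" "length bs' = Suc n" by (cases bs) auto
    show ?case using Suc.IH[OF b(2)] zU[of b] unfolding b(1) by auto
  qed
  have "2 ^ n \<le> alg_growth K A U n" if n: "n \<ge> 1" for n
  proof -
    define L where "L = {bs::bool list. length bs = n}"
    have L: "finite L" "card L = 2 ^ n"
      using finite_lists_length_eq[of "UNIV :: bool set" n] card_lists_length_eq[of "UNIV :: bool set" n]
      by (simp_all add: L_def)
    have inj: "inj_on wd L"
    proof (rule inj_onI, rule ccontr)
      fix bs bs' assume "bs \<in> L" "bs' \<in> L" "wd bs = wd bs'" "bs \<noteq> bs'"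
      then show False using dual[of bs bs'] dual[of bs bs] v(1) by (simp add: L_def)
    qed
    have li: "lin_indpt (wd ` L)"
    proof (rule finite_lin_indpt2)
      fix a assume a: "a \<in> wd ` L \<rightarrow> carrier K" "lincomb a (wd ` L) = \<zero>\<^bsub>A\<^esub>"
      show "\<forall>w\<in>wd ` L. a w = \<zero>\<^bsub>K\<^esub>"
      proof (intro ballI, elim imageE, simp only:)
        fix bs assume bs: "bs \<in> L"
        have aw: "a (wd bs) \<in> carrier K" using a(1) bs by auto
        have "\<zero>\<^bsub>A\<^esub> = dw bs \<otimes>\<^bsub>A\<^esub> lincomb a (wd ` L)" using a(2) zero_mult cl by simp
        also have "\<dots> = (\<Oplus>\<^bsub>A\<^esub>w\<in>wd ` L. dw bs \<otimes>\<^bsub>A\<^esub> (a w \<odot>\<^bsub>A\<^esub> w))"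
          unfolding lincomb_def using a(1) L cl by (intro mult_finsum) (auto intro!: smult_closed)
        also have "\<dots> = (\<Oplus>\<^bsub>A\<^esub>w\<in>wd ` L. if wd bs = w then a w \<odot>\<^bsub>A\<^esub> v else \<zero>\<^bsub>A\<^esub>)"
        proof (intro M.finsum_cong' HOL.refl)
          show "(\<lambda>w. if wd bs = w then a w \<odot>\<^bsub>A\<^esub> v else \<zero>\<^bsub>A\<^esub>) \<in> wd ` L \<rightarrow> carrier A"
            by (auto intro!: smult_closed Pi_mem[OF a(1)] c)
          fix w assume "w \<in> wd ` L"
          then obtain bs' where bs': "bs' \<in> L" "w = wd bs'" by blast
          then have w: "a w \<in> carrier K" "w \<in> carrier A" using a(1) cl by auto
          have "dw bs \<otimes>\<^bsub>A\<^esub> (a w \<odot>\<^bsub>A\<^esub> w) = a w \<odot>\<^bsub>A\<^esub> (dw bs \<otimes>\<^bsub>A\<^esub> w)"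
            using w cl by (intro kalg_smult_r)
          also have "\<dots> = (if wd bs = w then a w \<odot>\<^bsub>A\<^esub> v else \<zero>\<^bsub>A\<^esub>)"
            using dual[of bs bs'] bs bs' inj w by (auto simp: L_def inj_on_eq_iff)
          finally show "dw bs \<otimes>\<^bsub>A\<^esub> (a w \<odot>\<^bsub>A\<^esub> w) = (if wd bs = w then a w \<odot>\<^bsub>A\<^esub> v else \<zero>\<^bsub>A\<^esub>)" .
        qed
        also have "\<dots> = a (wd bs) \<odot>\<^bsub>A\<^esub> v"
          using bs L a(1) c by (intro M.finsum_singleton) auto
        finally show "a (wd bs) = \<zero>\<^bsub>K\<^esub>" using smult_zero_cancel[OF aw c(1) v(1)] by simp
      qed
    qed (use L cl in auto)
    obtain m where m: "n = Suc m" using n by (cases n) auto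
    have sub: "wd ` L \<subseteq> prodspan U n"
    proof -
      have "wd bs \<in> prods A U m" if "bs \<in> L" for bs
        using that m by (intro wd_prods) (simp add: L_def)
      then have "wd ` L \<subseteq> (\<Union>j<n. prods A U j)" using m by auto
      then show ?thesis unfolding prodspan_def using in_own_span[OF Un_prods_carrier[OF Uc]] by blast
    qed
    \<comment> \<open>\<open>U\<close> itself may be an infinite set; a finite spanning set comes
      from the products of its generators in \<open>Y\<close>.\<close>
    have fin: "finite (\<Union>j<n. prods A Y j)"
    proof (intro finite_UN_I)
      show "finite (prods A Y j)" for j
      proof (induction j)
        case (Suc j)
        have "prods A Y (Suc j) = (\<lambda>(x, y). x \<otimes>\<^bsub>A\<^esub> y) ` (prods A Y j \<times> Y)" by auto
        then show ?case using Suc by (simp add: Y_def)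
      qed (simp add: Y_def)
    qed simp
    have "U \<subseteq> prodspan Y 1" unfolding U_def prodspan_def by (simp add: lessThan_Suc)
    then have "prodspan U n \<subseteq> span (\<Union>j<n. prods A Y j)"
      using prodspan_prodspan[OF Yc, of U 1 n] by (simp add: prodspan_def)
    moreover have "VectorSpace.subspace K (prodspan U n) A"
      unfolding prodspan_def by (intro span_is_subspace Un_prods_carrier Uc)
    ultimately have "card (wd ` L) \<le> alg_growth K A U n"
      unfolding alg_growth_eq using fin Un_prods_carrier[OF Yc] sub li by (intro li_le_subspace_dim)
    then show ?thesis using card_image[OF inj] L by simp
  qed
  then have "limsup (\<lambda>n. ereal (log (real n) (real (alg_growth K A U n)))) = \<infinity>"
    by (rule limsup_log_exp)
  moreover have "limsup (\<lambda>n. ereal (log (real n) (real (alg_growth K A U n)))) \<le> gk_dim K A"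
    unfolding gk_dim_def using Usub Ufd by (intro SUP_upper) simp
  ultimately show ?thesis by simp
qed

end

section \<open>Walks and monomials\<close>

context fin_digraph begin

text \<open>The arcs strictly between the two occurrences form a walk from the head of
  \<open>e\<close> to its tail.\<close>

lemma repeated_arc_returns:
  assumes "awalk u p x" "s < t" "t < length p" "p ! s = e" "p ! t = e"
  shows "head G e \<rightarrow>\<^sup>* tail G e"
proof -
  define r where "r = drop (Suc s) p"
  have r: "t - Suc s < length r" "r ! (t - Suc s) = e" using assms by (simp_all add: r_def)
  have "p = take s p @ e # r" using assms id_take_nth_drop[of s p] by (simp add: r_def)
  moreover have "r = take (t - Suc s) r @ e # drop (Suc (t - Suc s)) r"
    using id_take_nth_drop[OF r(1)] r(2) by simp
  ultimately have "p = take s p @ e # take (t - Suc s) r @ e # drop (Suc (t - Suc s)) r" by simp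
  then have "awalk (head G e) (take (t - Suc s) r) (tail G e)"
    using assms(1) by (metis awalk_Cons_iff awalk_append_iff awlast_of_awalk)
  then show ?thesis by (rule reachable_awalkI)
qed

text \<open>A walk is recorded as its origin and its list of arcs.\<close>

definition walks_upto :: "nat \<Rightarrow> ('a \<times> 'b list) set" where
  "walks_upto m = {(u, p). (\<exists>x. awalk u p x) \<and> length p \<le> m}"

definition transit :: "'b set" where
  "transit = {e \<in> arcs G. \<not> head G e \<rightarrow>\<^sup>* tail G e}"

text \<open>Absent arcs get the default \<open>length p\<close>, one past the last index: presence
  can be read off from the value, and all values stay bounded by the length.\<close>

definition pos :: "'b list \<Rightarrow> 'b \<Rightarrow> nat" where
  "pos p e = (if e \<in> set p then LEAST t. t < length p \<and> p ! t = e else length p)"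

lemma pos_nth:
  assumes "e \<in> set p"
  shows "pos p e < length p" "p ! pos p e = e"
proof -
  obtain t where "t < length p \<and> p ! t = e" using assms by (auto simp: in_set_conv_nth)
  then have "(LEAST t. t < length p \<and> p ! t = e) < length p \<and> p ! (LEAST t. t < length p \<and> p ! t = e) = e"
    by (rule LeastI)
  then show "pos p e < length p" "p ! pos p e = e" using assms by (simp_all add: pos_def)
qed

text \<open>An arc that occurs twice lies on a closed walk, so a transit arc has only one
  position.\<close>

lemma pos_transit:
  assumes "awalk u p x" "t < length p" "p ! t \<in> transit"
  shows "pos p (p ! t) = t"
proof (rule ccontr)
  assume ne: "pos p (p ! t) \<noteq> t"
  note pn = pos_nth[of "p ! t" p, OF nth_mem[OF assms(2)]]
  have "head G (p ! t) \<rightarrow>\<^sup>* tail G (p ! t)"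
    using ne repeated_arc_returns[OF assms(1), of "pos p (p ! t)" t] repeated_arc_returns[OF assms(1), of t "pos p (p ! t)"]
      assms(2) pn by (cases "pos p (p ! t) < t") auto
  then show False using assms(3) by (simp add: transit_def)
qed

text \<open>Compare prefixes of growing length. They end at the same vertex; if one of the next arcs
  is in \<open>transit\<close>, the recorded times force it on both walks, and otherwise both arcs
  return, so disjointness of cycles leaves one choice.\<close>

lemma walk_determined:
  assumes dc: "disjoint_cycles G" and p: "awalk u p x" and q: "awalk u q y" and len: "length p = length q"
    and pos: "\<And>e. e \<in> transit \<Longrightarrow> pos p e = pos q e"
  shows "p = q"
proof -
  have "take t p = take t q" if "t \<le> length p" for t
    using that
  proof (induction t)
    case (Suc t)
    then have t: "t < length p" "t < length q" and IH: "take t p = take t q" using len by auto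
    have "p = take t p @ p ! t # drop (Suc t) p" using t by (simp add: id_take_nth_drop)
    then have ptail: "p ! t \<in> arcs G" "awalk u (take t p) (tail G (p ! t))"
      using p by (metis awalk_Cons_iff awalk_append_iff awlast_of_awalk)+
    have "q = take t q @ q ! t # drop (Suc t) q" using t by (simp add: id_take_nth_drop)
    then have qtail: "q ! t \<in> arcs G" "awalk u (take t q) (tail G (q ! t))"
      using q by (metis awalk_Cons_iff awalk_append_iff awlast_of_awalk)+
    have tl: "tail G (p ! t) = tail G (q ! t)"
      using awlast_of_awalk[OF ptail(2)] awlast_of_awalk[OF qtail(2)] IH by simp
    have "p ! t = q ! t"
    proof (cases "p ! t \<in> transit \<or> q ! t \<in> transit")
      case True
      then show ?thesis
      proof
        assume T: "p ! t \<in> transit"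
        then have "pos q (p ! t) = t" using pos_transit[OF p t(1)] pos by simp
        moreover from this have "p ! t \<in> set q" using t by (auto simp: pos_def split: if_splits)
        ultimately show ?thesis using pos_nth(2) by metis
      next
        assume T: "q ! t \<in> transit"
        then have "pos p (q ! t) = t" using pos_transit[OF q t(2)] pos by simp
        moreover from this have "q ! t \<in> set p" using t by (auto simp: pos_def split: if_splits)
        ultimately show ?thesis using pos_nth(2) by metis
      qed
    next
      case False
      then show ?thesis using dc ptail(1) qtail(1) tl unfolding disjoint_cycles_iff by (simp add: transit_def)
    qed
    then show ?case using IH t by (simp add: take_Suc_conv_app_nth)
  qed simp
  from this[of "length p"] show ?thesis using len by simp
qed

text \<open>One factor \<open>Suc m\<close> accounts for the length and one for the time of each
  transit arc. \<open>restrict\<close> puts the times into a finite function space.\<close>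

lemma card_walks_upto:
  assumes dc: "disjoint_cycles G"
  shows "finite (walks_upto m)" "card (walks_upto m) \<le> card (verts G) * Suc m ^ Suc (card transit)"
proof -
  define code where "code = (\<lambda>(u :: 'a, p). (u, length p, restrict (pos p) transit))"
  have fT: "finite transit" unfolding transit_def by simp
  have inj: "inj_on code (walks_upto m)"
  proof (rule inj_onI, clarify)
    fix u p u' q assume a: "(u, p) \<in> walks_upto m" "(u', q) \<in> walks_upto m" "code (u, p) = code (u', q)"
    then have eq: "u = u'" "length p = length q" "restrict (pos p) transit = restrict (pos q) transit"
      by (simp_all add: code_def)
    have "pos p e = pos q e" if "e \<in> transit" for e using fun_cong[OF eq(3), of e] that by simp
    moreover obtain x y where "awalk u p x" "awalk u q y" using a eq(1) by (auto simp: walks_upto_def)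
    ultimately show "u = u' \<and> p = q" using walk_determined[OF dc] eq by blast
  qed
  have "pos p e \<le> length p" for p e using pos_nth(1)[of e p] by (cases "e \<in> set p") (auto simp: pos_def)
  then have pos_le: "pos p e \<le> m" if "length p \<le> m" for p e using that le_trans by blast
  then have im: "code ` walks_upto m \<subseteq> verts G \<times> {..m} \<times> (transit \<rightarrow>\<^sub>E {..m})"
    by (auto simp: code_def walks_upto_def dest: awalk_hd_in_verts)
  have fin: "finite (verts G \<times> {..m} \<times> (transit \<rightarrow>\<^sub>E {..m}))"
    using fT by (intro finite_cartesian_product finite_PiE) auto
  show "finite (walks_upto m)" using inj im fin by (meson finite_imageD finite_subset)
  have "card (walks_upto m) = card (code ` walks_upto m)" using card_image[OF inj] by simp
  also have "\<dots> \<le> card (verts G \<times> {..m} \<times> (transit \<rightarrow>\<^sub>E {..m}))" by (rule card_mono[OF fin im])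
  also have "\<dots> = card (verts G) * Suc m ^ Suc (card transit)"
    using fT by (simp add: card_cartesian_product card_PiE)
  finally show "card (walks_upto m) \<le> card (verts G) * Suc m ^ Suc (card transit)" .
qed

end

section \<open>Monomials in a family that satisfies the Leavitt relations\<close>

locale leavitt_family = kalgebra K A + fin_digraph G
  for K :: "('k, 'm) ring_scheme" and A :: "('k, 'c, 'n) module_scheme" and G :: "('v, 'e) pre_digraph" +
  fixes vx :: "'v \<Rightarrow> 'c" and ed gh :: "'e \<Rightarrow> 'c"
  assumes vx_closed: "v \<in> verts G \<Longrightarrow> vx v \<in> carrier A"
    and ed_closed: "e \<in> arcs G \<Longrightarrow> ed e \<in> carrier A"
    and gh_closed: "e \<in> arcs G \<Longrightarrow> gh e \<in> carrier A"
    and vx_vx: "v \<in> verts G \<Longrightarrow> w \<in> verts G \<Longrightarrow> vx v \<otimes>\<^bsub>A\<^esub> vx w = (if v = w then vx v else \<zero>\<^bsub>A\<^esub>)"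
    and vx_ed: "e \<in> arcs G \<Longrightarrow> vx (tail G e) \<otimes>\<^bsub>A\<^esub> ed e = ed e"
    and ed_vx: "e \<in> arcs G \<Longrightarrow> ed e \<otimes>\<^bsub>A\<^esub> vx (head G e) = ed e"
    and vx_gh: "e \<in> arcs G \<Longrightarrow> vx (head G e) \<otimes>\<^bsub>A\<^esub> gh e = gh e"
    and gh_vx: "e \<in> arcs G \<Longrightarrow> gh e \<otimes>\<^bsub>A\<^esub> vx (tail G e) = gh e"
    and gh_ed: "e \<in> arcs G \<Longrightarrow> f \<in> arcs G \<Longrightarrow>
      gh e \<otimes>\<^bsub>A\<^esub> ed f = (if e = f then vx (head G e) else \<zero>\<^bsub>A\<^esub>)"
begin

text \<open>Folding onto a given element avoids the empty product, for which \<open>kalgebra\<close>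
  provides no identity; monomials start from a vertex instead.\<close>

definition mult_edges :: "'c \<Rightarrow> 'e list \<Rightarrow> 'c" where "mult_edges = foldl (\<lambda>x e. x \<otimes>\<^bsub>A\<^esub> ed e)"
definition mult_ghosts :: "'c \<Rightarrow> 'e list \<Rightarrow> 'c" where "mult_ghosts x p = foldr (\<lambda>e x. x \<otimes>\<^bsub>A\<^esub> gh e) p x"

text \<open>\<open>monomial v p q\<close> is \<open>v p q\<^sup>*\<close>. The ghost edges of \<open>q\<^sup>*\<close> are multiplied in reverse order.\<close>

definition monomial :: "'v \<Rightarrow> 'e list \<Rightarrow> 'e list \<Rightarrow> 'c" where "monomial v p q = mult_ghosts (mult_edges (vx v) p) q"

lemma mult_edges_simps: "mult_edges x [] = x" "mult_edges x (e # p) = mult_edges (x \<otimes>\<^bsub>A\<^esub> ed e) p" "mult_edges x (p @ [e]) = mult_edges x p \<otimes>\<^bsub>A\<^esub> ed e"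
  and mult_ghosts_simps: "mult_ghosts x [] = x" "mult_ghosts x (e # p) = mult_ghosts x p \<otimes>\<^bsub>A\<^esub> gh e"
  by (simp_all add: mult_edges_def mult_ghosts_def)

lemma mult_edges_closed: "x \<in> carrier A \<Longrightarrow> set p \<subseteq> arcs G \<Longrightarrow> mult_edges x p \<in> carrier A"
  by (induction p arbitrary: x) (auto simp: mult_edges_simps kalg_m_closed ed_closed)

lemma mult_ghosts_closed: "x \<in> carrier A \<Longrightarrow> set p \<subseteq> arcs G \<Longrightarrow> mult_ghosts x p \<in> carrier A"
  by (induction p) (auto simp: mult_ghosts_simps intro: kalg_m_closed gh_closed)

lemma mult_edges_mult: "y \<in> carrier A \<Longrightarrow> x \<in> carrier A \<Longrightarrow> set p \<subseteq> arcs G \<Longrightarrow> y \<otimes>\<^bsub>A\<^esub> mult_edges x p = mult_edges (y \<otimes>\<^bsub>A\<^esub> x) p"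
  by (induction p arbitrary: x) (auto simp: mult_edges_simps kalg_m_assoc ed_closed kalg_m_closed)

lemma mult_edges_zero: "set p \<subseteq> arcs G \<Longrightarrow> mult_edges \<zero>\<^bsub>A\<^esub> p = \<zero>\<^bsub>A\<^esub>"
  by (induction p) (auto simp: mult_edges_simps zero_mult ed_closed)

lemma monomial_closed: "awalk v p x \<Longrightarrow> awalk u q x \<Longrightarrow> monomial v p q \<in> carrier A"
  unfolding monomial_def by (intro mult_ghosts_closed mult_edges_closed vx_closed) auto

text \<open>The last factor absorbs the vertex: the ghost of the first arc of \<open>q\<close>, or
  the last arc of \<open>p\<close> if \<open>q\<close> is empty, or the vertex itself.\<close>

lemma monomial_vx_same:
  assumes "awalk v p x" "awalk u q x"
  shows "monomial v p q \<otimes>\<^bsub>A\<^esub> vx u = monomial v p q"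
proof (cases q)
  case (Cons f q')
  then have f: "f \<in> arcs G" "u = tail G f" "awalk (head G f) q' x" using assms(2) by (auto simp: awalk_simps)
  have "monomial v p q' \<in> carrier A" using monomial_closed assms(1) f by blast
  then show ?thesis using f by (simp add: Cons monomial_def mult_ghosts_simps kalg_m_assoc gh_closed vx_closed gh_vx)
next
  case Nil
  then have ux: "u = x" "x \<in> verts G" using assms by (auto simp: awalk_simps)
  have "mult_edges (vx v) p \<otimes>\<^bsub>A\<^esub> vx x = mult_edges (vx v) p"
  proof (cases p rule: rev_cases)
    case Nil
    then show ?thesis using assms(1) ux by (auto simp: mult_edges_simps vx_vx awalk_simps)
  next
    case (snoc p' e)
    then have e: "e \<in> arcs G" "head G e = x" "set p' \<subseteq> arcs G" "v \<in> verts G"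
      using assms(1) by (auto simp: awalk_simps)
    then have "mult_edges (vx v) p' \<in> carrier A" by (intro mult_edges_closed vx_closed)
    then show ?thesis using e ed_vx[OF e(1)] by (simp add: snoc mult_edges_simps kalg_m_assoc ed_closed vx_closed ux)
  qed
  then show ?thesis by (simp add: Nil monomial_def mult_ghosts_simps ux)
qed

lemma monomial_vx:
  assumes "awalk v p x" "awalk u q x" "w \<in> verts G"
  shows "monomial v p q \<otimes>\<^bsub>A\<^esub> vx w = (if w = u then monomial v p q else \<zero>\<^bsub>A\<^esub>)"
proof (cases "w = u")
  case True
  then show ?thesis using monomial_vx_same assms by simp
next
  case False
  have u: "u \<in> verts G" using assms(2) by (rule awalk_hd_in_verts)
  have "monomial v p q \<otimes>\<^bsub>A\<^esub> vx w = monomial v p q \<otimes>\<^bsub>A\<^esub> vx u \<otimes>\<^bsub>A\<^esub> vx w" using monomial_vx_same assms by simp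
  also have "\<dots> = monomial v p q \<otimes>\<^bsub>A\<^esub> (vx u \<otimes>\<^bsub>A\<^esub> vx w)"
    using monomial_closed[OF assms(1,2)] u assms(3) by (simp add: kalg_m_assoc vx_closed)
  also have "\<dots> = \<zero>\<^bsub>A\<^esub>" using False u assms(3) monomial_closed[OF assms(1,2)] by (simp add: vx_vx zero_mult)
  finally show ?thesis using False by simp
qed

lemma monomial_gh:
  assumes "awalk v p x" "awalk u q x" "e \<in> arcs G"
  shows "monomial v p q \<otimes>\<^bsub>A\<^esub> gh e = (if head G e = u then monomial v p (e # q) else \<zero>\<^bsub>A\<^esub>)"
proof -
  have "monomial v p q \<otimes>\<^bsub>A\<^esub> gh e = monomial v p q \<otimes>\<^bsub>A\<^esub> (vx (head G e) \<otimes>\<^bsub>A\<^esub> gh e)" using assms(3) by (simp add: vx_gh)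
  also have "\<dots> = monomial v p q \<otimes>\<^bsub>A\<^esub> vx (head G e) \<otimes>\<^bsub>A\<^esub> gh e"
    using monomial_closed[OF assms(1,2)] assms(3) by (simp add: kalg_m_assoc vx_closed gh_closed)
  also have "\<dots> = (if head G e = u then monomial v p (e # q) else \<zero>\<^bsub>A\<^esub>)"
    using monomial_vx[OF assms(1,2), of "head G e"] assms(3)
    by (simp add: zero_mult gh_closed monomial_def mult_ghosts_simps)
  finally show ?thesis .
qed

lemma monomial_ed_Cons:
  assumes "awalk v p x" "awalk u (f # q) x" "e \<in> arcs G"
  shows "monomial v p (f # q) \<otimes>\<^bsub>A\<^esub> ed e = (if e = f then monomial v p q else \<zero>\<^bsub>A\<^esub>)"
proof -
  have f: "f \<in> arcs G" "awalk (head G f) q x" using assms(2) by (auto simp: awalk_simps)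
  have c: "monomial v p q \<in> carrier A" using monomial_closed assms(1) f by blast
  have "monomial v p (f # q) \<otimes>\<^bsub>A\<^esub> ed e = monomial v p q \<otimes>\<^bsub>A\<^esub> (gh f \<otimes>\<^bsub>A\<^esub> ed e)"
    using c f assms(3) by (simp add: monomial_def mult_ghosts_simps kalg_m_assoc gh_closed ed_closed)
  also have "\<dots> = (if e = f then monomial v p q else \<zero>\<^bsub>A\<^esub>)"
    using c f assms(3) monomial_vx_same[OF assms(1) f(2)] by (simp add: gh_ed zero_mult)
  finally show ?thesis .
qed

lemma monomial_ed_Nil:
  assumes "awalk v p x" "e \<in> arcs G"
  shows "monomial v p [] \<otimes>\<^bsub>A\<^esub> ed e = (if tail G e = x then monomial v (p @ [e]) [] else \<zero>\<^bsub>A\<^esub>)"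
proof -
  have x: "awalk x [] x" using assms(1) by (auto simp: awalk_simps)
  have "monomial v p [] \<otimes>\<^bsub>A\<^esub> ed e = monomial v p [] \<otimes>\<^bsub>A\<^esub> (vx (tail G e) \<otimes>\<^bsub>A\<^esub> ed e)" using assms(2) by (simp add: vx_ed)
  also have "\<dots> = monomial v p [] \<otimes>\<^bsub>A\<^esub> vx (tail G e) \<otimes>\<^bsub>A\<^esub> ed e"
    using monomial_closed[OF assms(1) x] assms(2) by (simp add: kalg_m_assoc vx_closed ed_closed)
  also have "\<dots> = (if tail G e = x then monomial v (p @ [e]) [] else \<zero>\<^bsub>A\<^esub>)"
    using monomial_vx[OF assms(1) x, of "tail G e"] assms(2)
    by (simp add: zero_mult ed_closed monomial_def mult_ghosts_simps mult_edges_simps)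
  finally show ?thesis .
qed

section \<open>Counting monomials\<close>

definition gens :: "'c set" where "gens = vx ` verts G \<union> ed ` arcs G \<union> gh ` arcs G"

definition monomials :: "nat \<Rightarrow> 'c set" where
  "monomials m = {monomial v p q | v p q u x. awalk v p x \<and> awalk u q x \<and> length p + length q \<le> m}"

lemma gens_closed: "gens \<subseteq> carrier A"
  by (auto simp: gens_def vx_closed ed_closed gh_closed)

lemma monomials_I: "awalk v p x \<Longrightarrow> awalk u q x \<Longrightarrow> length p + length q \<le> m \<Longrightarrow> monomial v p q \<in> monomials m"
  unfolding monomials_def by blast

lemma monomials_mono: "m \<le> n \<Longrightarrow> monomials m \<subseteq> monomials n"
proof
  fix x assume "m \<le> n" "x \<in> monomials m"
  moreover from this obtain v p q u z where
    "x = monomial v p q" "awalk v p z" "awalk u q z" "length p + length q \<le> m" unfolding monomials_def by blast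
  ultimately show "x \<in> monomials n" by (simp add: monomials_I)
qed

lemma monomials_closed: "monomials m \<subseteq> carrier A"
  unfolding monomials_def using monomial_closed by auto

text \<open>A factor on the right annihilates the monomial, keeps it, lengthens \<open>p\<close> or
  \<open>q\<close> by one arc, or removes the first arc of \<open>q\<close>. This fits
  \<open>prods\<close>, which grows on the right.\<close>

lemma monomials_gens:
  assumes "x \<in> monomials m" "y \<in> gens"
  shows "x \<otimes>\<^bsub>A\<^esub> y \<in> insert \<zero>\<^bsub>A\<^esub> (monomials (Suc m))"
proof -
  obtain v p q u z where x: "x = monomial v p q" and w: "awalk v p z" "awalk u q z" and l: "length p + length q \<le> m"
    using assms(1) unfolding monomials_def by blast
  consider (V) w where "w \<in> verts G" "y = vx w" | (E) e where "e \<in> arcs G" "y = ed e" | (G) e where "e \<in> arcs G" "y = gh e"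
    using assms(2) unfolding gens_def by blast
  then show ?thesis
  proof cases
    case V
    have "monomial v p q \<in> monomials (Suc m)" using w l by (intro monomials_I) auto
    then show ?thesis using monomial_vx[OF w V(1)] V x by simp
  next
    case G
    have "monomial v p (e # q) \<in> monomials (Suc m)" if "head G e = u"
      using w l G that by (intro monomials_I[of v p z "tail G e"]) (auto simp: awalk_simps)
    then show ?thesis using monomial_gh[OF w G(1)] G x by simp
  next
    case E
    show ?thesis
    proof (cases q)
      case (Cons f q')
      have "monomial v p q' \<in> monomials (Suc m)" using w l Cons by (intro monomials_I[of v p z "head G f"]) (auto simp: awalk_simps)
      then show ?thesis using monomial_ed_Cons[of v p z u f q' e] w E x Cons by simp
    next
      case Nil
      have "monomial v (p @ [e]) [] \<in> monomials (Suc m)" if "tail G e = z"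
        using w l E that Nil by (intro monomials_I[of v "p @ [e]" "head G e" "head G e"]) (auto simp: awalk_simps)
      then show ?thesis using monomial_ed_Nil[OF w(1) E(1)] E x Nil by simp
    qed
  qed
qed

lemma prods_gens: "prods A gens j \<subseteq> insert \<zero>\<^bsub>A\<^esub> (monomials (Suc j))"
proof (induction j)
  case 0
  show ?case
  proof
    fix y assume y: "y \<in> prods A gens 0"
    \<comment> \<open>Each generator absorbs a vertex on its left, so it is already a product that
      starts from the monomial \<open>vx v\<close> of length 0.\<close>
    then obtain v where v: "v \<in> verts G" "vx v \<otimes>\<^bsub>A\<^esub> y = y"
      by (auto simp: gens_def vx_vx) (metis tail_in_verts head_in_verts vx_ed vx_gh)+
    have "vx v \<in> monomials 0" using monomials_I[of v "[]" v v "[]" 0] v by (simp add: monomial_def mult_edges_simps mult_ghosts_simps awalk_simps)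
    then have "vx v \<otimes>\<^bsub>A\<^esub> y \<in> insert \<zero>\<^bsub>A\<^esub> (monomials (Suc 0))" using y by (intro monomials_gens) simp_all
    then show "y \<in> insert \<zero>\<^bsub>A\<^esub> (monomials (Suc 0))" using v(2) by simp
  qed
next
  case (Suc j)
  show ?case
  proof
    fix x assume "x \<in> prods A gens (Suc j)"
    then obtain a y where a: "x = a \<otimes>\<^bsub>A\<^esub> y" "a \<in> prods A gens j" "y \<in> gens" by auto
    then have "a = \<zero>\<^bsub>A\<^esub> \<or> a \<in> monomials (Suc j)" using Suc by blast
    then show "x \<in> insert \<zero>\<^bsub>A\<^esub> (monomials (Suc (Suc j)))"
      using monomials_gens[OF _ a(3)] zero_mult gens_closed a by blast
  qed
qed

text \<open>A monomial comes from two walks of length at most \<open>m\<close>, which squares the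
  bound for walks.\<close>

lemma card_monomials:
  assumes "disjoint_cycles G"
  shows "finite (monomials m)" "card (monomials m) \<le> (card (verts G))\<^sup>2 * Suc m ^ (2 * Suc (card transit))"
proof -
  note w = card_walks_upto[OF assms, of m]
  have sub: "monomials m \<subseteq> (\<lambda>((v, p), (u, q)). monomial v p q) ` (walks_upto m \<times> walks_upto m)"
  proof
    fix x assume "x \<in> monomials m"
    then obtain v p q u z where x: "x = monomial v p q" "awalk v p z" "awalk u q z" "length p + length q \<le> m"
      unfolding monomials_def by blast
    then have "((v, p), (u, q)) \<in> walks_upto m \<times> walks_upto m" by (auto simp: walks_upto_def)
    then show "x \<in> (\<lambda>((v, p), (u, q)). monomial v p q) ` (walks_upto m \<times> walks_upto m)"
      using x(1) by (intro image_eqI[of _ _ "((v, p), (u, q))"]) auto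
  qed
  then show "finite (monomials m)" using w by (meson finite_SigmaI finite_imageI finite_subset)
  have "card (monomials m) \<le> card ((\<lambda>((v, p), (u, q)). monomial v p q) ` (walks_upto m \<times> walks_upto m))"
    using sub w by (intro card_mono) auto
  also have "\<dots> \<le> card (walks_upto m \<times> walks_upto m)" using w by (intro card_image_le) auto
  also have "\<dots> = (card (walks_upto m))\<^sup>2" by (simp add: card_cartesian_product power2_eq_square)
  also have "\<dots> \<le> (card (verts G) * Suc m ^ Suc (card transit))\<^sup>2" using w by (intro power_mono) auto
  also have "\<dots> = (card (verts G))\<^sup>2 * Suc m ^ (2 * Suc (card transit))"
    by (simp only: power_mult_distrib power_even_eq)
  finally show "card (monomials m) \<le> (card (verts G))\<^sup>2 * Suc m ^ (2 * Suc (card transit))" .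
qed

lemma gk_dim_finite:
  assumes dc: "disjoint_cycles G" and gen: "carrier A = span (\<Union>j. prods A gens j)"
  shows "gk_dim K A < \<infinity>"
proof -
  have "\<exists>N. finite N \<and> N \<subseteq> carrier A \<and> card N \<le> (card (verts G))\<^sup>2 * Suc m ^ (2 * Suc (card transit)) \<and>
      (\<Union>j<m. prods A gens j) \<subseteq> span N" for m
  proof (intro exI conjI)
    show "finite (monomials m)" "card (monomials m) \<le> (card (verts G))\<^sup>2 * Suc m ^ (2 * Suc (card transit))"
      using card_monomials[OF dc] by auto
    show "monomials m \<subseteq> carrier A" by (rule monomials_closed)
    have "monomials (Suc j) \<subseteq> monomials m" if "j < m" for j using that by (intro monomials_mono) simp
    then have "(\<Union>j<m. prods A gens j) \<subseteq> insert \<zero>\<^bsub>A\<^esub> (monomials m)" using prods_gens by blast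
    also have "\<dots> \<subseteq> span (monomials m)" using in_own_span[OF monomials_closed] span_closed_ops(3)[OF monomials_closed] by blast
    finally show "(\<Union>j<m. prods A gens j) \<subseteq> span (monomials m)" .
  qed
  from gk_dim_le[OF gens_closed gen this] show ?thesis by (rule le_less_trans) simp
qed

section \<open>Closed walks with different first arcs\<close>

lemma monomial_ghost_path:
  assumes "awalk s p x" "awalk s q x"
  shows "monomial x [] q \<otimes>\<^bsub>A\<^esub> monomial s p [] = mult_edges (monomial x [] q) p"
proof -
  have x: "awalk x [] x" using assms(1) by (auto simp: awalk_simps)
  have "monomial x [] q \<otimes>\<^bsub>A\<^esub> monomial s p [] = mult_edges (monomial x [] q \<otimes>\<^bsub>A\<^esub> vx s) p"
    unfolding monomial_def[of s] mult_ghosts_simps using monomial_closed[OF x assms(2)] assms(1)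
    by (intro mult_edges_mult vx_closed) auto
  then show ?thesis using monomial_vx_same[OF x assms(2)] by simp
qed

text \<open>The factors that meet are the ghost and the edge of the first arc; they give a vertex,
  which the remaining ghosts absorb.\<close>

lemma monomial_cancel: "awalk s p x \<Longrightarrow> mult_edges (monomial x [] p) p = vx x"
proof (induction p arbitrary: s)
  case (Cons e p)
  have x: "awalk x [] x" using Cons.prems by (auto simp: awalk_simps dest: awalk_last_in_verts)
  show ?case using monomial_ed_Cons[OF x Cons.prems, of e] Cons by (auto simp: mult_edges_simps awalk_simps)
qed (simp add: mult_edges_simps monomial_def mult_ghosts_simps)

lemma gk_dim_double_return:
  assumes ef: "e \<in> arcs G" "f \<in> arcs G" "e \<noteq> f" "tail G e = u" "tail G f = u"
    and p: "awalk (head G e) p u" and q: "awalk (head G f) q u" and ne: "vx u \<noteq> \<zero>\<^bsub>A\<^esub>"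
  shows "gk_dim K A = \<infinity>"
proof -
  define c where "c b = (if b then e # p else f # q)" for b
  have w: "awalk u (c b) u" for b using ef p q by (auto simp: c_def awalk_simps)
  have u: "awalk u [] u" using p by (auto simp: awalk_simps dest: awalk_last_in_verts)
  have uv: "u \<in> verts G" using u by (auto simp: awalk_simps)
  show ?thesis
  proof (rule gk_dim_infinite[of "vx u" "\<lambda>b. monomial u (c b) []" "\<lambda>b. monomial u [] (c b)"])
    show "vx u \<in> carrier A" using uv by (rule vx_closed)
    show "monomial u (c b) [] \<in> carrier A" for b using w u by (rule monomial_closed)
    show "monomial u [] (c b) \<in> carrier A" for b using u w by (rule monomial_closed)
    show "vx u \<otimes>\<^bsub>A\<^esub> vx u = vx u" using uv by (simp add: vx_vx)
    show "vx u \<otimes>\<^bsub>A\<^esub> monomial u (c b) [] = monomial u (c b) []" for b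
      using w[of b] uv by (auto simp: monomial_def mult_ghosts_simps mult_edges_mult vx_closed vx_vx)
    show "monomial u [] (c b) \<otimes>\<^bsub>A\<^esub> monomial u (c b') [] = (if b = b' then vx u else \<zero>\<^bsub>A\<^esub>)" for b b'
    proof (cases "b = b'")
      case True
      then show ?thesis using monomial_ghost_path[OF w w] monomial_cancel[OF w] by simp
    next
      case False
      \<comment> \<open>The two closed walks differ in their first arcs, and these are the factors
        that meet.\<close>
      then obtain g g' r r' where g: "c b = g # r" "c b' = g' # r'" "g \<noteq> g'" "g' \<in> arcs G" "set r' \<subseteq> arcs G"
        using ef w[of b'] by (cases b; cases b') (auto simp: c_def)
      have "mult_edges (monomial u [] (c b)) (c b') = mult_edges (monomial u [] (g # r) \<otimes>\<^bsub>A\<^esub> ed g') r'" using g by (simp add: mult_edges_simps)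
      also have "\<dots> = \<zero>\<^bsub>A\<^esub>"
        using monomial_ed_Cons[OF u w[of b, unfolded g(1)] g(4)] g by (simp add: mult_edges_zero)
      finally show ?thesis using monomial_ghost_path[OF w w] False by simp
    qed
  qed (rule ne)
qed

end

section \<open>Free algebras acting on points\<close>

locale free_algebra = field K
  for K :: "('k, 'm) ring_scheme" (structure) and X :: "'x set"
begin

abbreviation "F \<equiv> free_alg K X"

sublocale F: kalgebra K F
  by (rule free_alg_kalgebra) (rule field_axioms)

lemma F_val: "f \<in> carrier F \<Longrightarrow> f w \<in> carrier K"
  and F_supp: "f \<in> carrier F \<Longrightarrow> finite {w. f w \<noteq> \<zero>}"
  by (auto simp: free_alg_simps)

lemma gen_carrier: "x \<in> X \<Longrightarrow> gen K x \<in> carrier F"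
  by (rule gen_closed) (rule field_axioms)

lemma mult_gen:
  assumes "f \<in> carrier F"
  shows "f \<otimes>\<^bsub>F\<^esub> gen K x = (\<lambda>w. if w \<noteq> [] \<and> last w = x then f (butlast w) else \<zero>)"
proof
  fix w
  have "(f \<otimes>\<^bsub>F\<^esub> gen K x) w = (\<Oplus>i\<in>{..length w}. f (take i w) \<otimes> gen K x (drop i w))"
    by (simp add: free_alg_simps)
  \<comment> \<open>Only the split before the last letter leaves a single letter for the generator.
    For \<open>w = []\<close> truncated subtraction selects \<open>i = 0\<close>, where the value is
    zero as well.\<close>
  also have "\<dots> = (\<Oplus>i\<in>{..length w}. if length w - 1 = i then (if w \<noteq> [] \<and> last w = x then f (butlast w) else \<zero>) else \<zero>)"
  proof (rule finsum_cong')
    fix i assume i: "i \<in> {..length w}"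
    show "f (take i w) \<otimes> gen K x (drop i w) =
        (if length w - 1 = i then (if w \<noteq> [] \<and> last w = x then f (butlast w) else \<zero>) else \<zero>)"
    proof (cases w rule: rev_cases)
      case (snoc w' y)
      then show ?thesis using F_val[OF assms] i by (auto simp: gen_def drop_Cons' append_eq_Cons_conv)
    qed (simp add: gen_def F_val[OF assms])
  qed (use F_val[OF assms] in auto)
  also have "\<dots> = (if w \<noteq> [] \<and> last w = x then f (butlast w) else \<zero>)"
    using F_val[OF assms] by (intro finsum_singleton) auto
  finally show "(f \<otimes>\<^bsub>F\<^esub> gen K x) w = (if w \<noteq> [] \<and> last w = x then f (butlast w) else \<zero>)" .
qed

lemma gen_mult:
  assumes "f \<in> carrier F"
  shows "gen K x \<otimes>\<^bsub>F\<^esub> f = (\<lambda>w. if w \<noteq> [] \<and> hd w = x then f (tl w) else \<zero>)"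
proof
  fix w
  show "(gen K x \<otimes>\<^bsub>F\<^esub> f) w = (if w \<noteq> [] \<and> hd w = x then f (tl w) else \<zero>)"
  proof (cases w)
    case Nil
    then show ?thesis using F_val[OF assms] by (simp add: free_alg_simps gen_def)
  next
    case (Cons y w')
    have "(gen K x \<otimes>\<^bsub>F\<^esub> f) w = (\<Oplus>i\<in>{..length w}. gen K x (take i w) \<otimes> f (drop i w))"
      by (simp add: free_alg_simps)
    also have "\<dots> = (\<Oplus>i\<in>{..length w}. if 1 = i then (if y = x then f w' else \<zero>) else \<zero>)"
    proof (rule finsum_cong')
      fix i assume "i \<in> {..length w}"
      then show "gen K x (take i w) \<otimes> f (drop i w) = (if 1 = i then (if y = x then f w' else \<zero>) else \<zero>)"
        using F_val[OF assms] by (cases i) (auto simp: gen_def Cons take_Cons')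
    qed (use F_val[OF assms] in auto)
    also have "\<dots> = (if y = x then f w' else \<zero>)"
      using F_val[OF assms] by (intro finsum_singleton) (auto simp: Cons)
    finally show ?thesis by (simp add: Cons)
  qed
qed

definition delta :: "'x list \<Rightarrow> 'x list \<Rightarrow> 'k" where "delta w = (\<lambda>u. if u = w then \<one> else \<zero>)"

lemma delta_carrier: "w \<noteq> [] \<Longrightarrow> set w \<subseteq> X \<Longrightarrow> delta w \<in> carrier F"
  by (auto simp: free_alg_simps delta_def)

lemma delta_prods: "w \<noteq> [] \<Longrightarrow> set w \<subseteq> X \<Longrightarrow> delta w \<in> (\<Union>j. prods F (gen K ` X) j)"
proof (induction w rule: rev_induct)
  case (snoc x w)
  show ?case
  proof (cases "w = []")
    case True
    then have "delta (w @ [x]) = gen K x" by (auto simp: delta_def gen_def)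
    then show ?thesis using snoc.prems by (intro UN_I[of 0]) auto
  next
    case False
    then obtain j where "delta w \<in> prods F (gen K ` X) j" using snoc by auto
    moreover have "delta (w @ [x]) = delta w \<otimes>\<^bsub>F\<^esub> gen K x"
      using False snoc.prems mult_gen[OF delta_carrier[of w], of x]
      by (auto simp: delta_def fun_eq_iff)
    ultimately show ?thesis using snoc.prems by (intro UN_I[of "Suc j"]) auto
  qed
qed simp

lemma gens_sub: "gen K ` X \<subseteq> carrier F"
  using gen_carrier by auto

text \<open>Induction on the size of the support: subtracting a multiple of one word removes that
  word, and words are products of generators.\<close>

lemma F_spanned:
  assumes "f \<in> carrier F"
  shows "f \<in> F.span (\<Union>j. prods F (gen K ` X) j)"
  using assms
proof (induction "card {w. f w \<noteq> \<zero>}" arbitrary: f)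
  case 0
  then have "f = \<zero>\<^bsub>F\<^esub>" using F_supp[of f] by (auto simp: free_alg_simps)
  then show ?case using F.span_closed_ops(3)[OF F.Un_prods_carrier[OF gens_sub]] by simp
next
  case (Suc n)
  then obtain w where w: "f w \<noteq> \<zero>" by (metis (mono_tags, lifting) card.empty empty_Collect_eq nat.distinct(1))
  then have wX: "w \<noteq> []" "set w \<subseteq> X" using Suc.prems by (auto simp: free_alg_simps)
  define g where "g = f(w := \<zero>)"
  have supp: "{u. g u \<noteq> \<zero>} = {u. f u \<noteq> \<zero>} - {w}" by (auto simp: g_def)
  have "finite {u. g u \<noteq> \<zero>}" unfolding supp using F_supp[OF Suc.prems] by simp
  then have g: "g \<in> carrier F" using Suc.prems by (auto simp: free_alg_simps g_def)
  have "n = card {u. g u \<noteq> \<zero>}" using Suc(2) w F_supp[OF Suc.prems] by (simp add: supp)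
  then have "g \<in> F.span (\<Union>j. prods F (gen K ` X) j)" using Suc.hyps(1) g by blast
  moreover have "delta w \<in> F.span (\<Union>j. prods F (gen K ` X) j)"
    using delta_prods[OF wX] F.in_own_span[OF F.Un_prods_carrier[OF gens_sub]] by blast
  moreover have "f = f w \<odot>\<^bsub>F\<^esub> delta w \<oplus>\<^bsub>F\<^esub> g"
    using F_val[OF Suc.prems] by (auto simp: free_alg_simps fun_eq_iff delta_def g_def)
  ultimately show ?case using F.span_closed_ops[OF F.Un_prods_carrier[OF gens_sub]] F_val[OF Suc.prems] by metis
qed

section \<open>Linear functionals and elements that act as zero\<close>

definition lin :: "('x list \<Rightarrow> 'k) \<Rightarrow> ('x list \<Rightarrow> 'k) \<Rightarrow> 'k" where
  "lin f h = (\<Oplus>w\<in>{w. f w \<noteq> \<zero>}. f w \<otimes> h w)"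

lemma lin_superset:
  assumes "f \<in> carrier F" "\<And>w. h w \<in> carrier K" "finite W" "{w. f w \<noteq> \<zero>} \<subseteq> W"
  shows "lin f h = (\<Oplus>w\<in>W. f w \<otimes> h w)"
  unfolding lin_def
  by (rule add.finprod_mono_neutral_cong_left[OF assms(3,4)]) (use assms F_val in auto)

lemma lin_closed: "f \<in> carrier F \<Longrightarrow> (\<And>w. h w \<in> carrier K) \<Longrightarrow> lin f h \<in> carrier K"
  unfolding lin_def by (intro finsum_closed) (auto simp: F_val)

lemma lin_add:
  assumes "f \<in> carrier F" "g \<in> carrier F" and h: "\<And>w. h w \<in> carrier K"
  shows "lin (f \<oplus>\<^bsub>F\<^esub> g) h = lin f h \<oplus> lin g h"
proof -
  let ?W = "{w. f w \<noteq> \<zero>} \<union> {w. g w \<noteq> \<zero>}"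
  have W: "finite ?W" using F_supp assms by blast
  have "{w. (f \<oplus>\<^bsub>F\<^esub> g) w \<noteq> \<zero>} \<subseteq> ?W" by (auto simp: free_alg_simps)
  then have "lin (f \<oplus>\<^bsub>F\<^esub> g) h = (\<Oplus>w\<in>?W. (f \<oplus>\<^bsub>F\<^esub> g) w \<otimes> h w)"
    using assms W by (intro lin_superset) auto
  also have "\<dots> = (\<Oplus>w\<in>?W. f w \<otimes> h w \<oplus> g w \<otimes> h w)"
    using F_val assms by (intro finsum_cong') (auto simp: free_alg_simps l_distr)
  also have "\<dots> = (\<Oplus>w\<in>?W. f w \<otimes> h w) \<oplus> (\<Oplus>w\<in>?W. g w \<otimes> h w)"
    using F_val assms by (intro finsum_addf) auto
  also have "\<dots> = lin f h \<oplus> lin g h" using assms W by (simp add: lin_superset[of _ h ?W])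
  finally show ?thesis .
qed

lemma lin_smult:
  assumes "f \<in> carrier F" "c \<in> carrier K" and h: "\<And>w. h w \<in> carrier K"
  shows "lin (c \<odot>\<^bsub>F\<^esub> f) h = c \<otimes> lin f h"
proof -
  have "{w. (c \<odot>\<^bsub>F\<^esub> f) w \<noteq> \<zero>} \<subseteq> {w. f w \<noteq> \<zero>}" using assms by (auto simp: free_alg_simps)
  then have "lin (c \<odot>\<^bsub>F\<^esub> f) h = (\<Oplus>w\<in>{w. f w \<noteq> \<zero>}. (c \<odot>\<^bsub>F\<^esub> f) w \<otimes> h w)"
    using assms F_supp by (intro lin_superset) auto
  also have "\<dots> = (\<Oplus>w\<in>{w. f w \<noteq> \<zero>}. c \<otimes> (f w \<otimes> h w))"
    using F_val assms by (intro finsum_cong') (auto simp: free_alg_simps m_assoc)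
  also have "\<dots> = c \<otimes> lin f h"
    unfolding lin_def using F_val F_supp assms by (intro finsum_rdistr[symmetric]) auto
  finally show ?thesis .
qed

lemma lin_zero: "lin \<zero>\<^bsub>F\<^esub> h = \<zero>"
  by (simp add: lin_def free_alg_simps)

lemma lin_minus_zero:
  assumes "f \<in> carrier F" "g \<in> carrier F" "\<And>w. h w \<in> carrier K" "lin f h = lin g h"
  shows "lin (f \<ominus>\<^bsub>F\<^esub> g) h = \<zero>"
proof -
  have d: "f \<ominus>\<^bsub>F\<^esub> g \<in> carrier F" using assms by (intro F.M.minus_closed)
  have "f = (f \<ominus>\<^bsub>F\<^esub> g) \<oplus>\<^bsub>F\<^esub> g" using assms by (simp add: a_minus_def F.M.a_assoc F.M.l_neg)
  then have "lin f h = lin (f \<ominus>\<^bsub>F\<^esub> g) h \<oplus> lin f h" using lin_add[OF d assms(2,3)] assms(4) by simp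
  then show ?thesis
    using add.r_cancel_one'[OF lin_closed[OF assms(1,3)] lin_closed[OF d assms(3)]] by simp
qed

lemma lin_gen: "x \<in> X \<Longrightarrow> (\<And>w. h w \<in> carrier K) \<Longrightarrow> lin (gen K x) h = h [x]"
  using lin_superset[OF gen_carrier, of x h "{[x]}"] by (simp add: gen_def)

lemma lin_gen_mult:
  assumes f: "f \<in> carrier F" "x \<in> X" and h: "\<And>w. h w \<in> carrier K"
  shows "lin (gen K x \<otimes>\<^bsub>F\<^esub> f) h = lin f (\<lambda>w. h (x # w))"
proof -
  have "{w. (gen K x \<otimes>\<^bsub>F\<^esub> f) w \<noteq> \<zero>} = (#) x ` {w. f w \<noteq> \<zero>}"
    unfolding gen_mult[OF f(1)] by (auto simp: image_iff neq_Nil_conv split: if_splits)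
  then have "lin (gen K x \<otimes>\<^bsub>F\<^esub> f) h = (\<Oplus>w\<in>(#) x ` {w. f w \<noteq> \<zero>}. (gen K x \<otimes>\<^bsub>F\<^esub> f) w \<otimes> h w)"
    by (simp add: lin_def)
  also have "\<dots> = (\<Oplus>w\<in>{w. f w \<noteq> \<zero>}. (gen K x \<otimes>\<^bsub>F\<^esub> f) (x # w) \<otimes> h (x # w))"
    using F_val[OF f(1)] h by (intro finsum_reindex) (auto simp: gen_mult[OF f(1)])
  also have "\<dots> = lin f (\<lambda>w. h (x # w))"
    by (simp add: lin_def gen_mult[OF f(1)])
  finally show ?thesis .
qed

lemma lin_mult_gen:
  assumes f: "f \<in> carrier F" "x \<in> X" and h: "\<And>w. h w \<in> carrier K"
  shows "lin (f \<otimes>\<^bsub>F\<^esub> gen K x) h = lin f (\<lambda>w. h (w @ [x]))"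
proof -
  have "{w. (f \<otimes>\<^bsub>F\<^esub> gen K x) w \<noteq> \<zero>} = (\<lambda>w. w @ [x]) ` {w. f w \<noteq> \<zero>}"
  proof (intro equalityI subsetI)
    fix w assume "w \<in> {w. (f \<otimes>\<^bsub>F\<^esub> gen K x) w \<noteq> \<zero>}"
    then have "w \<noteq> []" "last w = x" "f (butlast w) \<noteq> \<zero>" unfolding mult_gen[OF f(1)] by (auto split: if_splits)
    then show "w \<in> (\<lambda>w. w @ [x]) ` {w. f w \<noteq> \<zero>}" by (intro image_eqI[of _ _ "butlast w"]) auto
  qed (auto simp: mult_gen[OF f(1)])
  then have "lin (f \<otimes>\<^bsub>F\<^esub> gen K x) h = (\<Oplus>w\<in>(\<lambda>w. w @ [x]) ` {w. f w \<noteq> \<zero>}. (f \<otimes>\<^bsub>F\<^esub> gen K x) w \<otimes> h w)"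
    by (simp add: lin_def)
  also have "\<dots> = (\<Oplus>w\<in>{w. f w \<noteq> \<zero>}. (f \<otimes>\<^bsub>F\<^esub> gen K x) (w @ [x]) \<otimes> h (w @ [x]))"
    using F_val[OF f(1)] h by (intro finsum_reindex) (auto simp: mult_gen[OF f(1)] inj_on_def)
  also have "\<dots> = lin f (\<lambda>w. h (w @ [x]))"
    by (simp add: lin_def mult_gen[OF f(1)])
  finally show ?thesis .
qed

lemma lin_finsum:
  assumes "finite S" "\<And>s. s \<in> S \<Longrightarrow> g s \<in> carrier F" and h: "\<And>w. h w \<in> carrier K"
  shows "lin (\<Oplus>\<^bsub>F\<^esub>s\<in>S. g s) h = (\<Oplus>s\<in>S. lin (g s) h)"
  using assms(1,2)
proof (induction S rule: finite_induct)
  case (insert s S)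
  then have "(\<Oplus>\<^bsub>F\<^esub>s\<in>S. g s) \<in> carrier F" by (intro F.M.finsum_closed) auto
  then show ?case using insert h lin_closed[OF _ h] by (subst F.M.finsum_insert) (auto simp: lin_add)
qed (simp add: lin_zero)

text \<open>Words act from right to left, the last letter first; \<open>None\<close> means that the
  partial map is undefined.\<close>

fun wact :: "('x \<Rightarrow> 'p \<Rightarrow> 'p option) \<Rightarrow> 'x list \<Rightarrow> 'p \<Rightarrow> 'p option" where
  "wact \<tau> [] p = Some p"
| "wact \<tau> (x # w) p = Option.bind (wact \<tau> w p) (\<tau> x)"

lemma wact_snoc: "wact \<tau> (w @ [x]) p = Option.bind (\<tau> x p) (wact \<tau> w)"
  by (induction w) (auto simp: bind_eq_Some_conv split: bind_splits)

text \<open>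
  Composing functions \<open>\<phi>\<close> with the partial maps \<open>\<tau>\<close> is a right action of the free algebra on the
  functions on points, and \<open>kills \<tau> f\<close> says that \<open>f\<close> acts as zero.
\<close>

definition pull :: "('x \<Rightarrow> 'p \<Rightarrow> 'p option) \<Rightarrow> ('p \<Rightarrow> 'k) \<Rightarrow> 'p \<Rightarrow> 'x list \<Rightarrow> 'k" where
  "pull \<tau> \<phi> p w = (case wact \<tau> w p of None \<Rightarrow> \<zero> | Some q \<Rightarrow> \<phi> q)"

definition kills :: "('x \<Rightarrow> 'p \<Rightarrow> 'p option) \<Rightarrow> ('x list \<Rightarrow> 'k) \<Rightarrow> bool" where
  "kills \<tau> f \<longleftrightarrow> f \<in> carrier F \<and> (\<forall>\<phi> p. range \<phi> \<subseteq> carrier K \<longrightarrow> lin f (pull \<tau> \<phi> p) = \<zero>)"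

lemma pull_closed: "range \<phi> \<subseteq> carrier K \<Longrightarrow> pull \<tau> \<phi> p w \<in> carrier K"
  by (auto simp: pull_def split: option.splits)

text \<open>A generator on the left changes the function \<open>\<phi>\<close>, one on the right
  moves the point \<open>p\<close>. \<open>kills\<close> quantifies over both, which makes it stable
  on both sides.\<close>

lemma kills_gen_mult:
  fixes \<tau> :: "'x \<Rightarrow> 'p \<Rightarrow> 'p option"
  assumes "kills \<tau> f" "x \<in> X"
  shows "kills \<tau> (gen K x \<otimes>\<^bsub>F\<^esub> f)"
  unfolding kills_def
proof (intro conjI allI impI)
  have f: "f \<in> carrier F" using assms by (simp add: kills_def)
  then show "gen K x \<otimes>\<^bsub>F\<^esub> f \<in> carrier F" using assms(2) gen_carrier F.kalg_m_closed by blast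
  fix \<phi> :: "'p \<Rightarrow> 'k" and p assume \<phi>: "range \<phi> \<subseteq> carrier K"
  define \<psi> where "\<psi> q = (case \<tau> x q of None \<Rightarrow> \<zero> | Some q' \<Rightarrow> \<phi> q')" for q
  have "range \<psi> \<subseteq> carrier K" using \<phi>[unfolded image_subset_iff] by (auto simp: \<psi>_def split: option.splits)
  moreover have "(\<lambda>w. pull \<tau> \<phi> p (x # w)) = pull \<tau> \<psi> p"
    by (auto simp: pull_def \<psi>_def fun_eq_iff split: option.splits)
  ultimately show "lin (gen K x \<otimes>\<^bsub>F\<^esub> f) (pull \<tau> \<phi> p) = \<zero>"
    using assms(1) lin_gen_mult[OF f assms(2) pull_closed[OF \<phi>]] by (simp add: kills_def)
qed

lemma kills_mult_gen:
  fixes \<tau> :: "'x \<Rightarrow> 'p \<Rightarrow> 'p option"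
  assumes "kills \<tau> f" "x \<in> X"
  shows "kills \<tau> (f \<otimes>\<^bsub>F\<^esub> gen K x)"
  unfolding kills_def
proof (intro conjI allI impI)
  have f: "f \<in> carrier F" using assms by (simp add: kills_def)
  then show "f \<otimes>\<^bsub>F\<^esub> gen K x \<in> carrier F" using assms(2) gen_carrier F.kalg_m_closed by blast
  fix \<phi> :: "'p \<Rightarrow> 'k" and p assume \<phi>: "range \<phi> \<subseteq> carrier K"
  have eq: "lin (f \<otimes>\<^bsub>F\<^esub> gen K x) (pull \<tau> \<phi> p) = lin f (\<lambda>w. pull \<tau> \<phi> p (w @ [x]))"
    using lin_mult_gen[OF f assms(2) pull_closed[OF \<phi>]] .
  show "lin (f \<otimes>\<^bsub>F\<^esub> gen K x) (pull \<tau> \<phi> p) = \<zero>"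
  proof (cases "\<tau> x p")
    case None
    then have "pull \<tau> \<phi> p (w @ [x]) = \<zero>" for w by (simp add: pull_def wact_snoc)
    then have "lin f (\<lambda>w. pull \<tau> \<phi> p (w @ [x])) = (\<Oplus>w\<in>{w. f w \<noteq> \<zero>}. \<zero>)"
      unfolding lin_def using F_val[OF f] by (intro finsum_cong') auto
    then show ?thesis using eq by simp
  next
    case (Some q)
    then have "(\<lambda>w. pull \<tau> \<phi> p (w @ [x])) = pull \<tau> \<phi> q" by (simp add: pull_def wact_snoc fun_eq_iff)
    then show ?thesis using eq assms(1) \<phi> by (simp add: kills_def)
  qed
qed

lemma kills_add: "kills \<tau> f \<Longrightarrow> kills \<tau> g \<Longrightarrow> kills \<tau> (f \<oplus>\<^bsub>F\<^esub> g)"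
  by (auto simp: kills_def lin_add pull_closed)

lemma kills_smult: "c \<in> carrier K \<Longrightarrow> kills \<tau> f \<Longrightarrow> kills \<tau> (c \<odot>\<^bsub>F\<^esub> f)"
  by (auto simp: kills_def lin_smult pull_closed)

lemma kills_zero: "kills \<tau> \<zero>\<^bsub>F\<^esub>"
  by (simp add: kills_def lin_zero)

lemma kills_carrier: "kills \<tau> f \<Longrightarrow> f \<in> carrier F"
  by (simp add: kills_def)

lemma prods_gen_carrier: "y \<in> prods F (gen K ` X) j \<Longrightarrow> y \<in> carrier F"
  using F.prods_carrier[OF gens_sub] by blast

text \<open>The free algebra is spanned by products of generators, so the rules for one generator
  suffice. The claim for products is quantified over \<open>f\<close>, because the next factor meets
  an element that has already been multiplied.\<close>

lemma kills_mult:
  assumes g: "g \<in> carrier F" and f: "kills \<tau> f"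
  shows "kills \<tau> (g \<otimes>\<^bsub>F\<^esub> f)" "kills \<tau> (f \<otimes>\<^bsub>F\<^esub> g)"
proof -
  have fc: "f \<in> carrier F" using f by (rule kills_carrier)
  have pr: "\<forall>f. kills \<tau> f \<longrightarrow> kills \<tau> (y \<otimes>\<^bsub>F\<^esub> f) \<and> kills \<tau> (f \<otimes>\<^bsub>F\<^esub> y)" if "y \<in> prods F (gen K ` X) j" for y j
    using that
  proof (induction j arbitrary: y)
    case 0
    then show ?case by (auto intro: kills_gen_mult kills_mult_gen)
  next
    case (Suc j)
    then obtain z x where z: "y = z \<otimes>\<^bsub>F\<^esub> gen K x" "z \<in> prods F (gen K ` X) j" "x \<in> X" by auto
    have c: "z \<in> carrier F" "gen K x \<in> carrier F" using z prods_gen_carrier gen_carrier by auto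
    show ?case
    proof (intro allI impI)
      fix f assume k: "kills \<tau> f"
      have "kills \<tau> (z \<otimes>\<^bsub>F\<^esub> (gen K x \<otimes>\<^bsub>F\<^esub> f))" "kills \<tau> ((f \<otimes>\<^bsub>F\<^esub> z) \<otimes>\<^bsub>F\<^esub> gen K x)"
        using Suc.IH[OF z(2)] k z(3) by (simp_all add: kills_gen_mult kills_mult_gen)
      then show "kills \<tau> (y \<otimes>\<^bsub>F\<^esub> f) \<and> kills \<tau> (f \<otimes>\<^bsub>F\<^esub> y)"
        using c kills_carrier[OF k] by (simp add: z(1) F.kalg_m_assoc)
    qed
  qed
  have "kills \<tau> (g \<otimes>\<^bsub>F\<^esub> f) \<and> kills \<tau> (f \<otimes>\<^bsub>F\<^esub> g)"
    using F.Un_prods_carrier[OF gens_sub] F_spanned[OF g]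
  proof (induction rule: F.span_induct)
    case (base y)
    then show ?case using pr f by blast
  next
    case zero
    then show ?case using fc by (simp add: kills_zero F.zero_mult)
  next
    case (add x y)
    then show ?case using fc by (simp add: kills_add F.kalg_l_distr F.kalg_r_distr)
  next
    case (smult c x)
    then show ?case using fc by (simp add: kills_smult F.kalg_smult_l F.kalg_smult_r)
  qed
  then show "kills \<tau> (g \<otimes>\<^bsub>F\<^esub> f)" "kills \<tau> (f \<otimes>\<^bsub>F\<^esub> g)" by auto
qed

lemma kills_ideal:
  assumes "\<And>f. f \<in> S \<Longrightarrow> kills \<tau> f" "f \<in> gen_alg_ideal K F S"
  shows "kills \<tau> f"
  using assms(2)
  by induction (auto intro: assms(1) kills_zero kills_add kills_smult kills_mult)

end

section \<open>Leavitt path algebras\<close>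

locale lpa = fin_digraph E + free_algebra K "lpa_gens E"
  for K :: "('k, 'm) ring_scheme" and E :: "('v, 'e) pre_digraph"
begin

abbreviation "IL \<equiv> gen_alg_ideal K F (lpa_rels K E)"
abbreviation "LL \<equiv> leavitt_path_algebra K E"

definition coset :: "(('v, 'e) lpa_gen list \<Rightarrow> 'k) \<Rightarrow> (('v, 'e) lpa_gen list \<Rightarrow> 'k) set" where
  "coset f = IL +>\<^bsub>F\<^esub> f"

lemma rels_sub: "lpa_rels K E \<subseteq> carrier F"
  using lpa_rels_carrier[OF field_axioms fin_digraph] .

sublocale LL: kalgebra K LL
  by (rule leavitt_path_algebra_kalgebra[OF field_axioms fin_digraph])

sublocale IL: abelian_subgroup IL F
  by (rule F.gen_alg_ideal_subgroup[OF rels_sub])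

lemma LL_carrier: "carrier LL = coset ` carrier F"
  and LL_zero: "\<zero>\<^bsub>LL\<^esub> = coset \<zero>\<^bsub>F\<^esub>"
  and LL_add: "x \<in> carrier F \<Longrightarrow> y \<in> carrier F \<Longrightarrow> coset x \<oplus>\<^bsub>LL\<^esub> coset y = coset (x \<oplus>\<^bsub>F\<^esub> y)"
  and LL_mult: "x \<in> carrier F \<Longrightarrow> y \<in> carrier F \<Longrightarrow> coset x \<otimes>\<^bsub>LL\<^esub> coset y = coset (x \<otimes>\<^bsub>F\<^esub> y)"
  and LL_smult: "c \<in> carrier K \<Longrightarrow> x \<in> carrier F \<Longrightarrow> c \<odot>\<^bsub>LL\<^esub> coset x = coset (c \<odot>\<^bsub>F\<^esub> x)"
  and LL_ideal: "x \<in> IL \<Longrightarrow> coset x = \<zero>\<^bsub>LL\<^esub>"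
  using F.quot_alg_rules[OF rels_sub] by (simp_all add: leavitt_path_algebra_def Let_def coset_def[abs_def])

lemma coset_closed: "x \<in> carrier F \<Longrightarrow> coset x \<in> carrier LL"
  by (simp add: LL_carrier)

lemma coset_eqI:
  assumes "x \<in> carrier F" "y \<in> carrier F" "x \<ominus>\<^bsub>F\<^esub> y \<in> IL"
  shows "coset x = coset y"
proof -
  have d: "x \<ominus>\<^bsub>F\<^esub> y \<in> carrier F" using assms by (intro F.M.minus_closed)
  have "x = (x \<ominus>\<^bsub>F\<^esub> y) \<oplus>\<^bsub>F\<^esub> y" using assms by (simp add: a_minus_def F.M.a_assoc F.M.l_neg)
  then have "coset x = coset (x \<ominus>\<^bsub>F\<^esub> y) \<oplus>\<^bsub>LL\<^esub> coset y" using d assms by (simp add: LL_add)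
  also have "\<dots> = coset y" using LL_ideal[OF assms(3)] assms(2) coset_closed by simp
  finally show ?thesis .
qed

lemma coset_zeroD:
  assumes "x \<in> carrier F" "coset x = \<zero>\<^bsub>LL\<^esub>"
  shows "x \<in> IL"
proof -
  have "\<zero>\<^bsub>LL\<^esub> = IL" unfolding LL_zero coset_def using IL.a_subset by (intro F.M.a_coset_add_zero)
  then show ?thesis using IL.a_rcos_self[OF assms(1)] assms(2) by (simp add: coset_def)
qed

abbreviation "V v \<equiv> gen K (Vertex v)"
abbreviation "D e \<equiv> gen K (Edge e)"
abbreviation "H e \<equiv> gen K (Ghost e)"

lemma VDH_closed [simp]:
  "v \<in> verts E \<Longrightarrow> V v \<in> carrier F" "e \<in> arcs E \<Longrightarrow> D e \<in> carrier F" "e \<in> arcs E \<Longrightarrow> H e \<in> carrier F"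
  by (rule gen_carrier, simp add: lpa_gens_def)+

lemma rel_eqI:
  assumes "x \<ominus>\<^bsub>F\<^esub> y \<in> lpa_rels K E" "x \<in> carrier F" "y \<in> carrier F"
  shows "coset x = coset y"
  using assms by (intro coset_eqI gen_alg_ideal.base)

sublocale leavitt_family K LL E "\<lambda>v. coset (V v)" "\<lambda>e. coset (D e)" "\<lambda>e. coset (H e)"
proof
  fix v w assume v: "v \<in> verts E" and w: "w \<in> verts E"
  have "V v \<otimes>\<^bsub>F\<^esub> V w \<ominus>\<^bsub>F\<^esub> (if v = w then V v else \<zero>\<^bsub>F\<^esub>) \<in> lpa_rels K E"
    unfolding lpa_rels_def Let_def using v w by blast
  then have "coset (V v \<otimes>\<^bsub>F\<^esub> V w) = coset (if v = w then V v else \<zero>\<^bsub>F\<^esub>)"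
    using v w by (intro rel_eqI) (auto simp: F.kalg_m_closed)
  then show "coset (V v) \<otimes>\<^bsub>LL\<^esub> coset (V w) = (if v = w then coset (V v) else \<zero>\<^bsub>LL\<^esub>)"
    using v w by (simp add: LL_mult LL_zero)
next
  fix e assume e: "e \<in> arcs E"
  have r: "V (tail E e) \<otimes>\<^bsub>F\<^esub> D e \<ominus>\<^bsub>F\<^esub> D e \<in> lpa_rels K E" "D e \<otimes>\<^bsub>F\<^esub> V (head E e) \<ominus>\<^bsub>F\<^esub> D e \<in> lpa_rels K E"
    "V (head E e) \<otimes>\<^bsub>F\<^esub> H e \<ominus>\<^bsub>F\<^esub> H e \<in> lpa_rels K E" "H e \<otimes>\<^bsub>F\<^esub> V (tail E e) \<ominus>\<^bsub>F\<^esub> H e \<in> lpa_rels K E"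
    unfolding lpa_rels_def Let_def using e by blast+
  have c: "V (tail E e) \<in> carrier F" "V (head E e) \<in> carrier F" "D e \<in> carrier F" "H e \<in> carrier F" using e by auto
  show "coset (V (tail E e)) \<otimes>\<^bsub>LL\<^esub> coset (D e) = coset (D e)" "coset (D e) \<otimes>\<^bsub>LL\<^esub> coset (V (head E e)) = coset (D e)"
    "coset (V (head E e)) \<otimes>\<^bsub>LL\<^esub> coset (H e) = coset (H e)" "coset (H e) \<otimes>\<^bsub>LL\<^esub> coset (V (tail E e)) = coset (H e)"
    using r[THEN rel_eqI] c by (simp_all add: LL_mult F.kalg_m_closed)
next
  fix e f assume e: "e \<in> arcs E" and f: "f \<in> arcs E"
  have "H e \<otimes>\<^bsub>F\<^esub> D f \<ominus>\<^bsub>F\<^esub> (if e = f then V (head E e) else \<zero>\<^bsub>F\<^esub>) \<in> lpa_rels K E"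
    unfolding lpa_rels_def Let_def using e f by blast
  then have "coset (H e \<otimes>\<^bsub>F\<^esub> D f) = coset (if e = f then V (head E e) else \<zero>\<^bsub>F\<^esub>)"
    using e f by (intro rel_eqI) (auto simp: F.kalg_m_closed)
  then show "coset (H e) \<otimes>\<^bsub>LL\<^esub> coset (D f) = (if e = f then coset (V (head E e)) else \<zero>\<^bsub>LL\<^esub>)"
    using e f by (simp add: LL_mult LL_zero)
qed (auto intro: coset_closed)

lemma gens_eq: "gens = coset ` gen K ` lpa_gens E"
  unfolding gens_def lpa_gens_def by (simp add: image_Un image_image)

lemma coset_prods: "x \<in> prods F (gen K ` lpa_gens E) j \<Longrightarrow> coset x \<in> prods LL gens j"
proof (induction j arbitrary: x)
  case 0
  then show ?case by (simp add: gens_eq)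
next
  case (Suc j)
  then obtain y z where y: "x = y \<otimes>\<^bsub>F\<^esub> z" "y \<in> prods F (gen K ` lpa_gens E) j" "z \<in> gen K ` lpa_gens E" by auto
  then have "coset x = coset y \<otimes>\<^bsub>LL\<^esub> coset z" using prods_gen_carrier gens_sub by (auto simp: LL_mult)
  moreover have "coset z \<in> gens" using y(3) unfolding gens_eq by (rule imageI)
  ultimately show ?case using Suc.IH[OF y(2)] by auto
qed

lemma LL_spanned: "carrier LL = LL.span (\<Union>j. prods LL gens j)"
proof
  note G = LL.Un_prods_carrier[OF gens_closed]
  show "LL.span (\<Union>j. prods LL gens j) \<subseteq> carrier LL" using G by (rule LL.span_is_subset2)
  note ops = LL.span_closed_ops[OF G]
  have "coset f \<in> LL.span (\<Union>j. prods LL gens j)" if "f \<in> carrier F" for f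
    using F.Un_prods_carrier[OF gens_sub] F_spanned[OF that]
  proof (induction rule: F.span_induct)
    case (base x)
    then have "coset x \<in> (\<Union>j. prods LL gens j)" using coset_prods by blast
    then show ?case using LL.in_own_span[OF G] by blast
  next
    case zero
    then show ?case using ops(3) by (simp add: LL_zero)
  next
    case (add x y)
    then show ?case using ops(1) by (simp flip: LL_add)
  next
    case (smult c x)
    then show ?case using ops(2) by (simp flip: LL_smult)
  qed
  then show "carrier LL \<subseteq> LL.span (\<Union>j. prods LL gens j)" by (auto simp: LL_carrier)
qed

section \<open>A representation by partial maps\<close>

text \<open>
  The generators act on pairs of a vertex and a number. The copy \<open>{v} \<times> \<nat>\<close> over a vertex that is not a sink
  is split by residues modulo \<open>deg v\<close> into one copy of \<open>\<nat>\<close> for each arc that leaves \<open>v\<close>, which is what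
  the last Leavitt relation asks for. It follows that vertices do not vanish in the algebra.
\<close>

definition deg :: "'v \<Rightarrow> nat" where "deg v = card (out_arcs E v)"

definition idx :: "'e \<Rightarrow> nat" where
  "idx e = (SOME h. bij_betw h (out_arcs E (tail E e)) {..<deg (tail E e)}) e"

text \<open>The choice in \<open>idx\<close> depends only on the tail, so one bijection numbers all
  arcs leaving \<open>v\<close>.\<close>

lemma idx_bij: "bij_betw idx (out_arcs E v) {..<deg v}"
proof -
  have "\<exists>h. bij_betw h (out_arcs E v) {0..<deg v}"
    unfolding deg_def using finite_out_arcs by (rule ex_bij_betw_finite_nat)
  then have "bij_betw (SOME h. bij_betw h (out_arcs E v) {..<deg v}) (out_arcs E v) {..<deg v}"
    unfolding atLeast0LessThan by (rule someI_ex)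
  then show ?thesis by (rule bij_betw_cong[THEN iffD1, rotated]) (auto simp: idx_def)
qed

fun branch :: "('v, 'e) lpa_gen \<Rightarrow> 'v \<times> nat \<Rightarrow> ('v \<times> nat) option" where
  "branch (Vertex v) (u, n) = (if u = v then Some (u, n) else None)"
| "branch (Edge e) (u, n) = (if u = head E e then Some (tail E e, deg (tail E e) * n + idx e) else None)"
| "branch (Ghost e) (u, n) = (if u = tail E e \<and> n mod deg u = idx e then Some (head E e, n div deg u) else None)"

lemma idx_less: "e \<in> arcs E \<Longrightarrow> idx e < deg (tail E e)"
  using idx_bij[of "tail E e"] by (auto simp: bij_betw_def)

lemma idx_inj: "e \<in> arcs E \<Longrightarrow> f \<in> arcs E \<Longrightarrow> tail E e = tail E f \<Longrightarrow> idx e = idx f \<Longrightarrow> e = f"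
  using idx_bij[of "tail E e"] by (auto simp: bij_betw_def inj_on_def)

lemma kills_minus:
  assumes "x \<in> carrier F" "y \<in> carrier F"
    and "\<And>\<phi> p. range \<phi> \<subseteq> carrier K \<Longrightarrow> lin x (pull branch \<phi> p) = lin y (pull branch \<phi> p)"
  shows "kills branch (x \<ominus>\<^bsub>F\<^esub> y)"
  unfolding kills_def
  using assms by (auto intro!: F.M.minus_closed lin_minus_zero pull_closed)

lemma lin_gen2:
  assumes "x \<in> lpa_gens E" "y \<in> lpa_gens E" "\<And>w. h w \<in> carrier K"
  shows "lin (gen K x \<otimes>\<^bsub>F\<^esub> gen K y) h = h [x, y]"
  using lin_gen_mult[OF gen_carrier[OF assms(2)] assms(1,3)] lin_gen[OF assms(2), of "\<lambda>w. h (x # w)"] assms(3)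
  by simp

lemma in_gens: "v \<in> verts E \<Longrightarrow> Vertex v \<in> lpa_gens E" "e \<in> arcs E \<Longrightarrow> Edge e \<in> lpa_gens E"
  "e \<in> arcs E \<Longrightarrow> Ghost e \<in> lpa_gens E"
  by (auto simp: lpa_gens_def)

lemma lin_pull2:
  "x \<in> lpa_gens E \<Longrightarrow> y \<in> lpa_gens E \<Longrightarrow> range \<phi> \<subseteq> carrier K \<Longrightarrow>
    lin (gen K x \<otimes>\<^bsub>F\<^esub> gen K y) (pull branch \<phi> p) = pull branch \<phi> p [x, y]"
  by (rule lin_gen2[OF _ _ pull_closed])

lemma lin_pull1:
  "x \<in> lpa_gens E \<Longrightarrow> range \<phi> \<subseteq> carrier K \<Longrightarrow> lin (gen K x) (pull branch \<phi> p) = pull branch \<phi> p [x]"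
  by (rule lin_gen[OF _ pull_closed])

text \<open>Words act from the right, so \<open>Edge e\<close> carries points over the head to
  points over the tail and \<open>Ghost e\<close> leads back. \<open>Ghost e\<close> after
  \<open>Edge f\<close> compares tails and residues; \<open>Edge e\<close> after
  \<open>Ghost e\<close> is the identity on the points with residue \<open>idx e\<close>, and the
  residues partition the points over \<open>v\<close>.\<close>

lemma kills_rels:
  assumes "r \<in> lpa_rels K E"
  shows "kills branch r"
proof -
  note ls = lin_pull2 lin_pull1 lin_zero in_gens
  note c = F.kalg_m_closed
  have 1: "kills branch (V v \<otimes>\<^bsub>F\<^esub> V w \<ominus>\<^bsub>F\<^esub> (if v = w then V v else \<zero>\<^bsub>F\<^esub>))" if "v \<in> verts E" "w \<in> verts E" for v w
    using that by (intro kills_minus) (auto simp: ls c pull_def)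
  have 2: "kills branch (V (tail E e) \<otimes>\<^bsub>F\<^esub> D e \<ominus>\<^bsub>F\<^esub> D e)" "kills branch (D e \<otimes>\<^bsub>F\<^esub> V (head E e) \<ominus>\<^bsub>F\<^esub> D e)"
    "kills branch (V (head E e) \<otimes>\<^bsub>F\<^esub> H e \<ominus>\<^bsub>F\<^esub> H e)" "kills branch (H e \<otimes>\<^bsub>F\<^esub> V (tail E e) \<ominus>\<^bsub>F\<^esub> H e)"
    if "e \<in> arcs E" for e
    using that by (intro kills_minus; auto simp: ls c pull_def)+
  have 3: "kills branch (H e \<otimes>\<^bsub>F\<^esub> D f \<ominus>\<^bsub>F\<^esub> (if e = f then V (head E e) else \<zero>\<^bsub>F\<^esub>))" if "e \<in> arcs E" "f \<in> arcs E" for e f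
    using that idx_less[OF that(1)] idx_less[OF that(2)] idx_inj[OF that]
    by (intro kills_minus) (auto simp: ls c pull_def)
  have 4: "kills branch (V v \<ominus>\<^bsub>F\<^esub> (\<Oplus>\<^bsub>F\<^esub>e\<in>out_arcs E v. D e \<otimes>\<^bsub>F\<^esub> H e))" if v: "v \<in> verts E" "out_arcs E v \<noteq> {}" for v
  proof (rule kills_minus)
    have oc: "D e \<otimes>\<^bsub>F\<^esub> H e \<in> carrier F" if "e \<in> out_arcs E v" for e using that by (simp add: c)
    show "(\<Oplus>\<^bsub>F\<^esub>e\<in>out_arcs E v. D e \<otimes>\<^bsub>F\<^esub> H e) \<in> carrier F" using oc by (intro F.M.finsum_closed) auto
    show "V v \<in> carrier F" using v by simp
    fix \<phi> :: "'v \<times> nat \<Rightarrow> 'k" and p :: "'v \<times> nat"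
    assume \<phi>: "range \<phi> \<subseteq> carrier K"
    have \<phi>p: "\<phi> p \<in> carrier K" using \<phi> by (rule subsetD) (rule rangeI)
    obtain u n where p: "p = (u, n)" by fastforce
    have "lin (\<Oplus>\<^bsub>F\<^esub>e\<in>out_arcs E v. D e \<otimes>\<^bsub>F\<^esub> H e) (pull branch \<phi> p) =
        (\<Oplus>\<^bsub>K\<^esub>e\<in>out_arcs E v. lin (D e \<otimes>\<^bsub>F\<^esub> H e) (pull branch \<phi> p))"
      using oc finite_out_arcs pull_closed[OF \<phi>] by (intro lin_finsum) auto
    also have "\<dots> = (\<Oplus>\<^bsub>K\<^esub>e\<in>out_arcs E v. pull branch \<phi> p [Edge e, Ghost e])"
      using pull_closed[OF \<phi>] by (intro finsum_cong') (auto simp: lin_gen2 in_gens)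
    also have "\<dots> = pull branch \<phi> p [Vertex v]"
    proof (cases "u = v")
      case False
      then have "(\<Oplus>\<^bsub>K\<^esub>e\<in>out_arcs E v. pull branch \<phi> p [Edge e, Ghost e]) = (\<Oplus>\<^bsub>K\<^esub>e\<in>out_arcs E v. \<zero>\<^bsub>K\<^esub>)"
        by (intro finsum_cong') (auto simp: pull_def p)
      then show ?thesis using False by (simp add: pull_def p)
    next
      case True
      have "deg v > 0" unfolding deg_def using v(2) finite_out_arcs[of v] by (simp add: card_gt_0_iff)
      \<comment> \<open>The residue of \<open>n\<close> is the number of exactly one arc leaving
        \<open>v\<close>, so a single summand remains.\<close>
      then have "n mod deg v \<in> idx ` out_arcs E v" using idx_bij[of v] by (auto simp: bij_betw_def)
      then obtain e where e: "e \<in> out_arcs E v" "idx e = n mod deg v" by auto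
      have "(\<Oplus>\<^bsub>K\<^esub>f\<in>out_arcs E v. pull branch \<phi> p [Edge f, Ghost f]) = (\<Oplus>\<^bsub>K\<^esub>f\<in>out_arcs E v. if e = f then \<phi> p else \<zero>\<^bsub>K\<^esub>)"
      proof (intro finsum_cong' HOL.refl)
        fix f assume f: "f \<in> out_arcs E v"
        show "pull branch \<phi> p [Edge f, Ghost f] = (if e = f then \<phi> p else \<zero>\<^bsub>K\<^esub>)"
        proof (cases "e = f")
          case True
          then show ?thesis using e \<open>u = v\<close> mult_div_mod_eq[of "deg v" n] by (auto simp: pull_def p)
        next
          case False
          then have "idx f \<noteq> n mod deg v" using e f idx_inj[of e f] by auto
          moreover have "tail E f = v" using f by simp
          ultimately show ?thesis using False \<open>u = v\<close> by (simp add: pull_def p)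
        qed
      qed (use \<phi>p in auto)
      also have "\<dots> = \<phi> p" using e(1) finite_out_arcs \<phi>p by (intro finsum_singleton) auto
      finally show ?thesis using True by (simp add: pull_def p)
    qed
    also have "\<dots> = lin (V v) (pull branch \<phi> p)" using v pull_closed[OF \<phi>] by (simp add: lin_gen in_gens)
    finally show "lin (V v) (pull branch \<phi> p) = lin (\<Oplus>\<^bsub>F\<^esub>e\<in>out_arcs E v. D e \<otimes>\<^bsub>F\<^esub> H e) (pull branch \<phi> p)" ..
  qed
  show ?thesis using assms 1 2 3 4 unfolding lpa_rels_def Let_def by blast
qed

lemma vertex_nonzero:
  assumes v: "v \<in> verts E"
  shows "coset (V v) \<noteq> \<zero>\<^bsub>LL\<^esub>"
proof
  assume "coset (V v) = \<zero>\<^bsub>LL\<^esub>"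
  then have "V v \<in> IL" using v by (intro coset_zeroD) auto
  then have k: "kills branch (V v)" using kills_rels by (rule kills_ideal[rotated])
  \<comment> \<open>\<open>Vertex v\<close> fixes the point \<open>(v, 0)\<close>, so the constant
    function 1 evaluates to 1 there, whereas a killed element would give 0.\<close>
  have "lin (V v) (pull branch (\<lambda>_. \<one>\<^bsub>K\<^esub>) (v, 0)) = \<zero>\<^bsub>K\<^esub>" using k unfolding kills_def by auto
  moreover have "lin (V v) (pull branch (\<lambda>_. \<one>\<^bsub>K\<^esub>) (v, 0)) = \<one>\<^bsub>K\<^esub>"
    using v by (subst lin_gen) (auto simp: in_gens pull_closed, simp add: pull_def)
  ultimately show False by simp
qed

theorem disjoint_cycles_iff_gk_dim: "disjoint_cycles E \<longleftrightarrow> gk_dim K LL < \<infinity>"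
proof
  assume "disjoint_cycles E"
  then show "gk_dim K LL < \<infinity>" using LL_spanned by (rule gk_dim_finite)
next
  assume fin: "gk_dim K LL < \<infinity>"
  show "disjoint_cycles E" unfolding disjoint_cycles_iff
  proof (intro ballI impI, elim conjE, rule ccontr)
    fix e f assume ef: "e \<in> arcs E" "f \<in> arcs E" "tail E e = tail E f"
      "head E e \<rightarrow>\<^sup>*\<^bsub>E\<^esub> tail E e" "head E f \<rightarrow>\<^sup>*\<^bsub>E\<^esub> tail E f" "e \<noteq> f"
    obtain p where p: "awalk (head E e) p (tail E e)" using ef(4) reachable_awalk by blast
    obtain q where q: "awalk (head E f) q (tail E e)" using ef(3,5) reachable_awalk by auto
    have "gk_dim K LL = \<infinity>"
      using gk_dim_double_return[OF ef(1,2,6) HOL.refl ef(3)[symmetric] p q vertex_nonzero] ef(1) by simp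
    then show False using fin by simp
  qed
qed

end

theorem theorem4p2:
  fixes E :: "('v, 'e) pre_digraph" and K :: "('k, 'm) ring_scheme"
  assumes "fin_digraph E" and "field K"
  shows "(disjoint_cycles E \<longleftrightarrow>
            (\<exists>n I. composition_series (talented_monoid E) n I \<and>
              (\<forall>i<n. cyclic_gamma_monoid (ideal_quot (talented_monoid E) (I (Suc i)) (I i)) \<or>
                     noncomparable_gamma_monoid (ideal_quot (talented_monoid E) (I (Suc i)) (I i)))))
       \<and> (disjoint_cycles E \<longleftrightarrow> gk_dim K (leavitt_path_algebra K E) < \<infinity>)"
proof -
  interpret lpa K E using assms by (simp add: lpa_def free_algebra_def)
  show ?thesis using disjoint_cycles_iff_composition_series disjoint_cycles_iff_gk_dim by (rule conjI)
qed

end
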